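(* Suppose $E\subset\mathbb{R}^d$, $d\ge 2$, and $\dim_{\mathcal H}(E)+\beta(\dim_{\mathcal H}(E))>d$, where $\beta(\cdot)$ is the exponent in the spherical average estimate (as stated in the context). Then for any positive integer $k$, the $k$-chain set $$\{(|x_1-x_2|,\dots,|x_k-x_{k+1}|): x_j\in E\}$$ has positive $k$-dimensional Lebesgue measure.
   Context: $\dim_{\mathcal H}$ denotes Hausdorff dimension. $\widehat{\mu}(\xi)=\int e^{-2\pi i x\cdot\xi}\,d\mu(x)$ is the Fourier transform, and $d\omega$ is the normalized surface measure on the unit sphere $S^{d-1}$. $X\lesssim Y$ means $X\le CY$ for some constant $C>0$, and $X\lesssim_\epsilon Y$ means $X\le C_\epsilon Y$ for some constant $C_\epsilon>0$ depending on $\epsilon$. Spherical average estimate with exponent $\beta(\cdot)$: for any probability measure $\mu$ satisfying $\mu(B(x,r))\lesssim r^{s_\mu}$ for all $x\in\mathbb{R}^d$, $r>0$, one has $$\int_{S^{d-1}}|\widehat{\mu}(r\omega)|^2\,d\omega\lesssim_\epsilon r^{-\beta(s_\mu)+\epsilon}.$$ (For instance, this is known with $\beta(s)=s$ for $s\in(0,\frac{d-1}{2}]$ and $\beta(s)=\frac{d-1}{2}$ for $s\in[\frac{d-1}{2},\frac d2]$ by Mattila, and with $\beta(s)=\frac{d+2s-2}{4}$ for $s\in[\frac d2,\frac d2+1]$ by Wolff and Erdoğan.)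
   Formalization: The set E is assumed to be Borel; for arbitrary subsets of R^d the k-chain set can be non-measurable, and under the continuum hypothesis it can be null. *)

theory Defs
  imports "HOL-Probability.Probability"
begin

(* Covers are required to be bounded because the library's diameter is unspecified on
   unbounded sets. Only exponents s > 0 are used below, so the convention 0 powr s = 0 is the
   right contribution of a set of diameter 0. *)
definition hausdorff_content :: "real \<Rightarrow> real \<Rightarrow> 'a::metric_space set \<Rightarrow> ennreal" where
  "hausdorff_content \<delta> s E =
     (INF U \<in> {U :: nat \<Rightarrow> 'a set. E \<subseteq> (\<Union>i. U i) \<and> (\<forall>i. bounded (U i) \<and> diameter (U i) \<le> \<delta>)}.
        \<Sum>i. ennreal (diameter (U i) powr s))"

definition hausdorff_measure :: "real \<Rightarrow> 'a::metric_space set \<Rightarrow> ennreal" where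
  "hausdorff_measure s E = (SUP \<delta> \<in> {0<..}. hausdorff_content \<delta> s E)"

(* In Euclidean space the set on the right contains every s > DIM('a), so the real-valued
   infimum is taken over a nonempty set that is bounded below. *)
definition hausdorff_dim :: "'a::euclidean_space set \<Rightarrow> real" where
  "hausdorff_dim E = Inf {s. s > 0 \<and> hausdorff_measure s E = 0}"

definition fourier_measure :: "'a::euclidean_space measure \<Rightarrow> 'a \<Rightarrow> complex" where
  "fourier_measure \<mu> \<xi> = (\<integral>x. exp (- 2 * of_real pi * \<i> * of_real (x \<bullet> \<xi>)) \<partial>\<mu>)"

(* Normalized surface measure on the unit sphere, as a Borel measure on the ambient space:
   the law of x / |x| for x uniform in the unit ball, so a subset A of the sphere has measure
   |{t a : 0 < t < 1, a \<in> A}| / |B(0,1)|. (sgn x = x / |x|, with sgn 0 = 0.) *)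
definition sphere_measure :: "'a::euclidean_space measure" where
  "sphere_measure = distr (uniform_measure lborel (ball 0 1)) borel sgn"

(* The estimate is asked for r \<ge> 1, i.e. as a decay rate: as r tends to 0 the left side
   tends to 1, so for \<epsilon> > \<beta> s the bound could not hold for all r > 0. The constant C may depend
   on \<mu> and \<epsilon>. The type argument only carries the ambient space. *)
definition spherical_average_estimate ::
    "'a::euclidean_space itself \<Rightarrow> (real \<Rightarrow> real) \<Rightarrow> bool" where
  "spherical_average_estimate _ \<beta> \<longleftrightarrow>
     (\<forall>(\<mu> :: 'a measure) s.
        prob_space \<mu> \<and> sets \<mu> = sets borel \<and>
        (\<exists>C>0. \<forall>x. \<forall>r>0. measure \<mu> (ball x r) \<le> C * r powr s) \<longrightarrow>
        (\<forall>\<epsilon>>0. \<exists>C>0. \<forall>r\<ge>1.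
           (\<integral>\<omega>. (cmod (fourier_measure \<mu> (r *\<^sub>R \<omega>)))\<^sup>2 \<partial>sphere_measure)
             \<le> C * r powr (- \<beta> s + \<epsilon>)))"

(* Points of k-dimensional space are functions on {..<k}, extended by undefined as in PiM.
   Indices are shifted to start from 0, so the vertices are x 0, ..., x k. *)
definition chain_set :: "nat \<Rightarrow> 'a::metric_space set \<Rightarrow> (nat \<Rightarrow> real) set" where
  "chain_set k E = {\<lambda>j\<in>{..<k}. dist (x j) (x (Suc j)) | x. \<forall>j\<le>k. x j \<in> E}"

(* Completed, so that non-Borel images of Borel sets can be measured. As emeasure vanishes off
   the sigma-algebra, positive emeasure entails Lebesgue measurability. *)
definition lebesgue_power :: "nat \<Rightarrow> (nat \<Rightarrow> real) measure" where
  "lebesgue_power k = completion (\<Pi>\<^sub>M j\<in>{..<k}. lborel)"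

lemma prob_space_sphere_measure: "prob_space (sphere_measure :: 'a::euclidean_space measure)"
proof -
  have "prob_space (uniform_measure lborel (ball (0::'a) 1))"
    by (rule prob_space_uniform_measure)
       (use emeasure_lborel_ball_finite[of "0::'a" 1] unit_ball_vol_pos[of "real DIM('a)"] in
         \<open>auto simp: emeasure_ball less_top[symmetric] simp del: unit_ball_vol_pos\<close>)
  then show ?thesis
    unfolding sphere_measure_def by (rule prob_space.prob_space_distr) simp
qed

lemma AE_sphere_measure: "AE \<omega> in sphere_measure. norm (\<omega> :: 'a::euclidean_space) = 1"
proof -
  have "AE x in uniform_measure lborel (ball (0::'a) 1). norm (sgn x) = 1"
    using AE_lborel_singleton[of "0::'a"]
    by (intro AE_uniform_measureI) (auto simp: norm_sgn elim!: eventually_mono)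
  then show ?thesis
    unfolding sphere_measure_def by (subst AE_distr_iff) auto
qed

end

theory Submission
  imports Defs "HOL-Real_Asymp.Real_Asymp"
begin

text \<open>
  Let \<open>s0\<close> be the dimension of \<open>E\<close>. Frostman's lemma gives, for each \<open>s < s0\<close>, a probability measure
  \<open>\<mu>\<close> on a compact subset of \<open>E\<close> with \<open>\<mu> (B(x, r)) \<le> c r\<^sup>s\<close>. A gliding hump argument makes the
  spherical estimate uniform in \<open>\<mu>\<close>; passing to averages of translates makes the bound linear in \<open>c\<close>,
  and smoothing at scale \<open>1 / r\<close> allows an exponent \<open>s\<close> slightly below \<open>s0\<close>, although \<open>\<beta> s\<close> may be
  unrelated to \<open>\<beta> s0\<close>.

  Write \<open>G r x\<close> for the convolution of \<open>\<mu>\<close> with the Fourier transform of the sphere of radius \<open>r\<close>.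
  Pairing \<open>G r\<close> with the normalized restriction of \<open>\<mu>\<close> to a level set of \<open>G r\<close>, whose Frostman
  constant is \<open>c\<close> over the mass of the level set, gives a weak-type and hence an \<open>L\<^sup>2(\<mu>)\<close> bound
  for \<open>G r\<close> by about \<open>r\<^bsup>-\<beta>\<^esup>\<close> times the spherical average of \<open>\<mu>\<close> at \<open>r\<close>. Integrating over \<open>r\<close>
  and comparing with the energy of \<open>\<mu>\<close> shows that for \<open>\<mu>\<close>-almost every \<open>x\<close> the rotation-invariant law
  of \<open>|x - y|\<close> has a square-integrable Fourier transform, so the law of \<open>|x - y|\<close> itself is absolutely
  continuous. Such pins can be concatenated: given a null set of \<open>(k + 1)\<close>-chains, Fubini's theorem and
  a generic last vertex extend a chain of length \<open>k\<close> to one avoiding the null set.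
\<close>

subsection \<open>Capacitability of Borel sets\<close>

text \<open>Uniformity in the measure is forced because the estimate at radius \<open>r\<close> is
  tested on restrictions of \<open>\<mu>\<close> to level sets, which change with \<open>r\<close>
  and with the level. Linearity in the Frostman constant matters for the same reason: restriction to
  a set of mass \<open>p\<close> costs \<open>c / p\<close>, and a bound quadratic in
  \<open>c / p\<close> would control only \<open>l * p\<close> instead of
  \<open>l\<^sup>2 * p\<close>. Summing the weak-type bound over about \<open>log r\<close> dyadic
  levels loses a logarithm, which a small power of \<open>r\<close> absorbs. The Hausdorff measure
  may vanish at the exponent \<open>s0\<close> itself, whereas the hypothesis speaks of
  \<open>\<beta> s0\<close> only. The passage from \<open>s\<close> to \<open>s0\<close> costs
  \<open>r powr (s0 - s)\<close>, affordable because the hypothesis is a strict inequality. Since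
  \<open>emeasure\<close> vanishes off the sigma-algebra, positivity also requires the chain set to
  be Lebesgue measurable; it is a continuous image of a Borel set and need not be Borel. Choquet's
  theorem is therefore proved for an abstract set function and used twice: for dyadic content, to
  find the compact set carrying the Frostman measure, and for the outer measure of images of
  chains.\<close>

definition suslin :: "'a::metric_space set \<Rightarrow> bool" where
  "suslin S \<longleftrightarrow> (\<exists>F :: ('a \<times> (nat \<Rightarrow> nat)) set. closed F \<and> S = fst ` F)"

lemma suslin_closed: "closed S \<Longrightarrow> suslin S"
  unfolding suslin_def
  by (rule exI[of _ "S \<times> UNIV"]) (auto simp: closed_Times)

lemma continuous_on_coord_snd: "continuous_on A (\<lambda>p. snd p i)"
  by (rule continuous_on_product_then_coordinatewise[of A snd i]) (intro continuous_on_snd continuous_on_id)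

text \<open>The first entry of the witness sequence names the member of the union, and the shifted
  sequence is a witness for that member.\<close>

lemma suslin_UN:
  fixes S :: "nat \<Rightarrow> 'a::metric_space set"
  assumes "\<And>n. suslin (S n)"
  shows "suslin (\<Union>n. S n)"
proof -
  obtain F :: "nat \<Rightarrow> ('a \<times> (nat \<Rightarrow> nat)) set"
    where F: "\<And>n. closed (F n)" "\<And>n. S n = fst ` F n"
    using assms unfolding suslin_def by metis
  define G where "G = (\<Inter>n. {p. snd p 0 \<noteq> n} \<union> {p. (fst p, \<lambda>i. snd p (Suc i)) \<in> F n})"
  have "closed {p :: 'a \<times> (nat \<Rightarrow> nat). snd p 0 \<noteq> n}" for n
  proof -
    have "closed {m::nat. m \<noteq> n}" unfolding closed_def by (rule Topological_Spaces.open_discrete)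
    then have "closed ((\<lambda>p :: 'a \<times> (nat \<Rightarrow> nat). snd p 0) -` {m. m \<noteq> n})"
      by (rule closed_vimage) (rule continuous_on_coord_snd)
    then show ?thesis by (simp add: vimage_def)
  qed
  moreover have "closed {p. (fst p, \<lambda>i. snd p (Suc i)) \<in> F n}" for n
  proof -
    have "closed ((\<lambda>p. (fst p, \<lambda>i. snd p (Suc i))) -` F n)"
      by (intro closed_vimage F continuous_on_Pair continuous_on_fst continuous_on_id
          continuous_on_coordinatewise_then_product continuous_on_coord_snd)
    then show ?thesis by (simp add: vimage_def)
  qed
  ultimately have "closed G"
    unfolding G_def by (intro closed_INT closed_Un ballI) auto
  moreover have "(\<Union>n. S n) = fst ` G"
  proof (intro equalityI subsetI)
    fix x assume "x \<in> (\<Union>n. S n)"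
    then obtain n y where "(x, y) \<in> F n" using F(2) by force
    then have "(x, case_nat n y) \<in> G" by (auto simp: G_def)
    then show "x \<in> fst ` G" by (metis fst_conv image_eqI)
  next
    fix x assume "x \<in> fst ` G"
    then obtain y where "(x, y) \<in> G" by force
    then have "(x, \<lambda>i. y (Suc i)) \<in> F (y 0)" by (auto simp: G_def)
    then show "x \<in> (\<Union>n. S n)" using F(2) by (metis UN_I UNIV_I fst_conv image_eqI)
  qed
  ultimately show ?thesis unfolding suslin_def by blast
qed

text \<open>Countably many witness sequences, one for each member, are packed into a single one
  along \<open>prod_encode\<close>.\<close>

lemma suslin_INT:
  fixes S :: "nat \<Rightarrow> 'a::metric_space set"
  assumes "\<And>n. suslin (S n)"
  shows "suslin (\<Inter>n. S n)"
proof -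
  obtain F :: "nat \<Rightarrow> ('a \<times> (nat \<Rightarrow> nat)) set"
    where F: "\<And>n. closed (F n)" "\<And>n. S n = fst ` F n"
    using assms unfolding suslin_def by metis
  define G where "G = (\<Inter>n. {p. (fst p, \<lambda>i. snd p (prod_encode (n, i))) \<in> F n})"
  have "closed {p. (fst p, \<lambda>i. snd p (prod_encode (n, i))) \<in> F n}" for n
  proof -
    have "closed ((\<lambda>p. (fst p, \<lambda>i. snd p (prod_encode (n, i)))) -` F n)"
      by (intro closed_vimage F continuous_on_Pair continuous_on_fst continuous_on_id
          continuous_on_coordinatewise_then_product continuous_on_coord_snd)
    then show ?thesis by (simp add: vimage_def)
  qed
  then have "closed G"
    unfolding G_def by (intro closed_INT ballI) auto
  moreover have "(\<Inter>n. S n) = fst ` G"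
  proof (intro equalityI subsetI)
    fix x assume "x \<in> (\<Inter>n. S n)"
    then have "\<forall>n. \<exists>y. (x, y) \<in> F n" using F(2) by fastforce
    then obtain y where y: "\<And>n. (x, y n) \<in> F n" by metis
    have "(x, \<lambda>k. case prod_decode k of (n, i) \<Rightarrow> y n i) \<in> G"
      using y by (simp add: G_def)
    then show "x \<in> fst ` G" by (metis fst_conv image_eqI)
  next
    fix x assume "x \<in> fst ` G"
    then obtain y where "(x, y) \<in> G" by force
    then have "(x, \<lambda>i. y (prod_encode (n, i))) \<in> F n" for n by (auto simp: G_def)
    then show "x \<in> (\<Inter>n. S n)" using F(2) by (metis INT_I fst_conv image_eqI)
  qed
  ultimately show ?thesis unfolding suslin_def by blast
qed

lemma suslin_open:
  fixes S :: "'a::metric_space set"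
  assumes "open S"
  shows "suslin S"
proof -
  define T where "T n = (\<Inter>y\<in>-S. {x. 1 / real (Suc n) \<le> dist x y})" for n
  have "closed (T n)" for n
    unfolding T_def by (intro closed_INT ballI closed_Collect_le continuous_intros)
  moreover have "S = (\<Union>n. T n)"
  proof (intro equalityI subsetI)
    fix x assume "x \<in> S"
    with assms obtain e where e: "e > 0" "ball x e \<subseteq> S" by (meson open_contains_ball)
    then obtain n where "1 / real (Suc n) < e" using nat_approx_posE by blast
    then have "x \<in> T n" using e(2) by (force simp: T_def ball_def)
    then show "x \<in> (\<Union>n. T n)" by blast
  next
    fix x assume "x \<in> (\<Union>n. T n)"
    then obtain n where n: "x \<in> T n" by blast
    show "x \<in> S"
    proof (rule ccontr)
      assume "x \<notin> S"
      with n have "1 / real (Suc n) \<le> dist x x" unfolding T_def by blast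
      then show False by simp
    qed
  qed
  ultimately show ?thesis using suslin_UN[of T] suslin_closed by metis
qed

text \<open>Suslin sets are in general not closed under complements, so the induction over the
  sigma-algebra carries \<open>S\<close> and its complement together.\<close>

lemma suslin_borel:
  fixes S :: "'a::metric_space set"
  assumes "S \<in> sets borel"
  shows "suslin S"
proof -
  have "S \<in> sigma_sets UNIV {S. open S}"
    using assms by (simp add: borel_def)
  then have "suslin S \<and> suslin (- S)"
  proof induction
    case (Basic a)
    then show ?case by (simp add: suslin_open suslin_closed closed_Compl)
  next
    case Empty
    then show ?case by (auto simp: suslin_closed)
  next
    case (Compl a)
    then show ?case by (simp add: Compl_eq_Diff_UNIV[symmetric])
  next
    case (Union a)
    then show ?case using suslin_UN[of a] suslin_INT[of "\<lambda>n. - a n"] by (simp add: Compl_UN)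
  qed
  then show ?thesis ..
qed

section \<open>Sequence spaces and Choquet's theorem\<close>

lemma tendsto_fun_iff:
  fixes f :: "'b \<Rightarrow> 'i \<Rightarrow> 'a::topological_space"
  shows "(f \<longlongrightarrow> l) F \<longleftrightarrow> (\<forall>i. ((\<lambda>n. f n i) \<longlongrightarrow> l i) F)"
  using limitin_componentwise[of "\<lambda>_. euclidean" UNIV f l F]
  by (simp add: euclidean_product_topology)

lemma compact_PiE_UNIV:
  fixes S :: "'i \<Rightarrow> 'a::topological_space set"
  assumes "\<And>i. compact (S i)"
  shows "compact {f. \<forall>i. f i \<in> S i}"
proof -
  have "compactin (product_topology (\<lambda>_. euclidean) UNIV) (PiE UNIV S)"
    using assms by (simp add: compactin_PiE)
  moreover have "PiE UNIV S = {f. \<forall>i. f i \<in> S i}" by auto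
  ultimately show ?thesis by (simp add: euclidean_product_topology)
qed

text \<open>No continuity along decreasing compact sets is assumed of \<open>C\<close>, so the
  conclusion keeps the whole sequence \<open>K\<close> and does not evaluate \<open>C\<close> on its
  intersection. Each application passes to the intersection by its own means: an open cover for
  dyadic content, finiteness of the measure for images of chains.\<close>

theorem choquet_capacitability:
  fixes C :: "'a::metric_space set \<Rightarrow> ennreal"
  assumes mono: "\<And>A B. A \<subseteq> B \<Longrightarrow> C A \<le> C B"
    and cont: "\<And>A :: nat \<Rightarrow> 'a set. incseq A \<Longrightarrow> C (\<Union>n. A n) = (SUP n. C (A n))"
    and S: "S \<in> sets borel" "S \<subseteq> X" and X: "compact X" and b: "b < C S"
  obtains K :: "nat \<Rightarrow> 'a set" where "\<And>m. compact (K m)" "decseq K" "(\<Inter>m. K m) \<subseteq> S" "\<And>m. b < C (K m)"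
    "\<And>m. K m \<subseteq> X"
proof -
  obtain F :: "('a \<times> (nat \<Rightarrow> nat)) set" where F: "closed F" "S = fst ` F"
    using suslin_borel[OF S(1)] unfolding suslin_def by blast
  \<comment> \<open>Points with a witness whose first \<open>length ns\<close> entries are bounded
    by \<open>ns\<close>. Letting one further bound grow exhausts the set, so continuity along
    increasing sequences allows a finite bound for each coordinate in turn while \<open>C\<close>
    stays above \<open>b\<close>.\<close>
  define T where "T ns = {x. \<exists>y. (x, y) \<in> F \<and> (\<forall>i<length ns. y i \<le> ns ! i)}" for ns
  have step: "\<exists>k. b < C (T (ns @ [k]))" if "b < C (T ns)" for ns
  proof -
    have inc: "incseq (\<lambda>k. T (ns @ [k]))"
    proof (intro incseq_SucI subsetI)
      fix k x assume "x \<in> T (ns @ [k])"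
      then obtain y where "(x, y) \<in> F" "\<And>i. i < Suc (length ns) \<Longrightarrow> y i \<le> (ns @ [k]) ! i"
        by (auto simp: T_def)
      moreover have "(ns @ [k]) ! i \<le> (ns @ [Suc k]) ! i" if "i < Suc (length ns)" for i
        using that by (auto simp: nth_append)
      ultimately have "(x, y) \<in> F \<and> (\<forall>i<length (ns @ [Suc k]). y i \<le> (ns @ [Suc k]) ! i)"
        by (metis le_trans length_append_singleton)
      then show "x \<in> T (ns @ [Suc k])" unfolding T_def by blast
    qed
    have "T ns = (\<Union>k. T (ns @ [k]))"
    proof (intro equalityI subsetI)
      fix x assume "x \<in> T ns"
      then obtain y where y: "(x, y) \<in> F" "\<forall>i<length ns. y i \<le> ns ! i" by (auto simp: T_def)
      then have "x \<in> T (ns @ [y (length ns)])"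
        by (auto simp: T_def nth_append less_Suc_eq intro!: exI[of _ y])
      then show "x \<in> (\<Union>k. T (ns @ [k]))" by blast
    next
      fix x assume "x \<in> (\<Union>k. T (ns @ [k]))"
      then obtain k y where y: "(x, y) \<in> F" "\<forall>i<Suc (length ns). y i \<le> (ns @ [k]) ! i"
        by (auto simp: T_def)
      have "y i \<le> ns ! i" if "i < length ns" for i
        using y(2)[rule_format, of i] that by (simp add: nth_append)
      with y(1) show "x \<in> T ns" unfolding T_def by blast
    qed
    with that cont[OF inc] show ?thesis by (simp add: less_SUP_iff)
  qed
  have "\<exists>f. \<forall>m. (length (f m) = m \<and> b < C (T (f m))) \<and> (\<exists>k. f (Suc m) = f m @ [k])"
  proof (rule dependent_nat_choice)
    have "T [] = S" using F(2) by (force simp: T_def)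
    then show "\<exists>x. length x = 0 \<and> b < C (T x)" using b by simp
  next
    fix x n assume "length x = n \<and> b < C (T x)"
    then obtain k where "b < C (T (x @ [k]))" using step by blast
    with \<open>length x = n \<and> b < C (T x)\<close>
    show "\<exists>y. (length y = Suc n \<and> b < C (T y)) \<and> (\<exists>k. y = x @ [k])"
      by (intro exI[of _ "x @ [k]"]) auto
  qed
  then obtain f where f: "\<And>m. length (f m) = m" "\<And>m. b < C (T (f m))" "\<And>m. \<exists>k. f (Suc m) = f m @ [k]"
    by metis
  define N where "N i = f (Suc i) ! i" for i
  have fN: "f m ! i = N i" if "i < m" for m i
    using that
  proof (induction m)
    case (Suc m)
    obtain k where k: "f (Suc m) = f m @ [k]" using f(3) by blast
    show ?case
    proof (cases "i = m")
      case False
      then show ?thesis using Suc k f(1)[of m] by (simp add: nth_append)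
    qed (simp add: N_def)
  qed simp
  have T_alt: "T (f m) = {x. \<exists>y. (x, y) \<in> F \<and> (\<forall>i<m. y i \<le> N i)}" for m
    by (simp add: T_def f(1) fN)
  define K where "K m = closure (T (f m))" for m
  have TS: "T (f m) \<subseteq> S" for m using F(2) by (force simp: T_alt)
  have KX: "K m \<subseteq> X" for m
    unfolding K_def using TS S(2) X by (intro closure_minimal) (auto intro: compact_imp_closed)
  then have "compact (K m)" for m
    using KX X unfolding K_def by (metis closed_closure compact_Int_closed inf.absorb_iff2)
  moreover have "decseq K"
    unfolding decseq_def K_def T_alt by (auto intro!: closure_mono)
  moreover have "b < C (K m)" for m
    using f(2)[of m] mono[OF closure_subset] unfolding K_def by (rule less_le_trans)
  \<comment> \<open>Each closure may leave \<open>S\<close>. For a point in all of them, the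
    witnesses of nearby points lie in a compact box, so a subsequence converges and closedness of
    \<open>F\<close> gives a witness for the limit.\<close>
  moreover have "(\<Inter>m. K m) \<subseteq> S"
  proof
    fix x assume x: "x \<in> (\<Inter>m. K m)"
    have "\<exists>x' y. dist x' x < 1 / real (Suc m) \<and> (x', y) \<in> F \<and> (\<forall>i<m. y i \<le> N i)" for m
    proof -
      have "x \<in> closure (T (f m))" using x by (auto simp: K_def)
      then obtain x' where "x' \<in> T (f m)" "dist x' x < 1 / real (Suc m)"
        using closure_approachable[of x "T (f m)"] by (meson of_nat_0_less_iff zero_less_Suc zero_less_divide_1_iff)
      then show ?thesis by (auto simp: T_alt)
    qed
    then obtain xs ys where xy: "\<And>m. dist (xs m) x < 1 / real (Suc m)" "\<And>m. (xs m, ys m) \<in> F"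
      "\<And>m i. i < m \<Longrightarrow> ys m i \<le> N i" by metis
    define B where "B = {y :: nat \<Rightarrow> nat. \<forall>i. y i \<in> {..N i}}"
    have "compact B"
      unfolding B_def by (intro compact_PiE_UNIV) (simp add: finite_imp_compact)
    then have "seq_compact B" by (rule compact_imp_seq_compact)
    \<comment> \<open>Only the first \<open>m\<close> entries of \<open>ys m\<close> are bounded.
      Setting the others to 0 puts the sequence into the box, and each fixed coordinate is affected
      for finitely many \<open>m\<close> only.\<close>
    moreover have "\<forall>m. (\<lambda>i. if i < m then ys m i else 0) \<in> B"
      using xy(3) by (auto simp: B_def)
    ultimately obtain y r where yr: "y \<in> B" "strict_mono r"
      "((\<lambda>m i. if i < m then ys m i else 0) \<circ> r) \<longlonglongrightarrow> y"
      by (rule seq_compactE)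
    have "(\<lambda>n. ys (r n)) \<longlonglongrightarrow> y"
      unfolding tendsto_fun_iff
    proof
      fix i
      have "(\<lambda>n. if i < r n then ys (r n) i else 0) \<longlonglongrightarrow> y i"
        using yr(3) unfolding tendsto_fun_iff o_def by blast
      moreover have "i < n \<Longrightarrow> i < r n" for n
        using seq_suble[OF yr(2), of n] by simp
      then have "eventually (\<lambda>n. (if i < r n then ys (r n) i else 0) = ys (r n) i) sequentially"
        by (intro eventually_mono[OF eventually_gt_at_top[of i]]) simp
      ultimately show "(\<lambda>n. ys (r n) i) \<longlonglongrightarrow> y i"
        by (rule Lim_transform_eventually)
    qed
    moreover have "xs \<longlonglongrightarrow> x"
    proof (rule tendsto_dist_iff[THEN iffD2, OF tendsto_sandwich[of "\<lambda>_. 0" _ _ "\<lambda>n. 1 / real (Suc n)"]])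
      show "\<forall>\<^sub>F n in sequentially. dist (xs n) x \<le> 1 / real (Suc n)"
        by (intro always_eventually allI less_imp_le xy(1))
      show "(\<lambda>n. 1 / real (Suc n)) \<longlonglongrightarrow> 0" by real_asymp
    qed auto
    then have "(\<lambda>n. xs (r n)) \<longlonglongrightarrow> x" using LIMSEQ_subseq_LIMSEQ[OF _ yr(2)] unfolding o_def by blast
    ultimately have "(\<lambda>n. (xs (r n), ys (r n))) \<longlonglongrightarrow> (x, y)" by (rule tendsto_Pair[rotated])
    then have "(x, y) \<in> F" by (rule closed_sequentially[OF F(1), rotated]) (rule xy(2))
    then show "x \<in> S" using F(2) by force
  qed
  ultimately show ?thesis using that KX by blast
qed

subsection \<open>Dyadic Hausdorff content\<close>

definition dcode :: "nat \<Rightarrow> real ^ 'n \<Rightarrow> int ^ 'n" where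
  "dcode m y = (\<chi> i. \<lfloor>2 ^ m * y $ i\<rfloor>)"

text \<open>A pair \<open>(m, z)\<close> encodes the half-open dyadic cube of side \<open>2\<^bsup>-m\<^esup>\<close> with corner \<open>2\<^bsup>-m\<^esup> z\<close>; since
  \<open>m :: nat\<close>, only cubes of side at most \<open>1\<close> are used.\<close>

definition dcube :: "nat \<times> (int ^ 'n) \<Rightarrow> (real ^ 'n) set" where
  "dcube q = {y. dcode (fst q) y = snd q}"

lemma dcube_code: "x \<in> dcube (m, dcode m x)"
  by (simp add: dcube_def)

lemma floor_power2_div:
  assumes "m \<le> l"
  shows "\<lfloor>2 ^ m * (y :: real)\<rfloor> = \<lfloor>2 ^ l * y\<rfloor> div 2 ^ (l - m)"
proof -
  have "2 ^ m * y = 2 ^ l * y / real_of_int (2 ^ (l - m))"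
    using assms by (simp add: field_simps flip: power_add)
  then show ?thesis by (metis floor_divide_real_eq_div zero_le_numeral zero_le_power)
qed

lemma dcode_coarser:
  assumes "m \<le> l"
  shows "dcode m y = (\<chi> i. dcode l y $ i div 2 ^ (l - m))"
  using floor_power2_div[OF assms] by (simp add: dcode_def)

lemma dcube_nested:
  assumes "x \<in> dcube p" "x \<in> dcube q" "fst q \<le> fst p"
  shows "dcube p \<subseteq> dcube q"
proof
  fix y assume "y \<in> dcube p"
  with assms show "y \<in> dcube q"
    using dcode_coarser[OF assms(3), of x] dcode_coarser[OF assms(3), of y] by (simp add: dcube_def)
qed

lemma dcube_eqI: "x \<in> dcube p \<Longrightarrow> x \<in> dcube q \<Longrightarrow> fst q = fst p \<Longrightarrow> p = q"
  by (auto simp: dcube_def prod_eq_iff)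

text \<open>The cost of a family of cubes is made a measure on the countable set of codes, so that
  additivity and continuity from below of the cost are instances of measure theory.\<close>

definition dmeas :: "real \<Rightarrow> (nat \<times> (int ^ 'n)) measure" where
  "dmeas s = density (count_space UNIV) (\<lambda>q. ennreal (2 powr (- real (fst q) * s)))"

lemma sets_dmeas [simp, measurable_cong]: "sets (dmeas s) = UNIV"
  by (simp add: dmeas_def)

lemma emeasure_dmeas:
  "emeasure (dmeas s) Q = (\<integral>\<^sup>+q. ennreal (2 powr (- real (fst q) * s)) * indicator Q q \<partial>count_space UNIV)"
  by (simp add: dmeas_def emeasure_density)

lemma emeasure_dmeas_singleton: "emeasure (dmeas s) {q} = ennreal (2 powr (- real (fst q) * s))"
  by (simp add: emeasure_dmeas nn_integral_indicator_singleton')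

definition dcontent :: "real \<Rightarrow> (real ^ 'n) set \<Rightarrow> ennreal" where
  "dcontent s A = (INF Q \<in> {Q. A \<subseteq> (\<Union>q\<in>Q. dcube q)}. emeasure (dmeas s) Q)"

lemma dcontent_le: "A \<subseteq> (\<Union>q\<in>Q. dcube q) \<Longrightarrow> dcontent s A \<le> emeasure (dmeas s) Q"
  unfolding dcontent_def by (rule INF_lower) auto

lemma dcontent_mono: "A \<subseteq> B \<Longrightarrow> dcontent s A \<le> dcontent s B"
  unfolding dcontent_def by (rule INF_superset_mono) auto

lemma dcontent_less:
  assumes "dcontent s A < b"
  obtains Q where "A \<subseteq> (\<Union>q\<in>Q. dcube q)" "emeasure (dmeas s) Q < b"
  using assms unfolding dcontent_def INF_less_iff by auto

lemma dcontent_approx: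
  assumes "dcontent s A < \<top>" "e > 0"
  obtains Q where "A \<subseteq> (\<Union>q\<in>Q. dcube q)" "emeasure (dmeas s) Q \<le> dcontent s A + ennreal e"
proof -
  have "dcontent s A < dcontent s A + ennreal e"
    using assms ennreal_add_left_cancel_less[of "dcontent s A" 0 "ennreal e"] by (simp add: less_top)
  then show ?thesis using that dcontent_less by (metis less_imp_le)
qed

lemma dcontent_empty [simp]: "dcontent s {} = 0"
  using dcontent_le[of "{}" "{}" s] by simp

lemma dcontent_dcube: "A \<subseteq> dcube q \<Longrightarrow> dcontent s A \<le> ennreal (2 powr (- real (fst q) * s))"
  using dcontent_le[of A "{q}" s] by (simp add: emeasure_dmeas_singleton)

lemma dcontent_Un: "dcontent s (A \<union> B) \<le> dcontent s A + dcontent s B"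
proof (rule ennreal_le_epsilon)
  fix e :: real assume fin: "dcontent s A + dcontent s B < \<top>" and e: "e > 0"
  obtain P where P: "A \<subseteq> (\<Union>q\<in>P. dcube q)" "emeasure (dmeas s) P \<le> dcontent s A + ennreal (e / 2)"
    using dcontent_approx[of s A "e / 2"] fin e by (auto simp: less_top)
  obtain Q where Q: "B \<subseteq> (\<Union>q\<in>Q. dcube q)" "emeasure (dmeas s) Q \<le> dcontent s B + ennreal (e / 2)"
    using dcontent_approx[of s B "e / 2"] fin e by (auto simp: less_top)
  have "dcontent s (A \<union> B) \<le> emeasure (dmeas s) (P \<union> Q)"
    using P(1) Q(1) by (intro dcontent_le) auto
  also have "\<dots> \<le> emeasure (dmeas s) P + emeasure (dmeas s) Q"
    by (rule emeasure_subadditive) auto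
  also have "\<dots> \<le> (dcontent s A + ennreal (e / 2)) + (dcontent s B + ennreal (e / 2))"
    by (intro add_mono P Q)
  also have "\<dots> = dcontent s A + dcontent s B + (ennreal (e / 2) + ennreal (e / 2))"
    by (simp add: ac_simps)
  also have "ennreal (e / 2) + ennreal (e / 2) = ennreal e"
    using e by (simp add: ennreal_plus[symmetric] del: ennreal_plus)
  finally show "dcontent s (A \<union> B) \<le> dcontent s A + dcontent s B + ennreal e" .
qed

lemma dcontent_finite_UN:
  "finite I \<Longrightarrow> dcontent s (\<Union>i\<in>I. A i) \<le> (\<Sum>i\<in>I. dcontent s (A i))"
proof (induction rule: finite_induct)
  case (insert x F)
  have "dcontent s (\<Union>i\<in>insert x F. A i) \<le> dcontent s (A x) + dcontent s (\<Union>i\<in>F. A i)"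
    using dcontent_Un[of s "A x" "\<Union>i\<in>F. A i"] by simp
  also have "\<dots> \<le> dcontent s (A x) + (\<Sum>i\<in>F. dcontent s (A i))"
    using insert by (intro add_left_mono)
  finally show ?case using insert by simp
qed simp

text \<open>\<open>djoin\<close> keeps the cubes not contained in a coarser cube of the other family and \<open>dmeet\<close> the
  remaining ones, which still cover what both families cover. This gives strong subadditivity of the
  content, and hence its continuity along increasing sequences.\<close>

definition djoin :: "(nat \<times> (int ^ 'n)) set \<Rightarrow> (nat \<times> (int ^ 'n)) set \<Rightarrow> (nat \<times> (int ^ 'n)) set" where
  "djoin P Q = {p \<in> P. \<not> (\<exists>q\<in>Q. fst q < fst p \<and> dcube p \<subseteq> dcube q)}
             \<union> {q \<in> Q. \<not> (\<exists>p\<in>P. fst p \<le> fst q \<and> dcube q \<subseteq> dcube p)}"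

definition dmeet :: "(nat \<times> (int ^ 'n)) set \<Rightarrow> (nat \<times> (int ^ 'n)) set \<Rightarrow> (nat \<times> (int ^ 'n)) set" where
  "dmeet P Q = {p \<in> P. \<exists>q\<in>Q. fst q < fst p \<and> dcube p \<subseteq> dcube q}
             \<union> {q \<in> Q. \<exists>p\<in>P. fst p \<le> fst q \<and> dcube q \<subseteq> dcube p}"

lemma djoin_dmeet:
  "emeasure (dmeas s) (djoin P Q) + emeasure (dmeas s) (dmeet P Q)
     \<le> emeasure (dmeas s) P + emeasure (dmeas s) Q"
proof -
  let ?m = "emeasure (dmeas s)"
  define a where "a p \<longleftrightarrow> (\<exists>q\<in>Q. fst q < fst p \<and> dcube p \<subseteq> dcube q)" for p
  define b where "b q \<longleftrightarrow> (\<exists>p\<in>P. fst p \<le> fst q \<and> dcube q \<subseteq> dcube p)" for q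
  have P: "?m P = ?m {p\<in>P. \<not> a p} + ?m {p\<in>P. a p}"
    by (subst plus_emeasure) (auto intro!: arg_cong2[where f=emeasure])
  have Q: "?m Q = ?m {p\<in>Q. \<not> b p} + ?m {p\<in>Q. b p}"
    by (subst plus_emeasure) (auto intro!: arg_cong2[where f=emeasure])
  have "?m (djoin P Q) + ?m (dmeet P Q) \<le>
    (?m {p\<in>P. \<not> a p} + ?m {p\<in>Q. \<not> b p}) + (?m {p\<in>P. a p} + ?m {p\<in>Q. b p})"
    unfolding djoin_def dmeet_def a_def[symmetric] b_def[symmetric]
    by (intro add_mono emeasure_subadditive) auto
  also have "\<dots> = ?m P + ?m Q" unfolding P Q by (simp add: ac_simps)
  finally show ?thesis .
qed

text \<open>A smaller first component means a coarser cube. The asymmetry between \<open><\<close>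
  and \<open>\<le>\<close> in \<open>djoin\<close> matters here: a cube belonging to both families
  is kept as a member of \<open>P\<close> and would otherwise be discarded from both sides.\<close>

lemma djoin_lowest:
  assumes "p \<in> P \<union> Q" "x \<in> dcube p" "\<And>q. q \<in> P \<union> Q \<Longrightarrow> x \<in> dcube q \<Longrightarrow> fst p \<le> fst q"
  shows "p \<in> djoin P Q"
proof (cases "p \<in> P")
  case True
  then show ?thesis using assms unfolding djoin_def by (auto simp: not_less[symmetric])
next
  case False
  then have pQ: "p \<in> Q" using assms by auto
  have "\<not> (fst p' \<le> fst p \<and> dcube p \<subseteq> dcube p')" if "p' \<in> P" for p'
  proof
    assume *: "fst p' \<le> fst p \<and> dcube p \<subseteq> dcube p'"
    with assms that have "fst p' = fst p" by (meson UnI1 le_antisym subsetD)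
    then have "p' = p" using * assms(2) dcube_eqI by blast
    with that False show False by simp
  qed
  with pQ show ?thesis unfolding djoin_def by auto
qed

lemma djoin_below:
  assumes "p \<in> P \<union> Q" "x \<in> dcube p"
  obtains p' where "p' \<in> djoin P Q" "x \<in> dcube p'" "fst p' \<le> fst p"
proof -
  obtain p' where p': "p' \<in> P \<union> Q \<and> x \<in> dcube p'" "\<And>q. q \<in> P \<union> Q \<and> x \<in> dcube q \<Longrightarrow> fst p' \<le> fst q"
    using assms ex_has_least_nat[of "\<lambda>p. p \<in> P \<union> Q \<and> x \<in> dcube p" p fst] by blast
  then show ?thesis using djoin_lowest[of p' P Q x] that assms by blast
qed

lemma dmeet_covers:
  assumes "A \<subseteq> (\<Union>q\<in>P. dcube q)" "A \<subseteq> (\<Union>q\<in>Q. dcube q)"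
  shows "A \<subseteq> (\<Union>q\<in>dmeet P Q. dcube q)"
proof
  fix x assume "x \<in> A"
  with assms obtain p q where pq: "p \<in> P" "x \<in> dcube p" "q \<in> Q" "x \<in> dcube q" by blast
  show "x \<in> (\<Union>q\<in>dmeet P Q. dcube q)"
  proof (cases "fst q < fst p")
    case True
    then have "p \<in> dmeet P Q" using pq dcube_nested[of x p q] unfolding dmeet_def by auto
    then show ?thesis using pq by blast
  next
    case False
    then have "q \<in> dmeet P Q" using pq dcube_nested[of x q p] unfolding dmeet_def by auto
    then show ?thesis using pq by blast
  qed
qed

text \<open>Near-optimal covers \<open>Q n\<close> of \<open>A n\<close> are joined one after the
  other into \<open>U n\<close>. The meet of \<open>U n\<close> with \<open>Q (Suc n)\<close> still
  covers \<open>A n\<close>, so it costs at least the content of \<open>A n\<close>; subtracting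
  this leaves only the error \<open>\<epsilon> (Suc n)\<close> at each join, and the errors sum to
  at most \<open>e\<close>.\<close>

lemma dcontent_UN_incseq:
  assumes inc: "incseq A"
  shows "dcontent s (\<Union>n. A n) = (SUP n. dcontent s (A n))"
proof (rule antisym)
  show "(SUP n. dcontent s (A n)) \<le> dcontent s (\<Union>n. A n)"
    by (intro SUP_least dcontent_mono) auto
  show "dcontent s (\<Union>n. A n) \<le> (SUP n. dcontent s (A n))"
  proof (rule ennreal_le_epsilon)
    fix e :: real assume fin: "(SUP n. dcontent s (A n)) < \<top>" and e: "e > 0"
    have finn: "dcontent s (A n) < \<top>" for n
      using fin by (meson SUP_upper UNIV_I le_less_trans)
    define \<epsilon> where "\<epsilon> n = e / 2 ^ Suc n" for n
    have "\<exists>Q. A n \<subseteq> (\<Union>q\<in>Q. dcube q) \<and> emeasure (dmeas s) Q \<le> dcontent s (A n) + ennreal (\<epsilon> n)" for n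
    proof -
      have "\<epsilon> n > 0" using e by (simp add: \<epsilon>_def)
      then show ?thesis using dcontent_approx[OF finn] by metis
    qed
    then obtain Q where Q: "\<And>n. A n \<subseteq> (\<Union>q\<in>Q n. dcube q)"
      "\<And>n. emeasure (dmeas s) (Q n) \<le> dcontent s (A n) + ennreal (\<epsilon> n)" by metis
    define U where "U = rec_nat (Q 0) (\<lambda>n u. djoin u (Q (Suc n)))"
    have U0: "U 0 = Q 0" and US: "U (Suc n) = djoin (U n) (Q (Suc n))" for n
      by (simp_all add: U_def)
    have covU: "A n \<subseteq> (\<Union>q\<in>U n. dcube q)" for n
    proof (cases n)
      case 0 then show ?thesis using Q(1)[of 0] U0 by simp
    next
      case (Suc m)
      show ?thesis
      proof
        fix x assume "x \<in> A n"
        then obtain p where "p \<in> Q (Suc m)" "x \<in> dcube p" using Q(1)[of n] Suc by blast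
        then obtain p' where "p' \<in> djoin (U m) (Q (Suc m))" "x \<in> dcube p'"
          using djoin_below[of p "U m" "Q (Suc m)" x] by blast
        then show "x \<in> (\<Union>q\<in>U n. dcube q)" unfolding Suc US by blast
      qed
    qed
    have size: "emeasure (dmeas s) (U n) \<le> dcontent s (A n) + ennreal (\<Sum>i\<le>n. \<epsilon> i)" for n
    proof (induction n)
      case 0 then show ?case using Q(2)[of 0] U0 by simp
    next
      case (Suc n)
      have "A n \<subseteq> (\<Union>q\<in>dmeet (U n) (Q (Suc n)). dcube q)"
        by (rule dmeet_covers[OF covU order_trans[OF incseq_SucD[OF inc] Q(1)]])
      then have "dcontent s (A n) \<le> emeasure (dmeas s) (dmeet (U n) (Q (Suc n)))"
        by (rule dcontent_le)
      then have "dcontent s (A n) + emeasure (dmeas s) (U (Suc n))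
          \<le> emeasure (dmeas s) (U (Suc n)) + emeasure (dmeas s) (dmeet (U n) (Q (Suc n)))"
        by (simp add: add.commute add_left_mono)
      also have "\<dots> \<le> emeasure (dmeas s) (U n) + emeasure (dmeas s) (Q (Suc n))"
        unfolding US by (rule djoin_dmeet)
      also have "\<dots> \<le> (dcontent s (A n) + ennreal (\<Sum>i\<le>n. \<epsilon> i)) + (dcontent s (A (Suc n)) + ennreal (\<epsilon> (Suc n)))"
        by (intro add_mono Suc Q)
      also have "\<dots> = dcontent s (A n) + (dcontent s (A (Suc n)) + (ennreal (\<Sum>i\<le>n. \<epsilon> i) + ennreal (\<epsilon> (Suc n))))"
        by (simp add: ac_simps)
      also have "ennreal (\<Sum>i\<le>n. \<epsilon> i) + ennreal (\<epsilon> (Suc n)) = ennreal (\<Sum>i\<le>Suc n. \<epsilon> i)"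
        using e by (subst ennreal_plus[symmetric]) (auto simp: \<epsilon>_def intro!: sum_nonneg)
      finally show ?case using finn[of n] by (auto simp: ennreal_add_left_cancel_le)
    qed
    have sum\<epsilon>: "(\<Sum>i\<le>n. \<epsilon> i) \<le> e" for n
    proof -
      have "(\<Sum>i\<le>n. \<epsilon> i) = e - e / 2 ^ Suc n"
        by (induction n) (auto simp: \<epsilon>_def field_simps)
      then show ?thesis using e by simp
    qed
    \<comment> \<open>The union of the \<open>V N\<close> is the lower limit of the families
      \<open>U M\<close>. As \<open>V N\<close> is contained in \<open>U N\<close>, continuity from
      below bounds its cost.\<close>
    define V where "V N = (\<Inter>M\<in>{N..}. U M)" for N
    have "incseq V" unfolding incseq_def V_def by auto
    then have "emeasure (dmeas s) (\<Union>N. V N) = (SUP N. emeasure (dmeas s) (V N))"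
      by (intro SUP_emeasure_incseq[symmetric]) auto
    also have "\<dots> \<le> (SUP n. dcontent s (A n)) + ennreal e"
    proof (rule SUP_least)
      fix N
      have "emeasure (dmeas s) (V N) \<le> emeasure (dmeas s) (U N)"
        by (intro emeasure_mono) (auto simp: V_def)
      also have "\<dots> \<le> dcontent s (A N) + ennreal (\<Sum>i\<le>N. \<epsilon> i)" by (rule size)
      also have "\<dots> \<le> (SUP n. dcontent s (A n)) + ennreal e"
        using sum\<epsilon>[of N] by (intro add_mono SUP_upper ennreal_leI) auto
      finally show "emeasure (dmeas s) (V N) \<le> (SUP n. dcontent s (A n)) + ennreal e" .
    qed
    finally have sizeV: "emeasure (dmeas s) (\<Union>N. V N) \<le> (SUP n. dcontent s (A n)) + ennreal e" .
    have "(\<Union>n. A n) \<subseteq> (\<Union>q\<in>(\<Union>N. V N). dcube q)"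
    proof
      fix x assume "x \<in> (\<Union>n. A n)"
      then obtain n where n: "x \<in> A n" by blast
      \<comment> \<open>Among all stages from \<open>n\<close> on and all cubes through
        \<open>x\<close> kept there, a coarsest cube is chosen. No later join can discard it,
        because a join keeps the coarsest cube through a point.\<close>
      define R where "R = (\<lambda>(N, p). n \<le> N \<and> p \<in> U N \<and> x \<in> dcube p)"
      obtain p where "p \<in> U n" "x \<in> dcube p" using covU[of n] n by blast
      then have "R (n, p)" by (simp add: R_def)
      then obtain N0 p0 where R0: "R (N0, p0)" and least: "\<And>N p. R (N, p) \<Longrightarrow> fst p0 \<le> fst p"
        using ex_has_least_nat[of R "(n, p)" "\<lambda>(N, p). fst p"] by fastforce
      have "p0 \<in> U M" if "N0 \<le> M" for M
        using that
      proof (induction M rule: dec_induct)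
        case base then show ?case using R0 by (simp add: R_def)
      next
        case (step M)
        have x0: "x \<in> dcube p0" and nM: "n \<le> Suc M" using R0 step(1) by (auto simp: R_def)
        show ?case unfolding US
        proof (rule djoin_lowest[of _ _ _ x])
          show "p0 \<in> U M \<union> Q (Suc M)" using step by auto
          show "x \<in> dcube p0" by (rule x0)
          fix q assume "q \<in> U M \<union> Q (Suc M)" "x \<in> dcube q"
          then obtain p' where "p' \<in> U (Suc M)" "x \<in> dcube p'" "fst p' \<le> fst q"
            unfolding US by (rule djoin_below)
          then show "fst p0 \<le> fst q" using least[of "Suc M" p'] nM by (auto simp: R_def)
        qed
      qed
      then have "p0 \<in> V N0" by (auto simp: V_def)
      then show "x \<in> (\<Union>q\<in>(\<Union>N. V N). dcube q)" using R0 by (auto simp: R_def)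
    qed
    from order_trans[OF dcontent_le[OF this] sizeV]
    show "dcontent s (\<Union>n. A n) \<le> (SUP n. dcontent s (A n)) + ennreal e" .
  qed
qed

lemma dcontent_UN_zero:
  fixes A :: "nat \<Rightarrow> (real ^ 'n) set"
  assumes "\<And>n. dcontent s (A n) = 0"
  shows "dcontent s (\<Union>n. A n) = 0"
proof -
  have *: "incseq (\<lambda>n. \<Union>i<n. A i)" by (auto simp: incseq_def intro: less_le_trans)
  have "dcontent s (\<Union>i<n. A i) = 0" for n
    using dcontent_finite_UN[of "{..<n}" s A] assms by simp
  then have "dcontent s (\<Union>n. \<Union>i<n. A i) = 0" using dcontent_UN_incseq[OF *] by simp
  moreover have "(\<Union>n. \<Union>i<n. A i) = (\<Union>n. A n)" by auto
  ultimately show ?thesis by simp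
qed

section \<open>Comparison with Hausdorff measure\<close>

lemma dcube_dist:
  assumes "x \<in> dcube q" "y \<in> dcube (q :: nat \<times> (int ^ 'n))"
  shows "dist x y \<le> real CARD('n) / 2 ^ fst q"
proof -
  have "\<bar>(x - y) $ i\<bar> \<le> 1 / 2 ^ fst q" for i
  proof -
    have "\<lfloor>2 ^ fst q * x $ i\<rfloor> = \<lfloor>2 ^ fst q * y $ i\<rfloor>"
      using assms by (metis (mono_tags, lifting) dcode_def dcube_def mem_Collect_eq vec_lambda_beta)
    then have "\<bar>2 ^ fst q * x $ i - 2 ^ fst q * y $ i\<bar> \<le> 1" by linarith
    also have "2 ^ fst q * x $ i - 2 ^ fst q * y $ i = 2 ^ fst q * (x - y) $ i" by (simp add: algebra_simps)
    finally have "2 ^ fst q * \<bar>(x - y) $ i\<bar> \<le> 1" by (simp only: abs_mult power_abs abs_numeral)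
    then show ?thesis by (simp add: field_simps)
  qed
  then have "(\<Sum>i\<in>UNIV. \<bar>(x - y) $ i\<bar>) \<le> (\<Sum>i\<in>(UNIV :: 'n set). 1 / 2 ^ fst q)" by (intro sum_mono) auto
  then show ?thesis using norm_le_l1_cart[of "x - y"] by (simp add: dist_norm)
qed

text \<open>Dyadic covers carry no smallness condition, but a cheap cover consists of small cubes:
  for \<open>s > 0\<close> every single cube of level \<open>m\<close> already costs
  \<open>2 powr (- m s)\<close>. Hence a cover of cost below \<open>\<eta>\<close> is admissible for
  \<open>\<delta>\<close> once \<open>\<eta>\<close> is small compared with
  \<open>\<delta>\<close>.\<close>

lemma hausdorff_measure_zero:
  fixes A :: "(real ^ 'n) set"
  assumes "dcontent s A = 0" "s > 0"
  shows "hausdorff_measure s A = 0"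
proof -
  let ?d = "real CARD('n)"
  have d: "?d > 0" by simp
  have "hausdorff_content \<delta> s A \<le> ennreal (?d powr s) * ennreal \<eta>"
    if \<delta>: "\<delta> > 0" and \<eta>: "0 < \<eta>" "\<eta> \<le> (\<delta> / ?d) powr s" for \<delta> \<eta>
  proof -
    obtain Q where Q: "A \<subseteq> (\<Union>q\<in>Q. dcube q)" "emeasure (dmeas s) Q < ennreal \<eta>"
      using dcontent_less[of s A "ennreal \<eta>"] assms \<eta> by auto
    have diam: "diameter (dcube q) \<le> ?d / 2 ^ fst q" for q :: "nat \<times> (int ^ 'n)"
      by (rule diameter_le) (auto simp: dcube_dist[unfolded dist_norm])
    have bdd: "bounded (dcube q)" for q :: "nat \<times> (int ^ 'n)"
      unfolding bounded_two_points using dcube_dist by blast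
    have small: "?d / 2 ^ fst q \<le> \<delta>" if "q \<in> Q" for q
    proof -
      have "ennreal (2 powr (- real (fst q) * s)) \<le> emeasure (dmeas s) Q"
        unfolding emeasure_dmeas_singleton[symmetric] using that by (intro emeasure_mono) auto
      then have "ennreal (2 powr (- real (fst q) * s)) < ennreal \<eta>" using Q(2) by (rule le_less_trans)
      then have "2 powr (- real (fst q) * s) < \<eta>" by (simp add: ennreal_less_iff)
      also have "\<dots> \<le> (\<delta> / ?d) powr s" by (rule \<eta>)
      finally have "(2 powr (- real (fst q))) powr s < (\<delta> / ?d) powr s" by (simp add: powr_powr)
      then have "2 powr (- real (fst q)) < \<delta> / ?d"
        using \<delta> d assms(2) by (meson divide_pos_pos less_imp_le not_le powr_ge_zero powr_mono2)
      then show ?thesis by (simp add: powr_minus powr_realpow field_simps)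
    qed
    \<comment> \<open>The family is listed as a sequence through its codes. The test
      \<open>to_nat (from_nat i) = i\<close> rejects numbers that are not codes, where
      \<open>from_nat\<close> could repeat a cube; these get the empty set, whose diameter 0
      contributes 0.\<close>
    define U where "U i = (if from_nat i \<in> Q \<and> to_nat (from_nat i :: nat \<times> (int ^ 'n)) = i
        then dcube (from_nat i :: nat \<times> (int ^ 'n)) else {})" for i
    have "hausdorff_content \<delta> s A \<le> (\<Sum>i. ennreal (diameter (U i) powr s))"
      unfolding hausdorff_content_def
    proof (rule INF_lower, safe)
      fix x assume "x \<in> A"
      then obtain q where q: "q \<in> Q" "x \<in> dcube q" using Q(1) by blast
      then have "x \<in> U (to_nat q)" by (simp add: U_def)
      then show "x \<in> (\<Union>i. U i)" by blast
    next
      fix i show "bounded (U i)" by (auto simp: U_def bdd)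
      show "diameter (U i) \<le> \<delta>"
        using order_trans[OF diam small] \<delta> by (simp add: U_def)
    qed
    also have "\<dots> = (\<integral>\<^sup>+i. ennreal (diameter (U i) powr s) \<partial>count_space UNIV)"
      by (simp add: nn_integral_count_space_nat)
    also have "\<dots> = (\<integral>\<^sup>+i. ennreal (diameter (U i) powr s) \<partial>count_space (range (to_nat :: nat \<times> (int ^ 'n) \<Rightarrow> nat)))"
    proof (rule nn_integral_count_space_eq)
      fix i :: nat assume "i \<in> UNIV - range (to_nat :: nat \<times> (int ^ 'n) \<Rightarrow> nat)"
      then have "U i = {}" by (auto simp: U_def) (metis rangeI)
      then show "ennreal (diameter (U i) powr s) = 0" by simp
    qed auto
    also have "\<dots> = (\<integral>\<^sup>+q. ennreal (diameter (U (to_nat (q :: nat \<times> (int ^ 'n)))) powr s) \<partial>count_space UNIV)"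
      by (rule nn_integral_bij_count_space[symmetric]) (simp add: bij_betw_def)
    also have "\<dots> \<le> (\<integral>\<^sup>+q. ennreal (?d powr s) * (ennreal (2 powr (- real (fst q) * s)) * indicator Q q) \<partial>count_space UNIV)"
    proof (rule nn_integral_mono)
      fix q :: "nat \<times> (int ^ 'n)"
      have "diameter (dcube q) powr s \<le> (?d / 2 ^ fst q) powr s"
        using diam assms(2) by (intro powr_mono2 diameter_ge_0 bdd) auto
      also have "\<dots> = ?d powr s * 2 powr (- real (fst q) * s)"
        by (simp add: powr_divide powr_realpow[symmetric] powr_powr powr_minus field_simps)
      finally show "ennreal (diameter (U (to_nat q)) powr s)
          \<le> ennreal (?d powr s) * (ennreal (2 powr (- real (fst q) * s)) * indicator Q q)"
        by (auto simp: U_def ennreal_mult[symmetric] split: split_indicator intro: ennreal_leI)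
    qed
    also have "\<dots> = ennreal (?d powr s) * emeasure (dmeas s) Q"
      by (simp add: emeasure_dmeas nn_integral_cmult)
    also have "\<dots> \<le> ennreal (?d powr s) * ennreal \<eta>" using Q(2) by (intro mult_left_mono) auto
    finally show ?thesis .
  qed
  note bound = this
  have "hausdorff_content \<delta> s A = 0" if \<delta>: "\<delta> > 0" for \<delta>
  proof -
    have "hausdorff_content \<delta> s A \<le> ennreal e" if e: "e > 0" for e
    proof -
      define \<eta> where "\<eta> = min ((\<delta> / ?d) powr s) (e / ?d powr s)"
      have "hausdorff_content \<delta> s A \<le> ennreal (?d powr s) * ennreal \<eta>"
        using \<delta> e by (intro bound) (auto simp: \<eta>_def)
      also have "\<dots> = ennreal (?d powr s * \<eta>)" by (simp add: ennreal_mult' )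
      also have "?d powr s * \<eta> \<le> e"
        using e d by (auto simp: \<eta>_def min_def field_simps)
      then have "ennreal (?d powr s * \<eta>) \<le> ennreal e" by (rule ennreal_leI)
      finally show ?thesis .
    qed
    then show ?thesis
      using ennreal_le_epsilon[of 0 "hausdorff_content \<delta> s A"] by simp
  qed
  then show ?thesis unfolding hausdorff_measure_def by simp
qed

subsection \<open>Frostman measures\<close>

text \<open>The Ionescu-Tulcea theorem for kernels that look only at the last coordinate. The
  initial law and the joint laws of consecutive states are all that the random descent through
  dyadic cubes requires.\<close>

lemma markov_chain_exists:
  fixes p0 :: "'a::countable pmf" and \<kappa> :: "nat \<Rightarrow> 'a \<Rightarrow> 'a pmf"
  obtains L :: "(nat \<Rightarrow> 'a) measure" where "prob_space L" "sets L = sets (\<Pi>\<^sub>M i\<in>UNIV. count_space UNIV)"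
    "\<And>z. emeasure L {\<omega>. \<omega> 0 = z} = ennreal (pmf p0 z)"
    "\<And>n y z. emeasure L {\<omega>. \<omega> n = y \<and> \<omega> (Suc n) = z} = emeasure L {\<omega>. \<omega> n = y} * ennreal (pmf (\<kappa> n y) z)"
proof -
  define M where "M = (\<lambda>i :: nat. count_space (UNIV :: 'a set))"
  define P where "P i \<omega> = measure_pmf (if i = 0 then p0 else \<kappa> (i - 1) (\<omega> (i - 1)))"
    for i :: nat and \<omega> :: "nat \<Rightarrow> 'a"
  have P_measurable: "P i \<in> Pi\<^sub>M {0..<i} M \<rightarrow>\<^sub>M subprob_algebra (M i)" for i
  proof -
    show "P i \<in> Pi\<^sub>M {0..<i} M \<rightarrow>\<^sub>M subprob_algebra (M i)"
    proof (cases i)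
      case 0
      then show ?thesis by (simp add: P_def[abs_def] M_def measure_pmf_in_subprob_algebra)
    next
      case (Suc j)
      have "(\<lambda>\<omega>. \<omega> j) \<in> Pi\<^sub>M {0..<i} M \<rightarrow>\<^sub>M M j"
        using Suc by (intro measurable_component_singleton) auto
      moreover have "(\<lambda>y. measure_pmf (\<kappa> j y)) \<in> M j \<rightarrow>\<^sub>M subprob_algebra (M i)"
        by (simp add: M_def measure_pmf_in_subprob_algebra)
      ultimately have "(\<lambda>\<omega>. measure_pmf (\<kappa> j (\<omega> j))) \<in> Pi\<^sub>M {0..<i} M \<rightarrow>\<^sub>M subprob_algebra (M i)"
        by (rule measurable_compose)
      then show ?thesis using Suc by (simp add: P_def[abs_def])
    qed
  qed
  have P_prob: "prob_space (P i x)" for i x by (simp add: P_def measure_pmf.prob_space_axioms)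
  interpret IT: Ionescu_Tulcea P M
    by (rule Ionescu_Tulcea.intro[OF P_measurable P_prob])
  \<comment> \<open>The law of the coordinates below \<open>n\<close>: \<open>DS\<close> is its
    one-step recursion and \<open>lim\<close> identifies it inside the projective limit.\<close>
  define D where "D n = IT.C 0 n (\<lambda>_. undefined)" for n
  let ?L = "IT.PF.lim"
  have spD: "space (D n) = space (PiM {0..<n} M)" "sets (D n) = sets (PiM {0..<n} M)" for n
    unfolding D_def using IT.space_C[of "\<lambda>_. undefined" 0 n] IT.sets_C[of "\<lambda>_. undefined" 0 n]
    by (auto simp: space_PiM)
  have DS: "emeasure (D (Suc n)) B = (\<integral>\<^sup>+\<omega>. emeasure (P n \<omega>) {x. fun_upd \<omega> n x \<in> B} \<partial>D n)"
    if B: "B \<in> sets (PiM {0..<Suc n} M)" for n B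
  proof -
    have "emeasure (D (Suc n)) B = (\<integral>\<^sup>+\<omega>. emeasure (IT.eP n \<omega>) B \<partial>D n)"
    proof -
      have "space (D n) \<noteq> {}"
        using IT.prob_space_C[of "\<lambda>_. undefined" 0 n] prob_space.not_empty
        by (auto simp: D_def space_PiM)
      moreover have "IT.eP n \<in> D n \<rightarrow>\<^sub>M subprob_algebra (PiM {0..<Suc n} M)"
        using IT.measurable_eP[of n] by (simp add: measurable_cong_sets[OF spD(2) refl])
      ultimately show ?thesis using B emeasure_bind[of "D n" "IT.eP n" "PiM {0..<Suc n} M" B]
        by (simp add: D_def)
    qed
    also have "\<dots> = (\<integral>\<^sup>+\<omega>. emeasure (P n \<omega>) {x. fun_upd \<omega> n x \<in> B} \<partial>D n)"
    proof (rule nn_integral_cong)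
      fix \<omega> assume "\<omega> \<in> space (D n)"
      then have "\<omega> \<in> space (PiM {0..<n} M)" by (simp only: spD)
      from IT.emeasure_eP[OF this B] show "emeasure (IT.eP n \<omega>) B = emeasure (P n \<omega>) {x. fun_upd \<omega> n x \<in> B}"
        by (simp add: M_def vimage_def)
    qed
    finally show ?thesis .
  qed
  have lim: "emeasure ?L {\<omega>. restrict \<omega> {0..<n} \<in> B} = emeasure (D n) B"
    if B: "B \<in> sets (PiM {0..<n} M)" for n B
  proof -
    have "emeasure ?L (prod_emb UNIV M {0..<n} B) = emeasure (IT.CI {0..<n}) B"
      by (rule IT.lim) (use B in auto)
    also have "\<dots> = IT.C 0 n (\<lambda>_. undefined) (prod_emb {0..<n} M {0..<n} B)"
      by (rule IT.emeasure_CI) (use B in auto)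
    also have "prod_emb {0..<n} M {0..<n} B = B"
      using sets.sets_into_space[OF B] by (intro prod_emb_id) (simp add: space_PiM)
    also have "prod_emb UNIV M {0..<n} B = {\<omega>. restrict \<omega> {0..<n} \<in> B}"
      by (auto simp: prod_emb_def M_def)
    finally show ?thesis by (simp add: D_def)
  qed
  have setsM: "{\<omega> \<in> space (PiM {0..<n} M). Q \<omega>} \<in> sets (PiM {0..<n} M)"
    if ex: "\<exists>R. \<forall>\<omega>\<in>space (PiM {0..<n} M). Q \<omega> = R (\<omega> i) (\<omega> j)" and ij: "i < n" "j < n" for Q n i j
  proof -
    obtain R where R: "\<forall>\<omega>\<in>space (PiM {0..<n} M). Q \<omega> = R (\<omega> i) (\<omega> j)" using ex by (rule exE)
    have [measurable]: "(\<lambda>\<omega>. \<omega> i) \<in> PiM {0..<n} M \<rightarrow>\<^sub>M count_space UNIV" "(\<lambda>\<omega>. \<omega> j) \<in> PiM {0..<n} M \<rightarrow>\<^sub>M count_space UNIV"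
      using measurable_component_singleton[of i "{0..<n}" M] measurable_component_singleton[of j "{0..<n}" M] ij
      by (auto simp: M_def)
    have "{\<omega> \<in> space (PiM {0..<n} M). R (\<omega> i) (\<omega> j)} \<in> sets (PiM {0..<n} M)" by measurable
    also have "{\<omega> \<in> space (PiM {0..<n} M). R (\<omega> i) (\<omega> j)} = {\<omega> \<in> space (PiM {0..<n} M). Q \<omega>}"
      using R by auto
    finally show ?thesis .
  qed
  have sp: "restrict \<omega> {0..<n} \<in> space (PiM {0..<n} M)" for \<omega> :: "nat \<Rightarrow> 'a" and n
    by (simp add: space_PiM M_def)
  have D1: "emeasure ?L {\<omega>. \<omega> n = y} = emeasure (D (Suc n)) {\<omega> \<in> space (PiM {0..<Suc n} M). \<omega> n = y}" for n y
    using lim[OF setsM[of "Suc n" "\<lambda>\<omega>. \<omega> n = y" n n, OF exI[of _ "\<lambda>a b. a = y"]]] sp by (auto simp del: restrict_apply simp add: restrict_apply')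
  have D2: "emeasure ?L {\<omega>. \<omega> n = y \<and> \<omega> (Suc n) = z} = emeasure (D (Suc (Suc n))) {\<omega> \<in> space (PiM {0..<Suc (Suc n)} M). \<omega> n = y \<and> \<omega> (Suc n) = z}" for n y z
    using lim[OF setsM[of "Suc (Suc n)" "\<lambda>\<omega>. \<omega> n = y \<and> \<omega> (Suc n) = z" n "Suc n", OF exI[of _ "\<lambda>a b. a = y \<and> b = z"]]] sp
    by (auto simp del: restrict_apply simp add: restrict_apply')
  have pD0: "prob_space (D 0)" using IT.prob_space_C[of "\<lambda>_. undefined" 0 0] by (simp add: D_def space_PiM)
  show thesis
  proof (rule that[of ?L])
    have "space ?L = UNIV"
      using sets_eq_imp_space_eq[OF IT.PF.sets_lim] by (simp add: space_PiM M_def)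
    moreover have "emeasure ?L {\<omega>. restrict \<omega> {0..<0} \<in> space (PiM {0..<0} M)} = 1"
    proof -
      from prob_space.emeasure_space_1[OF pD0] lim[OF sets.top, of 0] show ?thesis by (simp only: spD)
    qed
    ultimately show "prob_space ?L" using sp[of _ 0] by (intro prob_spaceI) simp
    show "sets ?L = sets (\<Pi>\<^sub>M i\<in>UNIV. count_space UNIV)"
      using IT.PF.sets_lim by (simp add: M_def)
  next
    fix z
    have "emeasure ?L {\<omega>. \<omega> 0 = z} = (\<integral>\<^sup>+\<omega>. emeasure (P 0 \<omega>) {x. fun_upd \<omega> 0 x \<in> {\<omega> \<in> space (PiM {0..<Suc 0} M). \<omega> 0 = z}} \<partial>D 0)"
      unfolding D1
      by (rule DS[OF setsM[of "Suc 0" "\<lambda>\<omega>. \<omega> 0 = z" 0 0, OF exI[of _ "\<lambda>a b. a = z"]]]) simp_all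
    also have "\<dots> = (\<integral>\<^sup>+\<omega>. ennreal (pmf p0 z) \<partial>D 0)"
    proof (rule nn_integral_cong)
      fix \<omega> assume "\<omega> \<in> space (D 0)"
      then have "{x. fun_upd \<omega> 0 x \<in> {\<omega> \<in> space (PiM {0..<Suc 0} M). \<omega> 0 = z}} = {z}"
        by (auto simp: spD space_PiM M_def PiE_iff extensional_def)
      then show "emeasure (P 0 \<omega>) {x. fun_upd \<omega> 0 x \<in> {\<omega> \<in> space (PiM {0..<Suc 0} M). \<omega> 0 = z}} = ennreal (pmf p0 z)"
        by (simp add: P_def emeasure_pmf_single)
    qed
    also have "\<dots> = ennreal (pmf p0 z)"
      using prob_space.emeasure_space_1[OF pD0] by simp
    finally show "emeasure ?L {\<omega>. \<omega> 0 = z} = ennreal (pmf p0 z)" .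
  next
    fix n y z
    let ?S = "space (PiM {0..<Suc (Suc n)} M)"
    have "emeasure ?L {\<omega>. \<omega> n = y \<and> \<omega> (Suc n) = z}
      = (\<integral>\<^sup>+\<omega>. emeasure (P (Suc n) \<omega>) {x. fun_upd \<omega> (Suc n) x \<in> {\<omega> \<in> ?S. \<omega> n = y \<and> \<omega> (Suc n) = z}} \<partial>D (Suc n))"
      unfolding D2
      by (rule DS[OF setsM[of "Suc (Suc n)" "\<lambda>\<omega>. \<omega> n = y \<and> \<omega> (Suc n) = z" n "Suc n", OF exI[of _ "\<lambda>a b. a = y \<and> b = z"]]]) simp_all
    also have "\<dots> = (\<integral>\<^sup>+\<omega>. ennreal (pmf (\<kappa> n y) z) * indicator {\<omega> \<in> space (PiM {0..<Suc n} M). \<omega> n = y} \<omega> \<partial>D (Suc n))"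
    proof (rule nn_integral_cong)
      fix \<omega> assume \<omega>: "\<omega> \<in> space (D (Suc n))"
      have "{x. fun_upd \<omega> (Suc n) x \<in> {\<omega> \<in> ?S. \<omega> n = y \<and> \<omega> (Suc n) = z}} = (if \<omega> n = y then {z} else {})"
        using \<omega> by (auto simp: spD space_PiM M_def PiE_iff extensional_def)
      then show "emeasure (P (Suc n) \<omega>) {x. fun_upd \<omega> (Suc n) x \<in> {\<omega> \<in> ?S. \<omega> n = y \<and> \<omega> (Suc n) = z}}
        = ennreal (pmf (\<kappa> n y) z) * indicator {\<omega> \<in> space (PiM {0..<Suc n} M). \<omega> n = y} \<omega>"
        using \<omega> by (auto simp: P_def emeasure_pmf_single spD split: split_indicator)
    qed
    also have "\<dots> = ennreal (pmf (\<kappa> n y) z) * emeasure (D (Suc n)) {\<omega> \<in> space (PiM {0..<Suc n} M). \<omega> n = y}"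
      using setsM[of "Suc n" "\<lambda>\<omega>. \<omega> n = y" n n, OF exI[of _ "\<lambda>a b. a = y"]] by (subst nn_integral_cmult_indicator) (auto simp: spD)
    finally show "emeasure ?L {\<omega>. \<omega> n = y \<and> \<omega> (Suc n) = z} = emeasure ?L {\<omega>. \<omega> n = y} * ennreal (pmf (\<kappa> n y) z)"
      by (simp add: D1 mult.commute)
  qed
qed

section \<open>Neighbouring cubes and decreasing compact sets\<close>

lemma
  fixes A :: "'n::finite \<Rightarrow> 'a set"
  assumes "\<And>i. finite (A i)"
  shows finite_vec_set: "finite {w :: 'a ^ 'n. \<forall>i. w $ i \<in> A i}"
    and card_vec_set: "card {w :: 'a ^ 'n. \<forall>i. w $ i \<in> A i} = (\<Prod>i\<in>UNIV. card (A i))"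
proof -
  have "bij_betw vec_nth {w :: 'a ^ 'n. \<forall>i. w $ i \<in> A i} (PiE UNIV A)"
    by (rule bij_betwI[of _ _ _ vec_lambda]) auto
  moreover have "finite (PiE UNIV A)" using assms by (intro finite_PiE) auto
  ultimately show "finite {w :: 'a ^ 'n. \<forall>i. w $ i \<in> A i}"
    "card {w :: 'a ^ 'n. \<forall>i. w $ i \<in> A i} = (\<Prod>i\<in>UNIV. card (A i))"
    by (auto simp: bij_betw_finite bij_betw_same_card card_PiE)
qed

lemma dcube_iff: "y \<in> dcube (m, z) \<longleftrightarrow> (\<forall>i. real_of_int (z $ i) \<le> 2 ^ m * y $ i \<and> 2 ^ m * y $ i < z $ i + 1)"
  by (auto simp: dcube_def dcode_def vec_eq_iff floor_eq_iff)

definition dnbr :: "nat \<times> (int ^ 'n) \<Rightarrow> (nat \<times> (int ^ 'n)) set" where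
  "dnbr q = Pair (fst q) ` {w. \<forall>i. w $ i \<in> {snd q $ i - 1..snd q $ i + 1}}"

lemma emeasure_dnbr:
  "emeasure (dmeas s) (dnbr (q :: nat \<times> (int ^ 'n))) \<le> 3 ^ CARD('n) * emeasure (dmeas s) {q}"
proof -
  have fin: "finite (dnbr q)"
    unfolding dnbr_def by (intro finite_imageI finite_vec_set) auto
  have "emeasure (dmeas s) (dnbr q) = (\<Sum>p\<in>dnbr q. emeasure (dmeas s) {p})"
    using fin by (intro emeasure_eq_sum_singleton) auto
  also have "\<dots> = (\<Sum>p\<in>dnbr q. emeasure (dmeas s) {q})"
    by (intro sum.cong refl) (auto simp: emeasure_dmeas_singleton dnbr_def)
  also have "\<dots> = of_nat (card (dnbr q)) * emeasure (dmeas s) {q}" by simp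
  also have "card (dnbr q) = 3 ^ CARD('n)"
    unfolding dnbr_def by (subst card_image) (simp_all add: inj_on_def card_vec_set del: atLeastAtMost_iff)
  finally show ?thesis by simp
qed

text \<open>Half-open cubes are not open, so a cover by them has no finite subcover for free.
  Enlarging each to its block of \<open>3 ^ CARD('n)\<close> neighbours leaves room for an open set
  in between, at the price of a constant factor.\<close>

lemma dcube_neighbourhood:
  fixes q :: "nat \<times> (int ^ 'n)"
  obtains U where "open U" "dcube q \<subseteq> U" "U \<subseteq> (\<Union>p\<in>dnbr q. dcube p)"
proof -
  let ?U = "(\<Inter>i. {y :: real ^ 'n. real_of_int (snd q $ i) - 1 < 2 ^ fst q * y $ i} \<inter> {y. 2 ^ fst q * y $ i < snd q $ i + 2})"
  have "open ?U" by (intro open_INT open_Int open_Collect_less continuous_intros ballI) auto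
  moreover have "dcube q \<subseteq> ?U"
  proof
    fix y assume "y \<in> dcube q"
    then have "real_of_int (snd q $ i) \<le> 2 ^ fst q * y $ i" "2 ^ fst q * y $ i < snd q $ i + 1" for i
      using dcube_iff[of y "fst q" "snd q"] by auto
    then have "real_of_int (snd q $ i) - 1 < 2 ^ fst q * y $ i \<and> 2 ^ fst q * y $ i < real_of_int (snd q $ i) + 2" for i
      by (auto simp: algebra_simps) (smt (verit))+
    then show "y \<in> ?U" by auto
  qed
  moreover have "?U \<subseteq> (\<Union>p\<in>dnbr q. dcube p)"
  proof
    fix y assume y: "y \<in> ?U"
    have "dcode (fst q) y $ i \<in> {snd q $ i - 1..snd q $ i + 1}" for i
    proof -
      have "real_of_int (snd q $ i) - 1 < 2 ^ fst q * y $ i" "2 ^ fst q * y $ i < snd q $ i + 2"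
        using y by auto
      then show ?thesis by (simp add: dcode_def) linarith
    qed
    then have "(fst q, dcode (fst q) y) \<in> dnbr q" by (auto simp: dnbr_def)
    then show "y \<in> (\<Union>p\<in>dnbr q. dcube p)" using dcube_code by blast
  qed
  ultimately show thesis by (rule that)
qed

text \<open>If the intersection had content below \<open>b / 3 ^ CARD('n)\<close>, finitely many of
  the enlarged cubes would cover it and hence, by compactness, some \<open>K m\<close>, at cost at
  most \<open>b\<close>. The loss of a constant is harmless since only positivity of the content is
  wanted.\<close>

lemma dcontent_compact_INT:
  fixes K :: "nat \<Rightarrow> (real ^ 'n) set"
  assumes K: "\<And>m. compact (K m)" "decseq K" "\<And>m. b < dcontent s (K m)" and b: "0 < b"
  shows "dcontent s (\<Inter>m. K m) > 0"
proof (rule ccontr)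
  assume "\<not> dcontent s (\<Inter>m. K m) > 0"
  then have "dcontent s (\<Inter>m. K m) < b / 3 ^ CARD('n)"
    using b by (simp add: ennreal_zero_less_divide not_gr_zero less_top[symmetric] power_eq_top_ennreal)
  then obtain Q where Q: "(\<Inter>m. K m) \<subseteq> (\<Union>q\<in>Q. dcube q)" "emeasure (dmeas s) Q < b / 3 ^ CARD('n)"
    by (rule dcontent_less)
  have "\<forall>q :: nat \<times> (int ^ 'n). \<exists>U. open U \<and> dcube q \<subseteq> U \<and> U \<subseteq> (\<Union>p\<in>dnbr q. dcube p)"
    using dcube_neighbourhood by metis
  then obtain U where U: "\<And>q :: nat \<times> (int ^ 'n). open (U q)" "\<And>q. dcube q \<subseteq> U q" "\<And>q. U q \<subseteq> (\<Union>p\<in>dnbr q. dcube p)"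
    by metis
  have "compact (\<Inter>m. K m)" using K(1) by (intro compact_Inter) auto
  moreover have "(\<Inter>m. K m) \<subseteq> (\<Union>q\<in>Q. U q)" using Q(1) U(2) by blast
  ultimately obtain R where R: "R \<subseteq> Q" "finite R" "(\<Inter>m. K m) \<subseteq> (\<Union>q\<in>R. U q)"
    using U(1) by (metis compactE_image)
  have "\<exists>m. K m \<subseteq> (\<Union>q\<in>R. U q)"
  proof (rule ccontr)
    assume *: "\<not> (\<exists>m. K m \<subseteq> (\<Union>q\<in>R. U q))"
    have "(\<Inter>m. K m - (\<Union>q\<in>R. U q)) \<noteq> {}"
    proof (rule compact_nest)
      show "compact (K m - (\<Union>q\<in>R. U q))" for m
        using K(1) U(1) by (intro compact_diff open_UN) auto
      show "K m - (\<Union>q\<in>R. U q) \<noteq> {}" for m using * by blast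
      show "K m - (\<Union>q\<in>R. U q) \<subseteq> K l - (\<Union>q\<in>R. U q)" if "l \<le> m" for l m
        using K(2) that by (auto simp: decseq_def)
    qed
    then show False using R(3) by blast
  qed
  then obtain m where m: "K m \<subseteq> (\<Union>q\<in>R. U q)" by blast
  have "dcontent s (K m) \<le> emeasure (dmeas s) (\<Union>q\<in>R. dnbr q)"
    using m U(3) by (intro dcontent_le) blast
  also have "\<dots> \<le> (\<Sum>q\<in>R. emeasure (dmeas s) (dnbr q))"
    using R(2) by (intro emeasure_subadditive_finite) auto
  also have "\<dots> \<le> (\<Sum>q\<in>R. 3 ^ CARD('n) * emeasure (dmeas s) {q})"
    by (intro sum_mono emeasure_dnbr)
  also have "\<dots> = 3 ^ CARD('n) * emeasure (dmeas s) R"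
    by (subst emeasure_eq_sum_singleton[OF R(2), of "dmeas s"]) (auto simp: sum_distrib_left)
  also have "\<dots> \<le> 3 ^ CARD('n) * emeasure (dmeas s) Q"
    by (rule mult_left_mono[OF emeasure_mono[OF R(1)] zero_le]) simp
  also have "\<dots> \<le> 3 ^ CARD('n) * (b / 3 ^ CARD('n))"
    by (rule mult_left_mono[OF less_imp_le[OF Q(2)] zero_le])
  also have "\<dots> = b"
    using b by (simp add: ennreal_times_divide mult.commute[of _ b] ennreal_mult_divide_eq power_eq_top_ennreal)
  finally show False using K(3)[of m] by simp
qed

lemma dcube_children:
  "dcube (m, z) \<subseteq> (\<Union>w\<in>{w. \<forall>i. w $ i \<in> {2 * z $ i .. 2 * z $ i + 1}}. dcube (Suc m, w))"
proof
  fix y assume y: "y \<in> dcube (m, z)"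
  have "dcode (Suc m) y $ i \<in> {2 * z $ i .. 2 * z $ i + 1}" for i
  proof -
    have "real_of_int (z $ i) \<le> 2 ^ m * y $ i" "2 ^ m * y $ i < z $ i + 1"
      using y by (auto simp: dcube_iff)
    then show ?thesis by (simp add: dcode_def) linarith
  qed
  then show "y \<in> (\<Union>w\<in>{w. \<forall>i. w $ i \<in> {2 * z $ i .. 2 * z $ i + 1}}. dcube (Suc m, w))"
    using dcube_code[of y "Suc m"] by blast
qed

text \<open>A mass function with \<open>a\<close> at a node at most the sum of \<open>a\<close> over its children can be distributed
  from the root so that no node receives more than its \<open>a\<close>.\<close>

lemma splitting_pmf:
  fixes a :: "'a \<Rightarrow> real"
  assumes "finite W" "W \<noteq> {}" "\<And>w. 0 \<le> a w" "0 \<le> t" "t \<le> (\<Sum>w\<in>W. a w)"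
  obtains p where "set_pmf p \<subseteq> W" "\<And>w. t * pmf p w \<le> a w"
proof (cases "t = 0")
  case True
  then show ?thesis using assms that[of "pmf_of_set W"] by auto
next
  case False
  define S where "S = (\<Sum>w\<in>W. a w)"
  have S: "0 < S" "t \<le> S" using False assms by (auto simp: S_def)
  define f where "f w = (if w \<in> W then a w / S else 0)" for w
  have f0: "0 \<le> f w" for w using assms S by (simp add: f_def)
  have "(\<integral>\<^sup>+w. ennreal (f w) \<partial>count_space UNIV) = (\<integral>\<^sup>+w. ennreal (f w) \<partial>count_space W)"
    by (intro nn_integral_count_space_eq) (auto simp: f_def)
  also have "\<dots> = ennreal (\<Sum>w\<in>W. f w)"
    using assms(1) f0 by (simp add: nn_integral_count_space_finite)
  also have "(\<Sum>w\<in>W. f w) = 1"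
    using S by (simp add: f_def sum_divide_distrib[symmetric] S_def[symmetric])
  finally have 1: "(\<integral>\<^sup>+w. ennreal (f w) \<partial>count_space UNIV) = 1" by simp
  have pmf: "pmf (embed_pmf f) w = f w" for w using f0 1 by (intro pmf_embed_pmf) auto
  show ?thesis
  proof (rule that[of "embed_pmf f"])
    show "set_pmf (embed_pmf f) \<subseteq> W" by (auto simp: set_pmf_eq pmf f_def)
    show "t * pmf (embed_pmf f) w \<le> a w" for w
    proof (cases "w \<in> W")
      case True
      have "t * (a w / S) = t / S * a w" by simp
      also have "\<dots> \<le> 1 * a w" using S assms by (intro mult_right_mono) auto
      finally show ?thesis using True by (simp add: pmf f_def)
    qed (use assms in \<open>simp add: pmf f_def\<close>)
  qed
qed

lemma div2_bracket: "2 * (k::int) \<le> l \<and> l \<le> 1 + 2 * k \<Longrightarrow> k = l div 2"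
  by presburger

text \<open>The contents \<open>a m z\<close> of the pieces of \<open>K\<close> are subadditive over
  children, so a random descent through the dyadic tree can be arranged to visit each cube with
  probability at most \<open>a m z / a0\<close>. The law of the limit point is the measure sought,
  as \<open>a m z\<close> is at most the \<open>s\<close>-th power of the side of the cube.\<close>

lemma frostman_compact:
  fixes K :: "(real ^ 'n) set"
  assumes K: "compact K" "K \<subseteq> dcube (0, z0)" "dcontent s K > 0" and s: "s > 0"
  obtains \<mu> C where "prob_space \<mu>" "sets \<mu> = sets borel" "emeasure \<mu> K = 1" "C > 0"
    "\<And>x r. r > 0 \<Longrightarrow> measure \<mu> (ball x r) \<le> C * r powr s"
proof -
  define a where "a m z = enn2real (dcontent s (K \<inter> dcube (m, z)))" for m z
  have le: "dcontent s (K \<inter> dcube (m, z)) \<le> ennreal (2 powr (- real m * s))" for m z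
    using dcontent_dcube[of "K \<inter> dcube (m, z)" "(m, z)" s] by simp
  then have a: "ennreal (a m z) = dcontent s (K \<inter> dcube (m, z))" for m z
    unfolding a_def by (intro ennreal_enn2real) (meson ennreal_less_top le_less_trans)
  have a_le: "a m z \<le> 2 powr (- real m * s)" for m z
    using le[of m z] unfolding a[symmetric] by (subst (asm) ennreal_le_iff) auto
  have a_nonneg: "0 \<le> a m z" for m z by (simp add: a_def)
  define W where "W z = {w :: int ^ 'n. \<forall>i. w $ i \<in> {2 * z $ i .. 2 * z $ i + 1}}" for z
  have finW: "finite (W z)" for z unfolding W_def by (rule finite_vec_set) simp
  have "(\<chi> i. 2 * z $ i) \<in> W z" for z by (simp add: W_def)
  then have neW: "W z \<noteq> {}" for z by auto
  have a_sum: "a m z \<le> (\<Sum>w\<in>W z. a (Suc m) w)" for m z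
  proof -
    have "dcontent s (K \<inter> dcube (m, z)) \<le> dcontent s (\<Union>w\<in>W z. K \<inter> dcube (Suc m, w))"
      using dcube_children[of m z] unfolding W_def by (intro dcontent_mono) blast
    also have "\<dots> \<le> (\<Sum>w\<in>W z. dcontent s (K \<inter> dcube (Suc m, w)))"
      by (rule dcontent_finite_UN[OF finW])
    finally show ?thesis
      unfolding a[symmetric] using a_nonneg by (simp add: sum_ennreal ennreal_le_iff sum_nonneg)
  qed
  have "\<forall>m z. \<exists>p. set_pmf p \<subseteq> W z \<and> (\<forall>w. a m z * pmf p w \<le> a (Suc m) w)"
    using splitting_pmf[OF finW neW a_nonneg a_nonneg a_sum] by metis
  then obtain \<kappa> where "\<forall>m z. set_pmf (\<kappa> m z) \<subseteq> W z \<and> (\<forall>w. a m z * pmf (\<kappa> m z) w \<le> a (Suc m) w)"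
    unfolding choice_iff by (elim exE)
  then have \<kappa>: "\<And>m z. set_pmf (\<kappa> m z) \<subseteq> W z" "\<And>m z w. a m z * pmf (\<kappa> m z) w \<le> a (Suc m) w"
    by blast+
  obtain L :: "(nat \<Rightarrow> int ^ 'n) measure" where L: "prob_space L" "sets L = sets (\<Pi>\<^sub>M i\<in>UNIV. count_space UNIV)"
    "\<And>z. emeasure L {\<omega>. \<omega> 0 = z} = ennreal (pmf (return_pmf z0) z)"
    "\<And>n y z. emeasure L {\<omega>. \<omega> n = y \<and> \<omega> (Suc n) = z} = emeasure L {\<omega>. \<omega> n = y} * ennreal (pmf (\<kappa> n y) z)"
    using markov_chain_exists[of "return_pmf z0" \<kappa>] by blast
  interpret L: prob_space L by fact
  have spL: "space L = UNIV" using sets_eq_imp_space_eq[OF L(2)] by (simp add: space_PiM)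
  have coord[measurable]: "(\<lambda>\<omega>. \<omega> m) \<in> L \<rightarrow>\<^sub>M count_space UNIV" for m
    using measurable_component_singleton[of m UNIV "\<lambda>_. count_space UNIV"] by (simp add: measurable_cong_sets[OF L(2) refl])
  have [measurable]: "{\<omega>. Q (\<omega> m) (\<omega> n)} \<in> sets L" for Q m n
  proof -
    have "{\<omega> \<in> space L. Q (\<omega> m) (\<omega> n)} \<in> sets L" by measurable
    then show ?thesis by (simp add: spL)
  qed
  have ae1: "AE \<omega> in L. \<forall>m. \<omega> (Suc m) \<in> W (\<omega> m)"
  proof -
    have "AE \<omega> in L. z \<notin> W y \<longrightarrow> \<not> (\<omega> m = y \<and> \<omega> (Suc m) = z)" for m y z
    proof (cases "z \<in> W y")
      case False
      then have "pmf (\<kappa> m y) z = 0" using \<kappa>(1)[of m y] by (auto simp: pmf_eq_0_set_pmf)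
      then have "emeasure L {\<omega>. \<omega> m = y \<and> \<omega> (Suc m) = z} = 0" by (simp add: L(4))
      then show ?thesis by (intro AE_I[of _ _ "{\<omega>. \<omega> m = y \<and> \<omega> (Suc m) = z}"]) auto
    qed simp
    then have "AE \<omega> in L. \<forall>m y z. z \<notin> W y \<longrightarrow> \<not> (\<omega> m = y \<and> \<omega> (Suc m) = z)"
      unfolding AE_all_countable by blast
    then show ?thesis by eventually_elim auto
  qed
  define a0 where "a0 = a 0 z0"
  have "K \<inter> dcube (0, z0) = K" using K(2) by blast
  then have a0: "a0 > 0" using K(3) a[of 0 z0] by (simp add: a0_def flip: ennreal_less_zero_iff)
  have pr: "measure L {\<omega>. \<omega> m = z} * a0 \<le> a m z" for m z
  proof (induction m arbitrary: z)
    case 0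
    have "measure L {\<omega>. \<omega> 0 = z} = pmf (return_pmf z0) z"
      using L(3)[of z] by (simp add: measure_def)
    then show ?case using a_nonneg by (auto simp: a0_def split: split_indicator)
  next
    case (Suc m)
    \<comment> \<open>The parent of \<open>z\<close>, almost surely the only state from which
      \<open>z\<close> can be entered.\<close>
    define y where "y = (\<chi> i. z $ i div 2)"
    have "measure L {\<omega>. \<omega> (Suc m) = z} = measure L {\<omega>. \<omega> m = y \<and> \<omega> (Suc m) = z}"
    proof (rule measure_eq_AE)
      show "AE \<omega> in L. (\<omega> \<in> {\<omega>. \<omega> (Suc m) = z}) = (\<omega> \<in> {\<omega>. \<omega> m = y \<and> \<omega> (Suc m) = z})"
        using ae1
      proof eventually_elim
        case (elim \<omega>)
        have "\<omega> m = y" if "\<omega> (Suc m) = z"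
        proof -
          have "z $ i \<in> {2 * \<omega> m $ i .. 2 * \<omega> m $ i + 1}" for i
            using elim that unfolding W_def by (metis (mono_tags, lifting) mem_Collect_eq)
          then have "2 * \<omega> m $ i \<le> z $ i \<and> z $ i \<le> 2 * \<omega> m $ i + 1" for i by simp
          then have "\<omega> m $ i = z $ i div 2" for i
            by (metis (no_types) add.commute div2_bracket)
          then show ?thesis by (simp add: y_def vec_eq_iff)
        qed
        then show ?case by auto
      qed
    qed auto
    also have "\<dots> = measure L {\<omega>. \<omega> m = y} * pmf (\<kappa> m y) z"
      using L(4)[of m y z] by (simp add: L.emeasure_eq_measure flip: ennreal_mult)
    finally have "measure L {\<omega>. \<omega> (Suc m) = z} * a0 = (measure L {\<omega>. \<omega> m = y} * a0) * pmf (\<kappa> m y) z"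
      by simp
    also have "\<dots> \<le> a m y * pmf (\<kappa> m y) z" by (intro mult_right_mono Suc) simp
    also have "\<dots> \<le> a (Suc m) z" by (rule \<kappa>)
    finally show ?case .
  qed
  have ae2: "AE \<omega> in L. \<forall>m. a m (\<omega> m) > 0"
  proof -
    have "AE \<omega> in L. a m z = 0 \<longrightarrow> \<omega> m \<noteq> z" for m z
    proof (cases "a m z = 0")
      case True
      then have "measure L {\<omega>. \<omega> m = z} = 0" using pr[of m z] a0 by (simp add: measure_le_0_iff mult_le_0_iff)
      then have "emeasure L {\<omega>. \<omega> m = z} = 0" by (simp add: L.emeasure_eq_measure)
      then show ?thesis by (intro AE_I[of _ _ "{\<omega>. \<omega> m = z}"]) auto
    qed simp
    then have "AE \<omega> in L. \<forall>m z. a m z = 0 \<longrightarrow> \<omega> m \<noteq> z" unfolding AE_all_countable by blast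
    then show ?thesis by eventually_elim (metis a_nonneg less_eq_real_def)
  qed
  define X where "X \<omega> = lim (\<lambda>m. (\<chi> i. real_of_int (\<omega> m $ i) / 2 ^ m) :: real ^ 'n)" for \<omega> :: "nat \<Rightarrow> int ^ 'n"
  have X_meas[measurable]: "X \<in> L \<rightarrow>\<^sub>M borel"
    unfolding X_def
  proof (rule borel_measurable_lim_metric)
    fix m
    have "(\<lambda>z :: int ^ 'n. (\<chi> i. real_of_int (z $ i) / 2 ^ m) :: real ^ 'n) \<in> count_space UNIV \<rightarrow>\<^sub>M borel" by simp
    from measurable_compose[OF coord[of m] this]
    show "(\<lambda>\<omega>. (\<chi> i. real_of_int (\<omega> m $ i) / 2 ^ m) :: real ^ 'n) \<in> borel_measurable L" .
  qed
  \<comment> \<open>The upper inequality is not strict: the limit of the corners may lie on an upper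
    face of a half-open cube of the descent.\<close>
  have X: "real_of_int (\<omega> m $ i) \<le> 2 ^ m * X \<omega> $ i \<and> 2 ^ m * X \<omega> $ i \<le> \<omega> m $ i + 1"
    if \<omega>: "\<forall>m. \<omega> (Suc m) \<in> W (\<omega> m)" for \<omega> m i
  proof -
    define u where "u i m = real_of_int (\<omega> m $ i) / 2 ^ m" for i m
    define v where "v i m = (real_of_int (\<omega> m $ i) + 1) / 2 ^ m" for i m
    have w: "2 * \<omega> m $ i \<le> \<omega> (Suc m) $ i" "\<omega> (Suc m) $ i \<le> 2 * \<omega> m $ i + 1" for m i
      using \<omega> by (auto simp: W_def)
    have w': "2 * real_of_int (\<omega> m $ i) \<le> \<omega> (Suc m) $ i" "\<omega> (Suc m) $ i \<le> 2 * real_of_int (\<omega> m $ i) + 1" for m i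
      using w[of m i] by linarith+
    have inc: "incseq (u i)" for i
      using w'(1)[of _ i] by (intro incseq_SucI) (simp add: u_def field_simps)
    have dec: "decseq (v i)" for i
    proof (rule decseq_SucI)
      fix m
      have "v i (Suc m) \<le> (2 * real_of_int (\<omega> m $ i) + 1 + 1) / 2 ^ Suc m"
        unfolding v_def using w'(2)[of m i] by (intro divide_right_mono add_mono) auto
      also have "\<dots> = v i m" by (simp add: v_def field_simps)
      finally show "v i (Suc m) \<le> v i m" .
    qed
    have uv: "u i m \<le> v i m" for i m by (simp add: u_def v_def divide_right_mono)
    have uv': "u i m \<le> v i n" for i m n
      using incseqD[OF inc, of m "max m n" i] decseqD[OF dec, of n "max m n" i] uv[of i "max m n"] by simp
    have "\<exists>l. u i \<longlonglongrightarrow> l \<and> (\<forall>m. u i m \<le> l)" for i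
      using incseq_convergent[OF inc[of i], of "v i 0"] uv' by metis
    then obtain l where l: "\<And>i. u i \<longlonglongrightarrow> l i" "\<And>i m. u i m \<le> l i" by metis
    have lv: "l i \<le> v i n" for i n
      using l(1)[of i] by (rule LIMSEQ_le_const2) (use uv' in blast)
    have "(\<lambda>m. \<chi> i. u i m) \<longlonglongrightarrow> (\<chi> i. l i)"
      using l(1) by (intro vec_tendstoI) simp
    then have "X \<omega> = (\<chi> i. l i)" unfolding X_def u_def by (rule limI)
    then have "X \<omega> $ i = l i" by simp
    then show ?thesis using l(2)[of i m] lv[of i m] by (simp add: u_def v_def field_simps)
  qed
  \<comment> \<open>Almost every descent visits only cubes of positive content. Each of them meets
    \<open>K\<close>, so \<open>X \<omega>\<close> is a limit of points of \<open>K\<close>.\<close>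
  have aeK: "AE \<omega> in L. X \<omega> \<in> K"
    using ae1 ae2
  proof eventually_elim
    case (elim \<omega>)
    have "\<exists>y\<in>K. dist y (X \<omega>) < e" if "e > 0" for e
    proof -
      have "(\<lambda>m. real CARD('n) / 2 ^ m) \<longlonglongrightarrow> 0" by real_asymp
      then have "eventually (\<lambda>m. real CARD('n) / 2 ^ m < e) sequentially"
        using \<open>e > 0\<close> by (rule order_tendstoD)
      then obtain m where m: "real CARD('n) / 2 ^ m < e" by (auto simp: eventually_sequentially)
      have "dcontent s (K \<inter> dcube (m, \<omega> m)) \<noteq> 0" using elim(2)[rule_format, of m] by (auto simp: a_def)
      then have "K \<inter> dcube (m, \<omega> m) \<noteq> {}" using dcontent_empty by metis
      then obtain y where y: "y \<in> K" "y \<in> dcube (m, \<omega> m)" by blast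
      have "\<bar>(y - X \<omega>) $ i\<bar> \<le> 1 / 2 ^ m" for i
      proof -
        have "real_of_int (\<omega> m $ i) \<le> 2 ^ m * y $ i" "2 ^ m * y $ i < \<omega> m $ i + 1"
          using y(2) by (auto simp: dcube_iff)
        then have "\<bar>2 ^ m * y $ i - 2 ^ m * X \<omega> $ i\<bar> \<le> 1" using X[OF elim(1), of m i] by simp linarith
        also have "2 ^ m * y $ i - 2 ^ m * X \<omega> $ i = 2 ^ m * (y - X \<omega>) $ i" by (simp add: algebra_simps)
        finally have "2 ^ m * \<bar>(y - X \<omega>) $ i\<bar> \<le> 1" by (simp only: abs_mult power_abs abs_numeral)
        then show ?thesis by (simp add: field_simps)
      qed
      then have "(\<Sum>i\<in>UNIV. \<bar>(y - X \<omega>) $ i\<bar>) \<le> (\<Sum>i\<in>(UNIV :: 'n set). 1 / 2 ^ m)" by (intro sum_mono) auto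
      then have "dist y (X \<omega>) \<le> real CARD('n) / 2 ^ m" using norm_le_l1_cart[of "y - X \<omega>"] by (simp add: dist_norm)
      then show ?thesis using y m by force
    qed
    then show ?case using K(1) by (metis closed_approachable compact_imp_closed)
  qed
  define \<mu> where "\<mu> = distr L borel X"
  \<comment> \<open>The value 1 serves radii \<open>r \<ge> 1\<close>. For smaller radii,
    \<open>4 ^ CARD('n)\<close> counts the cubes of side comparable to \<open>r\<close> that may be
    hit, and \<open>2 powr s\<close> comes from a side of less than \<open>2 * r\<close>.\<close>
  define C where "C = max 1 (4 ^ CARD('n) * 2 powr s / a0)"
  show thesis
  proof (rule that[of \<mu> C])
    show \<mu>: "prob_space \<mu>" unfolding \<mu>_def by (rule L.prob_space_distr) simp
    show "sets \<mu> = sets borel" by (simp add: \<mu>_def)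
    have [measurable]: "K \<in> sets borel" using K(1) by (rule borel_compact)
    show "emeasure \<mu> K = 1"
      unfolding \<mu>_def by (subst emeasure_distr) (use aeK in \<open>auto simp: vimage_def Int_def conj_commute intro!: L.emeasure_eq_1_AE\<close>)
    show "C > 0" by (simp add: C_def)
    fix x and r :: real assume r: "r > 0"
    interpret \<mu>: prob_space \<mu> by fact
    show "measure \<mu> (ball x r) \<le> C * r powr s"
    proof (cases "r \<ge> 1")
      case True
      have "measure \<mu> (ball x r) \<le> 1 * 1" by simp
      also have "\<dots> \<le> C * r powr s" using True s by (intro mult_mono) (auto simp: C_def ge_one_powr_ge_zero)
      finally show ?thesis .
    next
      case False
      have "(\<lambda>m. (1/2) ^ m :: real) \<longlonglongrightarrow> 0" by (rule LIMSEQ_realpow_zero) auto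
      then have "eventually (\<lambda>m. (1/2) ^ m < r) sequentially" using r by (rule order_tendstoD)
      then have ex: "\<exists>m. (1/2) ^ m < r" by (auto simp: eventually_sequentially)
      \<comment> \<open>Chosen so that \<open>(1/2) ^ Suc m < r \<le> (1/2) ^ m\<close>; the least
        exponent is positive because \<open>r < 1\<close>, which makes the subtraction
        harmless.\<close>
      define m where "m = (LEAST m. (1/2::real) ^ m < r) - 1"
      have "(LEAST m. (1/2::real) ^ m < r) \<noteq> 0" using LeastI_ex[OF ex] False by (metis less_imp_le power_0)
      then have Sm: "(LEAST m. (1/2::real) ^ m < r) = Suc m" by (simp add: m_def)
      then have m: "(1/2) ^ Suc m < r" "r \<le> (1/2) ^ m"
        using LeastI_ex[OF ex] not_less_Least[of m "\<lambda>m. (1/2::real) ^ m < r"] by auto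
      \<comment> \<open>Four integers per coordinate suffice for the codes of all level
        \<open>m\<close> cubes whose closure comes within \<open>(1/2) ^ m\<close> of
        \<open>x\<close> in each coordinate.\<close>
      define V where "V = {w :: int ^ 'n. \<forall>i. w $ i \<in> {\<lfloor>2 ^ m * x $ i\<rfloor> - 2..\<lfloor>2 ^ m * x $ i\<rfloor> + 1}}"
      have finV: "finite V" unfolding V_def by (rule finite_vec_set) simp
      have "card V = (\<Prod>i\<in>(UNIV :: 'n set). card {\<lfloor>2 ^ m * x $ i\<rfloor> - 2..\<lfloor>2 ^ m * x $ i\<rfloor> + 1})"
        unfolding V_def by (rule card_vec_set) simp
      then have cardV: "card V = 4 ^ CARD('n)" by simp
      have "measure \<mu> (ball x r) = measure L {\<omega>. X \<omega> \<in> ball x r}"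
        unfolding \<mu>_def by (subst measure_distr) (auto simp: vimage_def spL)
      also have "\<dots> \<le> measure L {\<omega>. \<omega> m \<in> V}"
      proof (rule L.finite_measure_mono_AE)
        show "AE \<omega> in L. \<omega> \<in> {\<omega>. X \<omega> \<in> ball x r} \<longrightarrow> \<omega> \<in> {\<omega>. \<omega> m \<in> V}"
          using ae1
        proof eventually_elim
          case (elim \<omega>)
          have "\<omega> m $ i \<in> {\<lfloor>2 ^ m * x $ i\<rfloor> - 2..\<lfloor>2 ^ m * x $ i\<rfloor> + 1}" if *: "X \<omega> \<in> ball x r" for i
          proof -
            have "\<bar>(x - X \<omega>) $ i\<bar> < (1/2) ^ m"
              using component_le_norm_cart[of "x - X \<omega>" i] * m(2) by (simp add: dist_norm)
            then have "2 ^ m * \<bar>(x - X \<omega>) $ i\<bar> < 1" by (simp add: field_simps power_divide)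
            then have "\<bar>2 ^ m * (x - X \<omega>) $ i\<bar> < 1" by (simp only: abs_mult power_abs abs_numeral)
            also have "2 ^ m * (x - X \<omega>) $ i = 2 ^ m * x $ i - 2 ^ m * X \<omega> $ i" by (simp add: algebra_simps)
            finally have "\<bar>2 ^ m * x $ i - 2 ^ m * X \<omega> $ i\<bar> < 1" .
            then show ?thesis using X[OF elim, of m i] by (simp del: of_int_add) linarith
          qed
          then show ?case by (auto simp: V_def)
        qed
      qed simp
      also have "{\<omega>. \<omega> m \<in> V} = (\<Union>z\<in>V. {\<omega>. \<omega> m = z})" by auto
      also have "measure L \<dots> \<le> (\<Sum>z\<in>V. measure L {\<omega>. \<omega> m = z})"
        by (rule L.finite_measure_subadditive_finite[OF finV]) auto
      also have "\<dots> \<le> (\<Sum>z\<in>V. 2 powr (- real m * s) / a0)"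
      proof (rule sum_mono)
        fix z
        have "measure L {\<omega>. \<omega> m = z} * a0 \<le> 2 powr (- real m * s)" using pr[of m z] a_le[of m z] by simp
        then show "measure L {\<omega>. \<omega> m = z} \<le> 2 powr (- real m * s) / a0" using a0 by (simp add: pos_le_divide_eq)
      qed
      also have "\<dots> = 4 ^ CARD('n) / a0 * (2 powr (- real m)) powr s" by (simp add: cardV powr_powr)
      also have "2 powr (- real m) = (1/2) ^ m" by (simp add: powr_minus powr_realpow power_one_over inverse_eq_divide)
      also have "4 ^ CARD('n) / a0 * ((1/2) ^ m) powr s \<le> 4 ^ CARD('n) / a0 * (2 * r) powr s"
        using m(1) a0 s by (intro mult_left_mono powr_mono2) auto
      also have "\<dots> = (4 ^ CARD('n) * 2 powr s / a0) * r powr s" using r by (simp add: powr_mult)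
      also have "\<dots> \<le> C * r powr s" by (intro mult_right_mono) (auto simp: C_def)
      finally show ?thesis .
    qed
  qed
qed

text \<open>The \<open>2 ^ (m * CARD('n))\<close> subcubes of level \<open>m\<close> cost
  \<open>2 powr (- m s)\<close> each, and the total tends to 0 as \<open>m\<close> grows. This is
  what bounds the Hausdorff dimension by \<open>CARD('n)\<close>.\<close>

lemma dcontent_unit_zero:
  assumes "s > real CARD('n)" "A \<subseteq> dcube (0, z :: int ^ 'n)"
  shows "dcontent s A = 0"
proof -
  have bound: "dcontent s A \<le> ennreal (2 powr (real m * (real CARD('n) - s)))" for m
  proof -
    define W where "W = {w :: int ^ 'n. \<forall>i. w $ i \<in> {2 ^ m * z $ i ..< 2 ^ m * z $ i + 2 ^ m}}"
    have "finite W" unfolding W_def by (rule finite_vec_set) simp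
    have "card W = (\<Prod>i\<in>(UNIV :: 'n set). card {2 ^ m * z $ i ..< 2 ^ m * z $ i + 2 ^ m})"
      unfolding W_def by (rule card_vec_set) simp
    then have card: "card W = (2 ^ m) ^ CARD('n)" by (simp add: nat_power_eq)
    have "A \<subseteq> (\<Union>w\<in>W. dcube (m, w))"
    proof
      fix y assume "y \<in> A"
      then have y: "y \<in> dcube (0, z)" using assms(2) by blast
      have "dcode m y $ i \<in> {2 ^ m * z $ i ..< 2 ^ m * z $ i + 2 ^ m}" for i
      proof -
        have "real_of_int (z $ i) \<le> y $ i" "y $ i < z $ i + 1" using y dcube_iff[of y 0 z] by auto
        then have "2 ^ m * real_of_int (z $ i) \<le> 2 ^ m * y $ i" "2 ^ m * y $ i < 2 ^ m * (real_of_int (z $ i) + 1)" by auto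
        then have "real_of_int (2 ^ m * z $ i) \<le> 2 ^ m * y $ i" "2 ^ m * y $ i < real_of_int (2 ^ m * z $ i + 2 ^ m)"
          by (auto simp: algebra_simps)
        then show ?thesis by (simp add: dcode_def le_floor_iff floor_less_iff)
      qed
      then have "dcode m y \<in> W" by (simp add: W_def)
      then show "y \<in> (\<Union>w\<in>W. dcube (m, w))" using dcube_code by blast
    qed
    then have "A \<subseteq> (\<Union>w\<in>W. A \<inter> dcube (m, w))" by blast
    then have "dcontent s A \<le> (\<Sum>w\<in>W. dcontent s (A \<inter> dcube (m, w)))"
      by (rule order_trans[OF dcontent_mono dcontent_finite_UN[OF \<open>finite W\<close>]])
    also have "\<dots> \<le> (\<Sum>w\<in>W. ennreal (2 powr (- real m * s)))"
      using dcontent_dcube[of "A \<inter> dcube (m, w)" "(m, w)" s for w] by (intro sum_mono) auto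
    also have "\<dots> = ennreal (2 powr (real m * (real CARD('n) - s)))"
    proof -
      have "real (card W) = 2 powr (real m * real CARD('n))"
        unfolding card by (simp add: powr_realpow[symmetric] powr_powr)
      then have "real (card W) * 2 powr (- real m * s) = 2 powr (real m * (real CARD('n) - s))"
        by (simp add: powr_add[symmetric] algebra_simps)
      then show ?thesis by (simp add: ennreal_of_nat_eq_real_of_nat ennreal_mult[symmetric])
    qed
    finally show ?thesis .
  qed
  have "(\<lambda>m. 2 powr (real m * (real CARD('n) - s))) \<longlonglongrightarrow> 0"
  proof -
    have "(\<lambda>m. (2 powr (real CARD('n) - s)) ^ m) \<longlonglongrightarrow> 0"
      using assms(1) by (intro LIMSEQ_realpow_zero) (auto simp: powr_less_one)
    then show ?thesis by (simp add: powr_realpow[symmetric] powr_powr mult.commute)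
  qed
  then have "(\<lambda>m. ennreal (2 powr (real m * (real CARD('n) - s)))) \<longlonglongrightarrow> ennreal 0" by (rule tendsto_ennrealI)
  from LIMSEQ_le_const[OF this, of "dcontent s A"] bound show ?thesis by simp
qed

lemma dcontent_zero_units:
  assumes "\<And>z. dcontent s (E \<inter> dcube (0, z :: int ^ 'n)) = 0"
  shows "dcontent s E = 0"
proof -
  have "E = (\<Union>n. E \<inter> dcube (0, from_nat n))"
  proof (intro equalityI subsetI)
    fix x assume "x \<in> E"
    then have "x \<in> E \<inter> dcube (0, from_nat (to_nat (dcode 0 x)))" using dcube_code[of x 0] by simp
    then show "x \<in> (\<Union>n. E \<inter> dcube (0, from_nat n))" by blast
  qed auto
  then show ?thesis using dcontent_UN_zero[of s "\<lambda>n. E \<inter> dcube (0, from_nat n)"] assms by metis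
qed

lemma hausdorff_measure_large:
  fixes E :: "(real ^ 'n) set"
  assumes "s > real CARD('n)"
  shows "hausdorff_measure s E = 0"
proof (rule hausdorff_measure_zero)
  show "dcontent s E = 0" by (rule dcontent_zero_units, rule dcontent_unit_zero[OF assms], rule Int_lower2)
  show "s > 0" using assms by (smt (verit) of_nat_0_le_iff)
qed

text \<open>Some unit cube meets \<open>E\<close> in positive content. Cutting down to it provides
  both the compact superset \<open>Q\<close> needed for capacitability and the root of the dyadic
  tree.\<close>

theorem frostman:
  fixes E :: "(real ^ 'n) set"
  assumes E: "E \<in> sets borel" "hausdorff_measure s E \<noteq> 0" and s: "s > 0"
  obtains \<mu> K C where "prob_space \<mu>" "sets \<mu> = sets borel" "compact K" "K \<subseteq> E" "emeasure \<mu> K = 1" "C > 0"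
    "\<And>x r. r > 0 \<Longrightarrow> measure \<mu> (ball x r) \<le> C * r powr s"
proof -
  have "dcontent s E \<noteq> 0" using hausdorff_measure_zero E(2) s by blast
  then obtain z where z: "dcontent s (E \<inter> dcube (0, z)) \<noteq> 0" using dcontent_zero_units by blast
  have dcube_eq: "dcube (0, z) = (\<Inter>i. {y. real_of_int (z $ i) \<le> y $ i} \<inter> {y. y $ i < z $ i + 1})"
    using dcube_iff[of _ 0 z] by auto
  have [measurable]: "dcube (0, z) \<in> sets borel"
    unfolding dcube_eq by (intro sets.countable_INT'' sets.Int borel_closed borel_open closed_Collect_le
        open_Collect_less continuous_intros) auto
  define Q where "Q = cbox (\<chi> i. real_of_int (z $ i)) (\<chi> i. real_of_int (z $ i) + 1)"
  have "dcube (0, z) \<subseteq> Q" unfolding dcube_eq Q_def by (auto simp: mem_box_cart less_imp_le)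
  \<comment> \<open>Any level strictly between 0 and the content will do, because the compact
    intersection only has to keep positive content.\<close>
  obtain b where b: "0 < b" "b < dcontent s (E \<inter> dcube (0, z))"
    using z dense[of 0] by (metis gr_zeroI)
  obtain K where K: "\<And>m. compact (K m)" "decseq K" "(\<Inter>m. K m) \<subseteq> E \<inter> dcube (0, z)" "\<And>m. b < dcontent s (K m)"
  proof (rule choquet_capacitability[of "dcontent s" "E \<inter> dcube (0, z)" Q b])
    show "E \<inter> dcube (0, z) \<in> sets borel" using E(1) by simp
    show "E \<inter> dcube (0, z) \<subseteq> Q" using \<open>dcube (0, z) \<subseteq> Q\<close> by blast
    show "compact Q" by (simp add: Q_def)
  qed (use b dcontent_mono dcontent_UN_incseq in auto)
  have cK: "compact (\<Inter>m. K m)" using K(1) by (intro compact_Inter) auto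
  have "dcontent s (\<Inter>m. K m) > 0" by (rule dcontent_compact_INT[OF K(1,2,4) b(1)])
  from frostman_compact[OF cK _ this s, of z] K(3) obtain \<mu> C where
    "prob_space \<mu>" "sets \<mu> = sets borel" "emeasure \<mu> (\<Inter>m. K m) = 1" "C > 0"
    "\<And>x r. r > 0 \<Longrightarrow> measure \<mu> (ball x r) \<le> C * r powr s" by auto
  then show thesis using that[of \<mu> "\<Inter>m. K m" C] cK K(3) by blast
qed

subsection \<open>Measurability of the chain set\<close>

lemma completion_sandwich:
  assumes "I \<in> sets M" "H \<in> sets M" "I \<subseteq> A" "A \<subseteq> H" "emeasure M H \<le> emeasure M I" "emeasure M H < \<infinity>"
  shows "A \<in> sets (completion M)"
proof (rule sets_completionI)
  show "A = I \<union> (A - I)" using assms by blast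
  show "A - I \<subseteq> H - I" using assms by blast
  have "emeasure M (H - I) = emeasure M H - emeasure M I"
    using assms emeasure_mono[OF order_trans[OF assms(3,4)] assms(2)] by (intro emeasure_Diff) auto
  also have "\<dots> = 0" using assms(5,6) by (intro diff_eq_0_ennreal) auto
  finally show "H - I \<in> null_sets M" using assms by (intro null_setsI) auto
qed fact

text \<open>The fibres of \<open>g\<close> over \<open>t\<close> inside the \<open>K m\<close> are
  nested nonempty compact sets, so a single preimage of \<open>t\<close> lies in all
  \<open>K m\<close>.\<close>

lemma image_INT_compact:
  fixes g :: "'a::metric_space \<Rightarrow> 'b::metric_space" and K :: "nat \<Rightarrow> 'a set"
  assumes g: "continuous_on UNIV g" and K: "\<And>m. compact (K m)" "decseq K"
  shows "g ` (\<Inter>m. K m) = (\<Inter>m. g ` K m)"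
proof (intro equalityI subsetI)
  fix t assume t: "t \<in> (\<Inter>m. g ` K m)"
  have "K 0 \<inter> (\<Inter>m\<in>UNIV. K m \<inter> g -` {t}) \<noteq> {}"
  proof (rule compact_imp_fip_image)
    show "compact (K 0)" by (rule K)
    show "closed (K m \<inter> g -` {t})" for m
      using K(1) by (intro closed_Int compact_imp_closed closed_vimage[OF closed_singleton g])
    fix I :: "nat set" assume I: "finite I"
    obtain x where x: "x \<in> K (Max (insert 0 I))" "g x = t" using t by blast
    have "x \<in> K m" if "m \<in> insert 0 I" for m
      using x(1) decseqD[OF K(2), of m "Max (insert 0 I)"] I that by (auto intro: Max_ge)
    then show "K 0 \<inter> (\<Inter>m\<in>I. K m \<inter> g -` {t}) \<noteq> {}" using x(2) by blast
  qed
  then obtain x where "\<forall>m. x \<in> K m" "g x = t" by blast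
  then show "t \<in> g ` (\<Inter>m. K m)" by blast
qed auto

text \<open>Defined on infinite sequences, of which only the entries up to \<open>k\<close> matter,
  so that the metric on \<open>nat \<Rightarrow> 'a\<close> makes Choquet's theorem applicable to
  sets of chains.\<close>

definition chain_map :: "nat \<Rightarrow> (nat \<Rightarrow> 'a::metric_space) \<Rightarrow> nat \<Rightarrow> real" where
  "chain_map k x = (\<lambda>j\<in>{..<k}. dist (x j) (x (Suc j)))"

lemma continuous_chain_map: "continuous_on UNIV (chain_map k :: (nat \<Rightarrow> 'a::metric_space) \<Rightarrow> _)"
proof (rule continuous_on_coordinatewise_then_product)
  fix j
  have "continuous_on UNIV (\<lambda>x :: nat \<Rightarrow> 'a. dist (x j) (x (Suc j)))"
    by (intro continuous_on_dist continuous_on_product_coordinates)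
  then show "continuous_on UNIV (\<lambda>x :: nat \<Rightarrow> 'a. chain_map k x j)"
    by (cases "j < k") (simp_all add: chain_map_def)
qed

abbreviation "cube_meas k \<equiv> (\<Pi>\<^sub>M j\<in>{..<k::nat}. (lborel :: real measure))"

lemma chain_map_space: "chain_map k x \<in> space (cube_meas k)"
  by (simp add: chain_map_def space_PiM)

text \<open>Bridges two structures on \<open>nat \<Rightarrow> real\<close>: closedness refers to
  all coordinates, the product sigma-algebra only to those below \<open>k\<close>. On the space of
  the product measure the other coordinates have the constant value
  \<open>undefined\<close>.\<close>

lemma closed_Int_space_measurable:
  fixes A :: "(nat \<Rightarrow> real) set"
  assumes "closed A" "A \<subseteq> space (cube_meas k)"
  shows "A \<in> sets (cube_meas k)"
proof -
  have "(\<lambda>t. t) \<in> cube_meas k \<rightarrow>\<^sub>M (borel :: (nat \<Rightarrow> real) measure)"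
  proof (rule measurable_coordinatewise_then_product)
    fix i
    show "(\<lambda>t. t i) \<in> borel_measurable (cube_meas k)"
    proof (cases "i < k")
      case True
      have "(\<lambda>t. t i) \<in> cube_meas k \<rightarrow>\<^sub>M lborel"
        using True by (intro measurable_component_singleton) auto
      then show ?thesis by simp
    next
      case False
      then have "t i = undefined" if "t \<in> space (cube_meas k)" for t
        using that by (auto simp: space_PiM PiE_iff extensional_def)
      then show ?thesis by (subst measurable_cong[where g="\<lambda>_. undefined"]) auto
    qed
  qed
  from measurable_sets[OF this, of A] assms show ?thesis
    by (simp add: Int_absorb2)
qed

lemma emeasure_chain_map_finite:
  assumes "\<And>x j. x \<in> S \<Longrightarrow> j \<le> k \<Longrightarrow> norm (x j :: 'a::real_normed_vector) \<le> R"
  obtains B where "B \<in> sets (cube_meas k)" "chain_map k ` S \<subseteq> B" "emeasure (cube_meas k) B < \<infinity>"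
proof -
  interpret product_sigma_finite "\<lambda>_ :: nat. lborel :: real measure" ..
  let ?B = "PiE {..<k} (\<lambda>_. {0..2 * R})"
  have "?B \<in> sets (cube_meas k)" by (intro sets_PiM_I_finite) auto
  moreover have "chain_map k ` S \<subseteq> ?B"
  proof clarify
    fix x assume x: "x \<in> S"
    have "dist (x j) (x (Suc j)) \<le> 2 * R" if "j < k" for j
    proof -
      have "norm (x j - x (Suc j)) \<le> norm (x j) + norm (x (Suc j))" by (rule norm_triangle_ineq4)
      also have "\<dots> \<le> 2 * R" using assms[OF x, of j] assms[OF x, of "Suc j"] that by simp
      finally show ?thesis by (simp add: dist_norm)
    qed
    then show "chain_map k x \<in> ?B" by (auto simp: chain_map_def)
  qed
  moreover have "emeasure (cube_meas k) ?B < \<infinity>"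
  proof -
    have "emeasure (cube_meas k) ?B = (\<Prod>i\<in>{..<k}. emeasure lborel {0..2 * R})"
      by (rule emeasure_PiM) auto
    also have "\<dots> < \<infinity>"
      by (auto simp: less_top[symmetric] emeasure_lborel_Icc_eq power_eq_top_ennreal)
    finally show ?thesis .
  qed
  ultimately show thesis by (rule that)
qed

text \<open>The outer measure of the image is monotone and continuous along increasing sequences, so
  Choquet's theorem yields compact images inside the image of \<open>S\<close> of measure
  arbitrarily close to its outer measure. Together with a measurable hull of the same finite measure
  this squeezes the image up to a null set.\<close>

lemma chain_map_image_measurable:
  fixes S :: "(nat \<Rightarrow> 'a::euclidean_space) set"
  assumes S: "S \<in> sets borel" "S \<subseteq> X" and X: "compact X"
    "\<And>x j. x \<in> X \<Longrightarrow> j \<le> k \<Longrightarrow> norm (x j) \<le> R"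
  shows "chain_map k ` S \<in> sets (completion (cube_meas k))"
proof -
  let ?M = "cube_meas k"
  define C where "C A = outer_measure_of ?M (chain_map k ` A)" for A :: "(nat \<Rightarrow> 'a) set"
  have sp: "chain_map k ` A \<subseteq> space ?M" for A :: "(nat \<Rightarrow> 'a) set"
    using chain_map_space by blast
  obtain H where H: "H \<in> sets ?M" "chain_map k ` S \<subseteq> H" "C S = emeasure ?M H"
    using outer_measure_of_attain[OF sp] unfolding C_def by blast
  obtain B where B: "B \<in> sets ?M" "chain_map k ` X \<subseteq> B" "emeasure ?M B < \<infinity>"
    using emeasure_chain_map_finite[of X k R] X(2) by blast
  have CX: "C A < \<infinity>" if "A \<subseteq> X" for A
  proof -
    have "C A \<le> outer_measure_of ?M B" unfolding C_def using that B(2) by (intro outer_measure_of_mono) blast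
    with B show ?thesis by (simp add: le_less_trans)
  qed
  have inner: "\<exists>I. I \<in> sets ?M \<and> I \<subseteq> chain_map k ` S \<and> b \<le> emeasure ?M I" if b: "b < C S" for b
  proof -
    obtain K where K: "\<And>m. compact (K m)" "decseq K" "(\<Inter>m. K m) \<subseteq> S" "\<And>m. b < C (K m)" "\<And>m. K m \<subseteq> X"
    proof (rule choquet_capacitability[of C S X b])
      show "C A \<le> C A'" if "A \<subseteq> A'" for A A'
        unfolding C_def using that by (intro outer_measure_of_mono) blast
      show "C (\<Union>n. A n) = (SUP n. C (A n))" if "incseq A" for A
        unfolding C_def image_UN
        using that by (intro SUP_outer_measure_of_incseq[symmetric] sp) (auto simp: incseq_def)
    qed (use S X b in auto)
    have meas: "chain_map k ` K m \<in> sets ?M" for m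
    proof -
      have "compact (chain_map k ` K m)"
        using continuous_on_subset[OF continuous_chain_map] K(1) by (intro compact_continuous_image) auto
      then show ?thesis by (intro closed_Int_space_measurable compact_imp_closed sp)
    qed
    have dec: "decseq (\<lambda>m. chain_map k ` K m)" using K(2) by (auto simp: decseq_def)
    have fin: "emeasure ?M (chain_map k ` K m) < \<infinity>" for m
      using CX[OF K(5), of m] meas[of m] by (simp add: C_def)
    have "b \<le> (INF m. emeasure ?M (chain_map k ` K m))"
      using K(4) meas by (intro INF_greatest) (auto simp: C_def less_imp_le)
    also have "\<dots> = emeasure ?M (\<Inter>m. chain_map k ` K m)"
      by (rule INF_emeasure_decseq) (use meas dec fin in \<open>auto simp: less_top[symmetric]\<close>)
    also have "(\<Inter>m. chain_map k ` K m) = chain_map k ` (\<Inter>m. K m)"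
      by (rule image_INT_compact[symmetric, OF continuous_chain_map K(1,2)])
    finally have "b \<le> emeasure ?M (chain_map k ` (\<Inter>m. K m))" .
    moreover have "chain_map k ` (\<Inter>m. K m) \<in> sets ?M"
      unfolding image_INT_compact[OF continuous_chain_map K(1,2)] using meas by auto
    ultimately show ?thesis using K(3) by blast
  qed
  obtain c where c: "C S = ennreal c" "c \<ge> 0" using CX[OF S(2)] by (cases "C S") auto
  have "\<exists>I. I \<in> sets ?M \<and> I \<subseteq> chain_map k ` S \<and> C S \<le> emeasure ?M I"
  proof (cases "c = 0")
    case True
    then show ?thesis using c by (intro exI[of _ "{}"]) auto
  next
    case False
    with c have "\<exists>I. I \<in> sets ?M \<and> I \<subseteq> chain_map k ` S \<and> ennreal (c - 1 / real (Suc n)) \<le> emeasure ?M I" for n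
      by (intro inner) (simp add: ennreal_less_iff ennreal_lessI)
    then obtain I where I: "\<And>n. I n \<in> sets ?M" "\<And>n. I n \<subseteq> chain_map k ` S"
      "\<And>n. ennreal (c - 1 / real (Suc n)) \<le> emeasure ?M (I n)" by metis
    have "ennreal (c - 1 / real (Suc n)) \<le> emeasure ?M (\<Union>n. I n)" for n
      using I(3)[of n] emeasure_mono[of "I n" "\<Union>n. I n" ?M] I(1) by (auto intro: order_trans)
    moreover have "(\<lambda>n. ennreal (c - 1 / real (Suc n))) \<longlonglongrightarrow> ennreal c"
      by (intro tendsto_ennrealI) real_asymp
    ultimately have "ennreal c \<le> emeasure ?M (\<Union>n. I n)"
      by (intro LIMSEQ_le_const2) auto
    then show ?thesis using I c by (intro exI[of _ "\<Union>n. I n"]) auto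
  qed
  then obtain I where "I \<in> sets ?M" "I \<subseteq> chain_map k ` S" "C S \<le> emeasure ?M I" by blast
  then show ?thesis
    using H CX[OF S(2)] by (intro completion_sandwich[of I _ H]) auto
qed

lemma chain_set_measurable:
  fixes E :: "'a::euclidean_space set"
  assumes E: "E \<in> sets borel"
  shows "chain_set k E \<in> sets (lebesgue_power k)"
proof -
  \<comment> \<open>Entries beyond \<open>k\<close> are fixed at 0 to make the box compact; the
    chain map does not see them.\<close>
  define X where "X R = {x :: nat \<Rightarrow> 'a. \<forall>j. x j \<in> (if j \<le> k then cball 0 (real R) else {0})}" for R :: nat
  define S where "S = {x :: nat \<Rightarrow> 'a. \<forall>j\<le>k. x j \<in> E}"
  have "S = (\<Inter>j\<in>{..k}. (\<lambda>x. x j) -` E \<inter> space borel)" by (auto simp: S_def)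
  also have "\<dots> \<in> sets borel"
    using E by (intro sets.finite_INT measurable_sets[OF borel_measurable_continuous_onI] continuous_on_product_coordinates) auto
  finally have S: "S \<in> sets borel" .
  have X: "compact (X R)" for R
    unfolding X_def by (rule compact_PiE_UNIV) auto
  then have "S \<inter> X R \<in> sets borel" for R by (intro sets.Int[OF S borel_compact])
  then have "chain_map k ` (S \<inter> X R) \<in> sets (completion (cube_meas k))" for R
  proof (rule chain_map_image_measurable[where X="X R" and R="real R"])
    fix x j assume "x \<in> X R" "j \<le> k"
    then have "x j \<in> cball 0 (real R)" by (auto simp: X_def split: if_splits)
    then show "norm (x j) \<le> real R" by simp
  qed (use X in auto)
  then have "(\<Union>R. chain_map k ` (S \<inter> X R)) \<in> sets (completion (cube_meas k))" by blast
  also have "(\<Union>R. chain_map k ` (S \<inter> X R)) = chain_set k E"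
  proof (intro equalityI subsetI)
    fix t assume "t \<in> (\<Union>R. chain_map k ` (S \<inter> X R))"
    then show "t \<in> chain_set k E" by (auto simp: chain_set_def chain_map_def S_def)
  next
    fix t assume "t \<in> chain_set k E"
    then obtain x where x: "t = chain_map k x" "\<forall>j\<le>k. x j \<in> E" by (auto simp: chain_set_def chain_map_def)
    define y where "y j = (if j \<le> k then x j else 0)" for j
    obtain R where R: "(\<Sum>j\<le>k. norm (x j)) \<le> real R" using real_arch_simple by blast
    have "norm (x j) \<le> real R" if "j \<le> k" for j
      using member_le_sum[of j "{..k}" "\<lambda>j. norm (x j)"] that R by simp
    then have "y \<in> S \<inter> X R" using x(2) by (auto simp: y_def S_def X_def dist_norm)
    moreover have "t = chain_map k y" unfolding x(1) by (auto simp: chain_map_def y_def fun_eq_iff)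
    ultimately show "t \<in> (\<Union>R. chain_map k ` (S \<inter> X R))" by blast
  qed
  finally show ?thesis by (simp add: lebesgue_power_def)
qed

subsection \<open>Fourier transforms of measures\<close>

text \<open>For a finite Borel measure, \<open>fourier_measure\<close> is
  \<open>fcos - \<i> * fsin\<close>. The real integrals are what Fubini arguments and approximation
  by mixtures act on.\<close>

definition fcos :: "'a::euclidean_space measure \<Rightarrow> 'a \<Rightarrow> real" where
  "fcos \<mu> \<xi> = (\<integral>x. cos (2 * pi * (x \<bullet> \<xi>)) \<partial>\<mu>)"

definition fsin :: "'a::euclidean_space measure \<Rightarrow> 'a \<Rightarrow> real" where
  "fsin \<mu> \<xi> = (\<integral>x. sin (2 * pi * (x \<bullet> \<xi>)) \<partial>\<mu>)"

lemma borel_measurable_fcos [measurable]: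
  fixes \<mu> :: "'a::euclidean_space measure"
  assumes "finite_measure \<mu>" and [measurable_cong]: "sets \<mu> = sets borel"
  shows "fcos \<mu> \<in> borel_measurable borel" "fsin \<mu> \<in> borel_measurable borel"
proof -
  interpret finite_measure \<mu> by fact
  show "fcos \<mu> \<in> borel_measurable borel" "fsin \<mu> \<in> borel_measurable borel"
    unfolding fcos_def[abs_def] fsin_def[abs_def] by measurable
qed

lemma integrable_bounded_finite:
  fixes f :: "'a \<Rightarrow> real"
  assumes "finite_measure \<mu>" "f \<in> borel_measurable \<mu>" "\<And>x. \<bar>f x\<bar> \<le> B"
  shows "integrable \<mu> f"
  using assms by (intro finite_measure.integrable_const_bound[of \<mu> f B]) auto

lemma abs_fcos_le:
  fixes \<mu> :: "'a::euclidean_space measure"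
  assumes "prob_space \<mu>" "sets \<mu> = sets borel"
  shows "\<bar>fcos \<mu> \<xi>\<bar> \<le> 1"
proof -
  interpret prob_space \<mu> by fact
  have "\<bar>fcos \<mu> \<xi>\<bar> \<le> (\<integral>x. \<bar>cos (2 * pi * (x \<bullet> \<xi>))\<bar> \<partial>\<mu>)" unfolding fcos_def by (rule integral_abs_bound)
  also have "\<dots> \<le> (\<integral>x. 1 \<partial>\<mu>)"
    using assms(2) by (intro integral_mono integrable_bounded_finite[of _ _ 1])
      (auto intro!: finite_measure_axioms simp: measurable_cong_sets[OF assms(2) refl])
  finally show ?thesis by (simp add: prob_space)
qed

lemma cmod_fourier_measure:
  fixes \<mu> :: "'a::euclidean_space measure"
  assumes "finite_measure \<mu>" and [measurable_cong]: "sets \<mu> = sets borel"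
  shows "(cmod (fourier_measure \<mu> \<xi>))\<^sup>2 = (fcos \<mu> \<xi>)\<^sup>2 + (fsin \<mu> \<xi>)\<^sup>2"
proof -
  interpret finite_measure \<mu> by fact
  have eq: "exp (- 2 * of_real pi * \<i> * of_real (x \<bullet> \<xi>)) = cis (- (2 * pi * (x \<bullet> \<xi>)))" for x
    by (simp add: cis_conv_exp mult_ac)
  have int: "integrable \<mu> (\<lambda>x. cis (- (2 * pi * (x \<bullet> \<xi>))))"
    by (rule integrable_const_bound[where B=1]) (auto simp: cis_conv_exp)
  have "Re (fourier_measure \<mu> \<xi>) = fcos \<mu> \<xi>" "Im (fourier_measure \<mu> \<xi>) = - fsin \<mu> \<xi>"
    unfolding fourier_measure_def eq fcos_def fsin_def
    using integral_Re[OF int] integral_Im[OF int] by simp_all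
  then show ?thesis by (simp add: cmod_power2)
qed

lemma cmod_fourier_measure_le_1:
  fixes \<mu> :: "'a::euclidean_space measure"
  assumes "prob_space \<mu>" "sets \<mu> = sets borel"
  shows "cmod (fourier_measure \<mu> \<xi>) \<le> 1"
proof -
  interpret prob_space \<mu> by fact
  have "cmod (fourier_measure \<mu> \<xi>) \<le> (\<integral>x. cmod (exp (- 2 * of_real pi * \<i> * of_real (x \<bullet> \<xi>))) \<partial>\<mu>)"
    unfolding fourier_measure_def by (rule integral_norm_bound)
  also have "\<dots> = (\<integral>x. 1 \<partial>\<mu>)" by (intro Bochner_Integration.integral_cong refl) simp
  finally show ?thesis by (simp add: prob_space)
qed

lemma borel_measurable_cmod_fourier [measurable]:
  fixes \<mu> :: "'a::euclidean_space measure"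
  assumes "finite_measure \<mu>" "sets \<mu> = sets borel"
  shows "(\<lambda>\<xi>. (cmod (fourier_measure \<mu> \<xi>))\<^sup>2) \<in> borel_measurable borel"
  unfolding cmod_fourier_measure[OF assms] using borel_measurable_fcos[OF assms] by measurable

text \<open>The integrand on the left is the real part of one transform times the conjugate of the
  other. The addition formula and Fubini move the transform onto \<open>\<nu>\<close>. With Gaussian
  \<open>\<nu>\<close> this gives energies, with the uniform law on a sphere of radius
  \<open>r\<close> the pairing with the spherical convolution.\<close>

lemma fcos_bilinear:
  fixes \<mu>1 \<mu>2 \<nu> :: "'a::euclidean_space measure"
  assumes "finite_measure \<mu>1" "sets \<mu>1 = sets borel" "finite_measure \<mu>2" "sets \<mu>2 = sets borel"
    "finite_measure \<nu>" "sets \<nu> = sets borel"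
  shows "(\<integral>\<xi>. fcos \<mu>1 \<xi> * fcos \<mu>2 \<xi> + fsin \<mu>1 \<xi> * fsin \<mu>2 \<xi> \<partial>\<nu>) = (\<integral>x. \<integral>y. fcos \<nu> (x - y) \<partial>\<mu>2 \<partial>\<mu>1)"
proof -
  note [measurable_cong] = assms(2,4,6)
  interpret m1: finite_measure \<mu>1 by fact
  interpret m2: finite_measure \<mu>2 by fact
  interpret n: finite_measure \<nu> by fact
  interpret p12: finite_measure "\<mu>1 \<Otimes>\<^sub>M \<mu>2" by (rule finite_measure_pair_measure) unfold_locales
  interpret p1n: finite_measure "\<mu>1 \<Otimes>\<^sub>M \<nu>" by (rule finite_measure_pair_measure) unfold_locales
  interpret p2n: finite_measure "\<mu>2 \<Otimes>\<^sub>M \<nu>" by (rule finite_measure_pair_measure) unfold_locales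
  interpret P1n: pair_sigma_finite \<mu>1 \<nu> ..
  interpret P2n: pair_sigma_finite \<mu>2 \<nu> ..
  let ?c = "\<lambda>x \<xi>. cos (2 * pi * (x \<bullet> \<xi>))" and ?s = "\<lambda>x \<xi>. sin (2 * pi * (x \<bullet> \<xi>))"
  have ic: "integrable \<mu> (\<lambda>x. ?c x \<xi>)" "integrable \<mu> (\<lambda>x. ?s x \<xi>)"
    if "finite_measure \<mu>" "sets \<mu> = sets borel" for \<mu> :: "'a measure" and \<xi>
    using that by (auto intro!: integrable_bounded_finite[where B=1] simp: measurable_cong_sets[OF that(2) refl])
  have inner: "fcos \<mu>1 \<xi> * fcos \<mu>2 \<xi> + fsin \<mu>1 \<xi> * fsin \<mu>2 \<xi>
    = (\<integral>x. (\<integral>y. cos (2 * pi * ((x - y) \<bullet> \<xi>)) \<partial>\<mu>2) \<partial>\<mu>1)" for \<xi>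
  proof -
    have "cos (2 * pi * ((x - y) \<bullet> \<xi>)) = ?c x \<xi> * ?c y \<xi> + ?s x \<xi> * ?s y \<xi>" for x y
      by (simp add: inner_diff_left right_diff_distrib cos_diff)
    then have "(\<integral>x. (\<integral>y. cos (2 * pi * ((x - y) \<bullet> \<xi>)) \<partial>\<mu>2) \<partial>\<mu>1)
      = (\<integral>x. ?c x \<xi> * fcos \<mu>2 \<xi> + ?s x \<xi> * fsin \<mu>2 \<xi> \<partial>\<mu>1)"
      using ic[OF assms(3,4), of \<xi>] by (simp add: fcos_def fsin_def)
    also have "\<dots> = fcos \<mu>1 \<xi> * fcos \<mu>2 \<xi> + fsin \<mu>1 \<xi> * fsin \<mu>2 \<xi>"
      using ic[OF assms(1,2), of \<xi>] by (simp add: fcos_def[of \<mu>1] fsin_def[of \<mu>1])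
    finally show ?thesis by simp
  qed
  have "(\<integral>\<xi>. fcos \<mu>1 \<xi> * fcos \<mu>2 \<xi> + fsin \<mu>1 \<xi> * fsin \<mu>2 \<xi> \<partial>\<nu>)
      = (\<integral>\<xi>. (\<integral>x. (\<integral>y. cos (2 * pi * ((x - y) \<bullet> \<xi>)) \<partial>\<mu>2) \<partial>\<mu>1) \<partial>\<nu>)"
    by (simp only: inner)
  also have "\<dots> = (\<integral>x. (\<integral>\<xi>. (\<integral>y. cos (2 * pi * ((x - y) \<bullet> \<xi>)) \<partial>\<mu>2) \<partial>\<nu>) \<partial>\<mu>1)"
  proof (rule P1n.Fubini_integral)
    show "integrable (\<mu>1 \<Otimes>\<^sub>M \<nu>) (\<lambda>(x, \<xi>). \<integral>y. cos (2 * pi * ((x - y) \<bullet> \<xi>)) \<partial>\<mu>2)"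
    proof (rule integrable_bounded_finite[where B="measure \<mu>2 (space \<mu>2)"])
      fix p :: "'a \<times> 'a"
      obtain x \<xi> where p: "p = (x, \<xi>)" by (cases p)
      have "\<bar>\<integral>y. cos (2 * pi * ((x - y) \<bullet> \<xi>)) \<partial>\<mu>2\<bar> \<le> (\<integral>y. \<bar>cos (2 * pi * ((x - y) \<bullet> \<xi>))\<bar> \<partial>\<mu>2)"
        by (rule integral_abs_bound)
      also have "\<dots> \<le> (\<integral>y. 1 \<partial>\<mu>2)"
        by (intro integral_mono integrable_bounded_finite[where B=1] m2.finite_measure_axioms) auto
      finally show "\<bar>case p of (x, \<xi>) \<Rightarrow> \<integral>y. cos (2 * pi * ((x - y) \<bullet> \<xi>)) \<partial>\<mu>2\<bar> \<le> measure \<mu>2 (space \<mu>2)"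
        by (simp add: p)
    qed (rule p1n.finite_measure_axioms, measurable)
  qed
  also have "\<dots> = (\<integral>x. (\<integral>y. (\<integral>\<xi>. cos (2 * pi * ((x - y) \<bullet> \<xi>)) \<partial>\<nu>) \<partial>\<mu>2) \<partial>\<mu>1)"
  proof (rule Bochner_Integration.integral_cong[OF refl])
    fix x
    show "(\<integral>\<xi>. (\<integral>y. cos (2 * pi * ((x - y) \<bullet> \<xi>)) \<partial>\<mu>2) \<partial>\<nu>) = (\<integral>y. (\<integral>\<xi>. cos (2 * pi * ((x - y) \<bullet> \<xi>)) \<partial>\<nu>) \<partial>\<mu>2)"
      by (rule P2n.Fubini_integral, rule integrable_bounded_finite[where B=1], rule p2n.finite_measure_axioms) (auto split: prod.split)
  qed
  also have "\<dots> = (\<integral>x. \<integral>y. fcos \<nu> (x - y) \<partial>\<mu>2 \<partial>\<mu>1)"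
    by (simp add: fcos_def inner_commute)
  finally show ?thesis .
qed

lemma fourier_energy:
  fixes \<mu> \<nu> :: "'a::euclidean_space measure"
  assumes "finite_measure \<mu>" "sets \<mu> = sets borel" "finite_measure \<nu>" "sets \<nu> = sets borel"
  shows "(\<integral>\<xi>. (cmod (fourier_measure \<mu> \<xi>))\<^sup>2 \<partial>\<nu>) = (\<integral>x. \<integral>y. fcos \<nu> (x - y) \<partial>\<mu> \<partial>\<mu>)"
  using fcos_bilinear[OF assms(1,2,1,2,3,4)] unfolding cmod_fourier_measure[OF assms(1,2)]
  by (simp only: power2_eq_square)

section \<open>Gaussian transforms and energies\<close>

lemma gaussian_1d:
  assumes a: "a > (0::real)"
  shows "integrable lborel (\<lambda>t. exp (- pi * a * t\<^sup>2) *\<^sub>R cis (2 * pi * v * t))"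
    and "(\<integral>t. exp (- pi * a * t\<^sup>2) *\<^sub>R cis (2 * pi * v * t) \<partial>lborel) = complex_of_real (exp (- pi * v\<^sup>2 / a) / sqrt a)"
proof -
  \<comment> \<open>The substitution \<open>x = c * t\<close> turns the standard normal density into
    \<open>exp (- pi * a * t\<^sup>2) / sqrt (2 * pi)\<close>, so the value is read off from its
    characteristic function.\<close>
  define c where "c = sqrt (2 * pi * a)"
  have c: "c > 0" "c\<^sup>2 = 2 * pi * a" using a by (auto simp: c_def)
  define f where "f x = std_normal_density x *\<^sub>R cis (2 * pi * v / c * x)" for x
  have [measurable]: "f \<in> borel_measurable lborel" unfolding f_def[abs_def] cis_conv_exp by measurable
  have int: "integrable lborel f"
  proof (rule Bochner_Integration.integrable_bound[where f="std_normal_density"])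
    show "integrable lborel std_normal_density" by (rule integrable_normal_density) simp
    show "AE x in lborel. norm (f x) \<le> norm (std_normal_density x)" by (simp add: f_def)
  qed simp
  have "char std_normal_distribution (2 * pi * v / c) = (\<integral>x. f x \<partial>lborel)"
    unfolding char_def f_def
    by (subst integral_density) (auto simp: normal_density_nonneg cis_conv_exp mult_ac)
  then have val: "(\<integral>x. f x \<partial>lborel) = exp (- ((2 * pi * v / c)\<^sup>2) / 2)"
    unfolding char_std_normal_distribution by simp
  have fx: "f (0 + c * t) = (1 / sqrt (2 * pi)) *\<^sub>R (exp (- pi * a * t\<^sup>2) *\<^sub>R cis (2 * pi * v * t))" for t
    using c by (simp add: f_def std_normal_density_def power_mult_distrib mult_ac)
  have "integrable lborel (\<lambda>t. f (0 + c * t))"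
    using int c(1) by (intro lborel_integrable_real_affine) auto
  then have "integrable lborel (\<lambda>t. (1 / sqrt (2 * pi)) *\<^sub>R (exp (- pi * a * t\<^sup>2) *\<^sub>R cis (2 * pi * v * t)))"
    unfolding fx .
  then have "integrable lborel (\<lambda>t. sqrt (2 * pi) *\<^sub>R ((1 / sqrt (2 * pi)) *\<^sub>R (exp (- pi * a * t\<^sup>2) *\<^sub>R cis (2 * pi * v * t))))"
    by (rule integrable_scaleR_right)
  then show i: "integrable lborel (\<lambda>t. exp (- pi * a * t\<^sup>2) *\<^sub>R cis (2 * pi * v * t))"
    by simp
  have "(\<integral>x. f x \<partial>lborel) = \<bar>c\<bar> *\<^sub>R (\<integral>t. f (0 + c * t) \<partial>lborel)"
    using c(1) by (intro lborel_integral_real_affine) auto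
  also have "\<dots> = (c / sqrt (2 * pi)) *\<^sub>R (\<integral>t. exp (- pi * a * t\<^sup>2) *\<^sub>R cis (2 * pi * v * t) \<partial>lborel)"
    unfolding fx integral_scaleR_right using c(1) by simp
  also have "c / sqrt (2 * pi) = sqrt a" unfolding c_def using a by (simp add: real_sqrt_mult)
  finally have "sqrt a *\<^sub>R (\<integral>t. exp (- pi * a * t\<^sup>2) *\<^sub>R cis (2 * pi * v * t) \<partial>lborel) = exp (- ((2 * pi * v / c)\<^sup>2) / 2)"
    using val by simp
  moreover have "(2 * pi * v / c)\<^sup>2 / 2 = pi * v\<^sup>2 / a"
    using a by (simp add: power_divide c(2)) (simp add: power2_eq_square field_simps)
  ultimately show "(\<integral>t. exp (- pi * a * t\<^sup>2) *\<^sub>R cis (2 * pi * v * t) \<partial>lborel) = complex_of_real (exp (- pi * v\<^sup>2 / a) / sqrt a)"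
    using a by (simp add: scaleR_conv_of_real field_simps)
qed

definition gauss :: "real \<Rightarrow> 'a::euclidean_space measure" where
  "gauss a = density lborel (\<lambda>\<xi>. ennreal (exp (- pi * a * (norm \<xi>)\<^sup>2)))"

lemma norm_sq_Basis: "(norm (x :: 'a::euclidean_space))\<^sup>2 = (\<Sum>b\<in>Basis. (x \<bullet> b)\<^sup>2)"
  unfolding power2_norm_eq_inner euclidean_inner[of x x] by (simp only: power2_eq_square)

lemma gaussian_nd:
  fixes u :: "'a::euclidean_space"
  assumes a: "a > 0"
  shows "integrable lborel (\<lambda>\<xi>::'a. exp (- pi * a * (norm \<xi>)\<^sup>2) *\<^sub>R cis (2 * pi * (u \<bullet> \<xi>)))"
    and "(\<integral>(\<xi>::'a). exp (- pi * a * (norm \<xi>)\<^sup>2) *\<^sub>R cis (2 * pi * (u \<bullet> \<xi>)) \<partial>lborel)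
      = complex_of_real (exp (- pi * (norm u)\<^sup>2 / a) / sqrt a ^ DIM('a))"
proof -
  define h where "h b t = exp (- pi * a * t\<^sup>2) *\<^sub>R cis (2 * pi * (u \<bullet> b) * t)" for b t
  define g where "g \<xi> = exp (- pi * a * (norm \<xi>)\<^sup>2) *\<^sub>R cis (2 * pi * (u \<bullet> \<xi>))" for \<xi> :: 'a
  interpret product_sigma_finite "\<lambda>_::'a. lborel :: real measure" ..
  have cis_sum: "cis (\<Sum>b\<in>A. t b) = (\<Prod>b\<in>A. cis (t b))" if "finite A" for A and t :: "'a \<Rightarrow> real"
    using that by (induction A rule: finite_induct) (auto simp: cis_mult[symmetric])
  have g_prod: "g (\<Sum>b\<in>Basis. f b *\<^sub>R b) = (\<Prod>b\<in>Basis. h b (f b))" for f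
  proof -
    let ?x = "\<Sum>b\<in>Basis. f b *\<^sub>R b"
    have xb: "?x \<bullet> b = f b" if "b \<in> Basis" for b using that by simp
    have "(norm ?x)\<^sup>2 = (\<Sum>b\<in>Basis. (f b)\<^sup>2)" unfolding norm_sq_Basis by (intro sum.cong) (auto simp: xb)
    moreover have "u \<bullet> ?x = (\<Sum>b\<in>Basis. (u \<bullet> b) * f b)"
      by (simp add: inner_sum_right mult.commute)
    ultimately show ?thesis
      by (simp add: g_def h_def sum_distrib_left exp_sum cis_sum prod.distrib scaleR_conv_of_real mult.assoc sum_negf[symmetric])
  qed
  have [measurable]: "g \<in> borel_measurable borel" unfolding g_def[abs_def] cis_conv_exp by measurable
  have hint: "integrable lborel (h b)" for b using gaussian_1d(1)[OF a] by (simp add: h_def[abs_def])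
  have int_prod: "integrable (\<Pi>\<^sub>M b\<in>Basis. lborel) (\<lambda>f. \<Prod>b\<in>Basis. h b (f b))"
    using hint by (intro product_integrable_prod) auto
  show "integrable lborel (\<lambda>\<xi>::'a. exp (- pi * a * (norm \<xi>)\<^sup>2) *\<^sub>R cis (2 * pi * (u \<bullet> \<xi>)))"
    unfolding g_def[symmetric] by (subst lborel_eq, subst integrable_distr_eq) (auto simp: g_prod int_prod)
  have "(\<integral>\<xi>. g \<xi> \<partial>lborel) = (\<integral>f. (\<Prod>b\<in>Basis. h b (f b)) \<partial>(\<Pi>\<^sub>M b\<in>Basis. lborel))"
    by (subst lborel_eq, subst integral_distr) (auto simp: g_prod)
  also have "\<dots> = (\<Prod>b\<in>Basis. (\<integral>t. h b t \<partial>lborel))"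
    using hint by (intro product_integral_prod) auto
  also have "\<dots> = (\<Prod>b\<in>(Basis :: 'a set). complex_of_real (exp (- pi * (u \<bullet> b)\<^sup>2 / a) / sqrt a))"
    using gaussian_1d(2)[OF a] by (simp add: h_def)
  also have "\<dots> = complex_of_real ((\<Prod>b\<in>(Basis :: 'a set). exp (- pi * (u \<bullet> b)\<^sup>2 / a)) / sqrt a ^ DIM('a))"
    by (simp add: prod_dividef)
  also have "(\<Prod>b\<in>(Basis :: 'a set). exp (- pi * (u \<bullet> b)\<^sup>2 / a)) = exp (- pi * (norm u)\<^sup>2 / a)"
    unfolding norm_sq_Basis by (simp add: exp_sum[symmetric] sum_distrib_left sum_divide_distrib sum_negf[symmetric])
  finally show "(\<integral>(\<xi>::'a). exp (- pi * a * (norm \<xi>)\<^sup>2) *\<^sub>R cis (2 * pi * (u \<bullet> \<xi>)) \<partial>lborel)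
      = complex_of_real (exp (- pi * (norm u)\<^sup>2 / a) / sqrt a ^ DIM('a))" by (simp add: g_def)
qed

lemma gauss_finite:
  assumes "a > 0"
  shows "finite_measure (gauss a :: 'a::euclidean_space measure)" "sets (gauss a :: 'a measure) = sets borel"
proof -
  have "integrable lborel (\<lambda>\<xi>::'a. Re (exp (- pi * a * (norm \<xi>)\<^sup>2) *\<^sub>R cis (2 * pi * (0 \<bullet> \<xi>))))"
    by (rule integrable_Re[OF gaussian_nd(1)[OF assms]])
  then have "integrable lborel (\<lambda>\<xi>::'a. exp (- pi * a * (norm \<xi>)\<^sup>2))" by simp
  then have "(\<integral>\<^sup>+(\<xi>::'a). ennreal (exp (- pi * a * (norm \<xi>)\<^sup>2)) \<partial>lborel) < \<infinity>"
    by (simp add: integrable_iff_bounded)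
  then show "finite_measure (gauss a :: 'a measure)"
    unfolding gauss_def by (intro finite_measureI) (simp add: emeasure_density less_top)
qed (simp add: gauss_def)

lemma fcos_gauss:
  fixes u :: "'a::euclidean_space"
  assumes "a > 0"
  shows "fcos (gauss a) u = exp (- pi * (norm u)\<^sup>2 / a) / sqrt a ^ DIM('a)"
proof -
  have "fcos (gauss a) u = (\<integral>(\<xi>::'a). exp (- pi * a * (norm \<xi>)\<^sup>2) * cos (2 * pi * (\<xi> \<bullet> u)) \<partial>lborel)"
    unfolding fcos_def gauss_def by (subst integral_density) auto
  also have "\<dots> = (\<integral>(\<xi>::'a). Re (exp (- pi * a * (norm \<xi>)\<^sup>2) *\<^sub>R cis (2 * pi * (u \<bullet> \<xi>))) \<partial>lborel)"
    by (simp add: inner_commute)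
  also have "\<dots> = exp (- pi * (norm u)\<^sup>2 / a) / sqrt a ^ DIM('a)"
    using integral_Re[OF gaussian_nd(1)[OF assms], of u] gaussian_nd(2)[OF assms, of u] by simp
  finally show ?thesis .
qed

text \<open>Plancherel with a Gaussian cutoff: both sides are finite, so no integrability of the
  transform is presupposed. It is applied with \<open>a = 4 * \<delta>\<^sup>2\<close> to detect
  absolute continuity and with \<open>a = 1 / T\<^sup>2\<close> to bound the transform on the ball
  of radius \<open>T\<close>.\<close>

lemma gauss_energy:
  fixes \<mu> :: "'a::euclidean_space measure"
  assumes \<mu>: "finite_measure \<mu>" "sets \<mu> = sets borel" and a: "a > 0"
  shows "(\<integral>\<^sup>+\<xi>. ennreal (exp (- pi * a * (norm \<xi>)\<^sup>2) * (cmod (fourier_measure \<mu> \<xi>))\<^sup>2) \<partial>lborel)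
    = (\<integral>\<^sup>+x. \<integral>\<^sup>+y. ennreal (exp (- pi * (norm (x - y))\<^sup>2 / a) / sqrt a ^ DIM('a)) \<partial>\<mu> \<partial>\<mu>)"
proof -
  note [measurable_cong] = \<mu>(2)
  interpret finite_measure \<mu> by fact
  interpret P: finite_measure "\<mu> \<Otimes>\<^sub>M \<mu>" by (rule finite_measure_pair_measure) unfold_locales
  note meas = borel_measurable_cmod_fourier[OF \<mu>]
  let ?F = "\<lambda>\<xi>. (cmod (fourier_measure \<mu> \<xi>))\<^sup>2"
  let ?k = "\<lambda>x y. exp (- pi * (norm (x - y))\<^sup>2 / a) / sqrt a ^ DIM('a)"
  let ?G = "gauss a :: 'a measure"
  interpret G: finite_measure ?G by (rule gauss_finite[OF a])
  have bnd: "\<bar>?F \<xi>\<bar> \<le> (measure \<mu> (space \<mu>))\<^sup>2" for \<xi>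
  proof -
    have "cmod (fourier_measure \<mu> \<xi>) \<le> (\<integral>x. cmod (exp (- 2 * of_real pi * \<i> * of_real (x \<bullet> \<xi>))) \<partial>\<mu>)"
      unfolding fourier_measure_def by (rule integral_norm_bound)
    also have "\<dots> = (\<integral>x. 1 \<partial>\<mu>)" by (intro Bochner_Integration.integral_cong refl) simp
    finally show ?thesis by (simp add: power_mono)
  qed
  have "(\<integral>\<^sup>+\<xi>. ennreal (exp (- pi * a * (norm \<xi>)\<^sup>2) * ?F \<xi>) \<partial>lborel) = (\<integral>\<^sup>+\<xi>. ennreal (?F \<xi>) \<partial>?G)"
    unfolding gauss_def using meas by (subst nn_integral_density) (auto simp: ennreal_mult)
  also have "\<dots> = ennreal (\<integral>\<xi>. ?F \<xi> \<partial>?G)"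
    using meas by (intro nn_integral_eq_integral integrable_bounded_finite[OF G.finite_measure_axioms _ bnd])
      (auto simp: measurable_cong_sets[OF gauss_finite(2)[OF a] refl])
  also have "(\<integral>\<xi>. ?F \<xi> \<partial>?G) = (\<integral>x. \<integral>y. ?k x y \<partial>\<mu> \<partial>\<mu>)"
    using fourier_energy[OF \<mu> gauss_finite[OF a]] by (simp add: fcos_gauss[OF a])
  also have "ennreal \<dots> = (\<integral>\<^sup>+x. ennreal (\<integral>y. ?k x y \<partial>\<mu>) \<partial>\<mu>)"
  proof (rule nn_integral_eq_integral[symmetric])
    show "integrable \<mu> (\<lambda>x. \<integral>y. ?k x y \<partial>\<mu>)"
    proof (rule integrable_bounded_finite[OF finite_measure_axioms, where B="1 / sqrt a ^ DIM('a) * measure \<mu> (space \<mu>)"])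
      fix x
      have "\<bar>\<integral>y. ?k x y \<partial>\<mu>\<bar> \<le> (\<integral>y. \<bar>?k x y\<bar> \<partial>\<mu>)" by (rule integral_abs_bound)
      also have "\<dots> \<le> (\<integral>y. 1 / sqrt a ^ DIM('a) \<partial>\<mu>)"
        using a by (intro integral_mono integrable_bounded_finite[OF finite_measure_axioms, where B="1 / sqrt a ^ DIM('a)"])
           (auto simp: divide_right_mono)
      finally show "\<bar>\<integral>y. ?k x y \<partial>\<mu>\<bar> \<le> 1 / sqrt a ^ DIM('a) * measure \<mu> (space \<mu>)" by simp
    qed measurable
    show "AE x in \<mu>. 0 \<le> (\<integral>y. ?k x y \<partial>\<mu>)" using a by (intro AE_I2 integral_nonneg_AE) auto
  qed
  also have "\<dots> = (\<integral>\<^sup>+x. \<integral>\<^sup>+y. ennreal (?k x y) \<partial>\<mu> \<partial>\<mu>)"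
    using a by (intro nn_integral_cong nn_integral_eq_integral[symmetric] AE_I2
        integrable_bounded_finite[OF finite_measure_axioms, where B="1 / sqrt a ^ DIM('a)"])
           (auto simp: divide_right_mono)
  finally show ?thesis .
qed

subsection \<open>Rotation invariance, polar coordinates and absolute continuity\<close>

lemma nn_integral_lborel_scale:
  fixes f :: "'a::euclidean_space \<Rightarrow> ennreal"
  assumes [measurable]: "f \<in> borel_measurable borel" and c: "c > 0"
  shows "(\<integral>\<^sup>+x. f x \<partial>lborel) = ennreal (c ^ DIM('a)) * (\<integral>\<^sup>+x. f (c *\<^sub>R x) \<partial>lborel)"
proof -
  have "(\<integral>\<^sup>+x. f x \<partial>lborel) = (\<integral>\<^sup>+x. f x \<partial>density (distr lborel borel (\<lambda>x. 0 + c *\<^sub>R x)) (\<lambda>_. \<bar>c\<bar> ^ DIM('a)))"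
    using lborel_affine[of c "0::'a"] c by simp
  also have "\<dots> = ennreal (c ^ DIM('a)) * (\<integral>\<^sup>+x. f (c *\<^sub>R x) \<partial>lborel)"
    using c by (simp add: nn_integral_density nn_integral_distr nn_integral_cmult)
  finally show ?thesis .
qed

lemma nn_integral_lborel_translate:
  fixes f :: "'a::euclidean_space \<Rightarrow> ennreal"
  assumes [measurable]: "f \<in> borel_measurable borel"
  shows "(\<integral>\<^sup>+x. f (c + x) \<partial>lborel) = (\<integral>\<^sup>+x. f x \<partial>lborel)"
proof -
  have "(\<integral>\<^sup>+x. f x \<partial>lborel) = (\<integral>\<^sup>+x. f x \<partial>distr lborel borel ((+) c))"
    by (simp only: lborel_distr_plus)
  then show ?thesis by (simp add: nn_integral_distr)
qed

lemma ennreal_mult_right_cancel':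
  "a * c = b * c \<Longrightarrow> c \<noteq> 0 \<Longrightarrow> c \<noteq> \<top> \<Longrightarrow> a = (b :: ennreal)"
  by (metis mult_divide_eq_ennreal)

lemma emeasure_unit_ball:
  "emeasure lborel (ball (0::'a::euclidean_space) 1) \<noteq> 0" "emeasure lborel (ball (0::'a) 1) \<noteq> \<top>"
  using emeasure_lborel_ball_finite[of "0::'a" 1] unit_ball_vol_pos[of "real DIM('a)"]
  by (auto simp: emeasure_ball simp del: unit_ball_vol_pos)

text \<open>A translation-invariant measure is a multiple of Lebesgue measure: integrate
  \<open>1\<^sub>A (x + y) 1\<^sub>B y\<close> against the product of the two.\<close>

lemma lborel_orthogonal:
  fixes f :: "'a::euclidean_space \<Rightarrow> 'a"
  assumes f: "orthogonal_transformation f"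
  shows "distr lborel borel f = lborel"
proof (rule measure_eqI)
  have lin: "linear f" using f by (simp add: orthogonal_transformation_linear)
  have [measurable]: "f \<in> borel_measurable borel"
    by (intro borel_measurable_continuous_onI linear_continuous_on linear_conv_bounded_linear[THEN iffD1] lin)
  fix A assume "A \<in> sets (distr lborel borel f)"
  then have A[measurable]: "A \<in> sets borel" by simp
  define B where "B = ball (0::'a) 1"
  have [measurable]: "B \<in> sets borel" by (simp add: B_def)
  \<comment> \<open>Translation invariance of the image measure: since \<open>f\<close> is onto, the
    shift \<open>y\<close> is some \<open>f w\<close> and moves inside \<open>f\<close>.\<close>
  have inv: "(\<integral>\<^sup>+x. g (f x + y) \<partial>lborel) = (\<integral>\<^sup>+x. g (f x) \<partial>lborel)"
    if [measurable]: "g \<in> borel_measurable borel" for g :: "'a \<Rightarrow> ennreal" and y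
  proof -
    obtain w where w: "y = f w" using orthogonal_transformation_surj[OF f] by (metis surjD)
    have "(\<integral>\<^sup>+x. g (f x + y) \<partial>lborel) = (\<integral>\<^sup>+x. g (f (w + x)) \<partial>lborel)"
      by (simp add: w linear_add[OF lin] add.commute)
    also have "\<dots> = (\<integral>\<^sup>+x. g (f x) \<partial>lborel)" by (rule nn_integral_lborel_translate) measurable
    finally show ?thesis .
  qed
  have normf: "f x \<in> B \<longleftrightarrow> x \<in> B" for x
    using f by (simp add: B_def orthogonal_transformation_norm)
  have "emeasure (distr lborel borel f) A * emeasure lborel B
      = (\<integral>\<^sup>+y. indicator B y * (\<integral>\<^sup>+x. indicator A (f x) \<partial>lborel) \<partial>lborel)"
    by (simp add: emeasure_distr nn_integral_multc nn_integral_indicator[symmetric] nn_integral_distr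
        mult.commute del: nn_integral_indicator)
  also have "\<dots> = (\<integral>\<^sup>+y. (\<integral>\<^sup>+x. indicator B y * indicator A (f x + y) \<partial>lborel) \<partial>lborel)"
    by (subst nn_integral_cmult) (auto simp: inv[of "indicator A"])
  also have "\<dots> = (\<integral>\<^sup>+x. (\<integral>\<^sup>+y. indicator B y * indicator A (f x + y) \<partial>lborel) \<partial>lborel)"
    by (rule lborel_pair.Fubini') measurable
  also have "\<dots> = (\<integral>\<^sup>+x. (\<integral>\<^sup>+y. indicator B (y - f x) * indicator A y \<partial>lborel) \<partial>lborel)"
  proof (rule nn_integral_cong)
    fix x
    show "(\<integral>\<^sup>+y. indicator B y * indicator A (f x + y) \<partial>lborel) = (\<integral>\<^sup>+y. indicator B (y - f x) * (indicator A y :: ennreal) \<partial>lborel)"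
      using nn_integral_lborel_translate[of "\<lambda>y. indicator B (y - f x) * (indicator A y :: ennreal)" "f x"] by simp
  qed
  also have "\<dots> = (\<integral>\<^sup>+y. (\<integral>\<^sup>+x. indicator B (y - f x) * indicator A y \<partial>lborel) \<partial>lborel)"
    by (rule lborel_pair.Fubini') measurable
  also have "\<dots> = (\<integral>\<^sup>+y. indicator A y * emeasure lborel B \<partial>lborel)"
  proof (rule nn_integral_cong)
    fix y
    have "(\<integral>\<^sup>+x. indicator B (y - f x) * indicator A y \<partial>lborel) = indicator A y * (\<integral>\<^sup>+x. indicator B (y - f x) \<partial>lborel)"
      by (subst nn_integral_cmult[symmetric]) (auto simp: mult.commute)
    also have "(\<integral>\<^sup>+x. indicator B (y - f x) \<partial>lborel) = (\<integral>\<^sup>+x. (indicator B (f x + (- y)) :: ennreal) \<partial>lborel)"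
      by (intro nn_integral_cong) (auto simp: B_def indicator_def norm_minus_commute)
    also have "\<dots> = (\<integral>\<^sup>+x. indicator B (f x) \<partial>lborel)" by (rule inv) measurable
    also have "\<dots> = (\<integral>\<^sup>+x. indicator B x \<partial>lborel)" by (simp add: indicator_def normf)
    also have "\<dots> = emeasure lborel B" by simp
    finally show "(\<integral>\<^sup>+x. indicator B (y - f x) * indicator A y \<partial>lborel) = indicator A y * emeasure lborel B" .
  qed
  also have "\<dots> = emeasure lborel A * emeasure lborel B"
    by (simp add: nn_integral_multc)
  finally have "emeasure (distr lborel borel f) A * emeasure lborel B = emeasure lborel A * emeasure lborel B" .
  moreover have "emeasure lborel B \<noteq> 0" "emeasure lborel B \<noteq> \<top>"
    using emeasure_unit_ball[where 'a='a] by (auto simp: B_def)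
  ultimately show "emeasure (distr lborel borel f) A = emeasure lborel A"
    by (rule ennreal_mult_right_cancel')
qed simp

section \<open>Invariance of spherical measure, radial null sets, polar coordinates\<close>

lemma sphere_measure_orthogonal:
  fixes f :: "'a::euclidean_space \<Rightarrow> 'a"
  assumes f: "orthogonal_transformation f"
  shows "distr sphere_measure borel f = (sphere_measure :: 'a measure)"
proof -
  have lin: "linear f" using f by (simp add: orthogonal_transformation_linear)
  have [measurable]: "f \<in> borel_measurable borel"
    by (intro borel_measurable_continuous_onI linear_continuous_on linear_conv_bounded_linear[THEN iffD1] lin)
  let ?U = "uniform_measure lborel (ball (0::'a) 1)"
  have comm: "f \<circ> sgn = sgn \<circ> f"
    using f by (auto simp: fun_eq_iff sgn_div_norm linear_scale[OF lin] orthogonal_transformation_norm)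
  have U: "distr ?U borel f = ?U"
  proof (rule measure_eqI)
    fix A assume "A \<in> sets (distr ?U borel f)"
    then have [measurable]: "A \<in> sets borel" by simp
    have [measurable]: "f -` A \<in> sets borel" using measurable_sets[of f borel borel A] by simp
    have "emeasure (distr ?U borel f) A = emeasure lborel (ball 0 1 \<inter> f -` A) / emeasure lborel (ball (0::'a) 1)"
      by (subst emeasure_distr) (auto simp: emeasure_uniform_measure)
    also have "ball 0 1 \<inter> f -` A = f -` (ball 0 1 \<inter> A)"
      using f by (auto simp: orthogonal_transformation_norm)
    also have "emeasure lborel \<dots> = emeasure (distr lborel borel f) (ball 0 1 \<inter> A)"
      by (subst emeasure_distr) auto
    finally show "emeasure (distr ?U borel f) A = emeasure ?U A"
      by (simp add: lborel_orthogonal[OF f] emeasure_uniform_measure)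
  qed simp
  have "distr sphere_measure borel f = distr ?U borel (f \<circ> sgn)"
    unfolding sphere_measure_def by (subst distr_distr) auto
  also have "\<dots> = distr (distr ?U borel f) borel sgn"
    unfolding comm by (subst distr_distr) auto
  finally show ?thesis by (simp add: U sphere_measure_def)
qed

lemma sets_sphere_measure [simp, measurable_cong]: "sets sphere_measure = sets borel"
  by (simp add: sphere_measure_def)

interpretation sphere: prob_space "sphere_measure :: 'a::euclidean_space measure"
  by (rule prob_space_sphere_measure)

lemma fcos_sphere_radial:
  fixes u v :: "real ^ 'n"
  assumes "norm u = norm v"
  shows "fcos sphere_measure u = fcos sphere_measure v"
proof -
  obtain f where f: "orthogonal_transformation f" "f u = v" by (rule orthogonal_transformation_exists[OF assms])
  have [measurable]: "f \<in> borel_measurable borel"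
    using f(1) by (intro borel_measurable_continuous_onI linear_continuous_on linear_conv_bounded_linear[THEN iffD1])
      (simp add: orthogonal_transformation_linear)
  have "fcos sphere_measure v = (\<integral>x. cos (2 * pi * (x \<bullet> v)) \<partial>distr sphere_measure borel f)"
    by (simp add: fcos_def sphere_measure_orthogonal[OF f(1)])
  also have "\<dots> = (\<integral>x. cos (2 * pi * (f x \<bullet> f u)) \<partial>sphere_measure)"
    by (subst integral_distr) (auto simp: f(2))
  also have "\<dots> = fcos sphere_measure u"
    using f(1) by (simp add: fcos_def orthogonal_transformation_def)
  finally show ?thesis by simp
qed

text \<open>Dilation shows that \<open>h t\<close> vanishes for one positive \<open>t\<close> only
  if \<open>h 1\<close> vanishes. Averaging over \<open>t\<close> and exchanging the integrals
  reduces the vanishing to the real line, where for fixed \<open>z \<noteq> 0\<close> the set of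
  \<open>t\<close> with \<open>t * norm z \<in> N\<close> is null.\<close>

lemma null_norm_vimage:
  assumes N: "N \<in> null_sets (lborel :: real measure)"
  shows "{z :: 'a::euclidean_space. norm z \<in> N} \<in> null_sets lborel"
proof -
  have [measurable]: "N \<in> sets borel" using N by auto
  define h where "h t = (\<integral>\<^sup>+(z :: 'a). indicator N (t * norm z) \<partial>lborel)" for t
  have h1: "h 1 = ennreal (t ^ DIM('a)) * h t" if "t > 0" for t
    using nn_integral_lborel_scale[of "\<lambda>z :: 'a. indicator N (norm z)" t] that by (simp add: h_def)
  have "(\<integral>\<^sup>+t. h t * indicator {0<..} t \<partial>lborel)
    = (\<integral>\<^sup>+(z :: 'a). (\<integral>\<^sup>+t. indicator N (t * norm z) * indicator {0<..} t \<partial>lborel) \<partial>lborel)"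
    unfolding h_def by (subst lborel_pair.Fubini') (auto simp: nn_integral_multc)
  also have "\<dots> = (\<integral>\<^sup>+(z :: 'a). 0 \<partial>lborel)"
  proof (rule nn_integral_cong_AE)
    show "AE z :: 'a in lborel. (\<integral>\<^sup>+t. indicator N (t * norm z) * indicator {0<..} t \<partial>lborel) = 0"
      using AE_lborel_singleton[of "0::'a"]
    proof eventually_elim
      case (elim z)
      then have z: "norm z > 0" by simp
      have "emeasure lborel N = (\<integral>\<^sup>+t. indicator N t \<partial>lborel)" by simp
      also have "\<dots> = ennreal (norm z) * (\<integral>\<^sup>+t. indicator N (norm z * t) \<partial>lborel)"
        using nn_integral_lborel_scale[of "indicator N :: real \<Rightarrow> ennreal" "norm z"] z by simp
      finally have "(\<integral>\<^sup>+t. indicator N (norm z * t) \<partial>lborel) = (0 :: ennreal)"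
        using N z by (auto simp: null_sets_def)
      then have "(\<integral>\<^sup>+t. indicator N (t * norm z) \<partial>lborel) = (0 :: ennreal)" by (simp add: mult.commute)
      moreover have "(\<integral>\<^sup>+t. indicator N (t * norm z) * indicator {0<..} t \<partial>lborel) \<le> (\<integral>\<^sup>+t. (indicator N (t * norm z) :: ennreal) \<partial>lborel)"
        by (intro nn_integral_mono) (auto split: split_indicator)
      ultimately show ?case by simp
    qed
  qed
  finally have "(\<integral>\<^sup>+t. h t * indicator {0<..} t \<partial>lborel) = 0" by simp
  moreover have [measurable]: "h \<in> borel_measurable borel" unfolding h_def[abs_def] by measurable
  ultimately have ae: "AE t in lborel. h t * indicator {0<..} t = 0"
    by (subst (asm) nn_integral_0_iff_AE) auto
  have "\<exists>t>0. h t = 0"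
  proof (rule ccontr)
    assume *: "\<not> (\<exists>t>0. h t = 0)"
    from ae have "AE t in lborel. t \<notin> {0<..1::real}"
    proof eventually_elim
      case (elim t)
      with * show ?case by (auto split: split_indicator_asm)
    qed
    then have "{0<..1::real} \<in> null_sets lborel" by (subst AE_iff_null_sets) auto
    then show False by (simp add: null_sets_def)
  qed
  then obtain t where "t > 0" "h t = 0" by blast
  then have "h 1 = 0" using h1 by simp
  moreover have "h 1 = emeasure lborel {z :: 'a. norm z \<in> N}"
  proof -
    have "h 1 = (\<integral>\<^sup>+z. indicator {z :: 'a. norm z \<in> N} z \<partial>lborel)" by (simp add: h_def indicator_def)
    also have "\<dots> = emeasure lborel {z :: 'a. norm z \<in> N}" by simp
    finally show ?thesis .
  qed
  ultimately show ?thesis by (intro null_setsI) auto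
qed

text \<open>Radial integration is expressed through the norm of a second Lebesgue variable, which
  avoids a density in the radius. Unfolding the spherical measure as the law of \<open>sgn z\<close>
  in the unit ball, the dilations \<open>\<xi> = norm z *\<^sub>R \<zeta>\<close> and
  \<open>w = norm \<zeta> *\<^sub>R z\<close> leave a constant \<open>K\<close> times the Lebesgue
  integral.\<close>

lemma sphere_polar:
  fixes f :: "'a::euclidean_space \<Rightarrow> ennreal"
  assumes f[measurable]: "f \<in> borel_measurable borel"
  shows "(\<integral>\<^sup>+\<xi>. \<integral>\<^sup>+\<omega>. f (norm (\<xi> :: 'a) *\<^sub>R \<omega>) \<partial>sphere_measure \<partial>lborel) = (\<integral>\<^sup>+\<xi>. f \<xi> \<partial>lborel)"
proof -
  let ?d = "DIM('a)"
  define B where "B = ball (0::'a) 1"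
  have [measurable]: "B \<in> sets borel" by (simp add: B_def)
  have B: "emeasure lborel B \<noteq> 0" "emeasure lborel B < \<top>"
    using emeasure_unit_ball[where 'a='a] by (auto simp: B_def less_top)
  define K where "K = (\<integral>\<^sup>+(\<eta> :: 'a). ennreal (1 / norm \<eta> ^ (2 * ?d)) * indicator {\<eta>. 1 < norm \<eta>} \<eta> \<partial>lborel)"
  have main: "(\<integral>\<^sup>+\<xi>. \<integral>\<^sup>+\<omega>. g (norm (\<xi> :: 'a) *\<^sub>R \<omega>) \<partial>sphere_measure \<partial>lborel) * emeasure lborel B
      = K * (\<integral>\<^sup>+\<xi>. g \<xi> \<partial>lborel)"
    if [measurable]: "g \<in> borel_measurable borel" for g :: "'a \<Rightarrow> ennreal"
  proof -
    have "(\<integral>\<^sup>+\<omega>. g (t *\<^sub>R \<omega>) \<partial>sphere_measure) * emeasure lborel B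
      = (\<integral>\<^sup>+z. g (t *\<^sub>R sgn z) * indicator B z \<partial>lborel)" for t
      unfolding sphere_measure_def B_def[symmetric] using B
      by (simp add: nn_integral_distr nn_integral_uniform_measure ennreal_divide_times ennreal_divide_self)
    then have "(\<integral>\<^sup>+\<xi>. \<integral>\<^sup>+\<omega>. g (norm (\<xi> :: 'a) *\<^sub>R \<omega>) \<partial>sphere_measure \<partial>lborel) * emeasure lborel B
      = (\<integral>\<^sup>+(\<xi> :: 'a). (\<integral>\<^sup>+z. g (norm \<xi> *\<^sub>R sgn z) * indicator B z \<partial>lborel) \<partial>lborel)"
      by (subst nn_integral_multc[symmetric]) auto
    also have "\<dots> = (\<integral>\<^sup>+z. (\<integral>\<^sup>+(\<xi> :: 'a). g (norm \<xi> *\<^sub>R sgn z) * indicator B z \<partial>lborel) \<partial>lborel)"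
      by (rule lborel_pair.Fubini') measurable
    also have "\<dots> = (\<integral>\<^sup>+z. (\<integral>\<^sup>+(\<zeta> :: 'a). ennreal (norm z ^ ?d) * (g (norm \<zeta> *\<^sub>R z) * indicator B z) \<partial>lborel) \<partial>lborel)"
    proof (rule nn_integral_cong_AE)
      show "AE z in lborel. (\<integral>\<^sup>+(\<xi> :: 'a). g (norm \<xi> *\<^sub>R sgn z) * indicator B z \<partial>lborel)
        = (\<integral>\<^sup>+(\<zeta> :: 'a). ennreal (norm z ^ ?d) * (g (norm \<zeta> *\<^sub>R z) * indicator B z) \<partial>lborel)"
        using AE_lborel_singleton[of "0::'a"]
      proof eventually_elim
        case (elim z)
        then have z: "norm z > 0" by simp
        have "norm (norm z *\<^sub>R \<zeta>) *\<^sub>R sgn z = norm \<zeta> *\<^sub>R z" for \<zeta> :: 'a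
          using z by (simp add: sgn_div_norm)
        then show ?case
          using nn_integral_lborel_scale[of "\<lambda>\<xi> :: 'a. g (norm \<xi> *\<^sub>R sgn z) * indicator B z" "norm z"] z
          by (simp add: nn_integral_cmult)
      qed
    qed
    also have "\<dots> = (\<integral>\<^sup>+(\<zeta> :: 'a). (\<integral>\<^sup>+z. ennreal (norm z ^ ?d) * (g (norm \<zeta> *\<^sub>R z) * indicator B z) \<partial>lborel) \<partial>lborel)"
      by (rule lborel_pair.Fubini') measurable
    also have "\<dots> = (\<integral>\<^sup>+(\<zeta> :: 'a). (\<integral>\<^sup>+w. ennreal (norm w ^ ?d / norm \<zeta> ^ (2 * ?d)) * (g w * indicator {w. norm w < norm \<zeta>} w) \<partial>lborel) \<partial>lborel)"
    proof (rule nn_integral_cong_AE)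
      show "AE \<zeta> :: 'a in lborel. (\<integral>\<^sup>+z. ennreal (norm z ^ ?d) * (g (norm \<zeta> *\<^sub>R z) * indicator B z) \<partial>lborel)
        = (\<integral>\<^sup>+w. ennreal (norm w ^ ?d / norm \<zeta> ^ (2 * ?d)) * (g w * indicator {w. norm w < norm \<zeta>} w) \<partial>lborel)"
        using AE_lborel_singleton[of "0::'a"]
      proof eventually_elim
        case (elim \<zeta>)
        then have z: "norm \<zeta> > 0" by simp
        define c where "c = norm \<zeta>"
        have c: "c > 0" using z by (simp add: c_def)
        have "(\<integral>\<^sup>+w. ennreal (norm w ^ ?d / c ^ (2 * ?d)) * (g w * indicator {w. norm w < c} w) \<partial>lborel)
          = ennreal (c ^ ?d) * (\<integral>\<^sup>+z. ennreal (norm (c *\<^sub>R z) ^ ?d / c ^ (2 * ?d)) * (g (c *\<^sub>R z) * indicator {w. norm w < c} (c *\<^sub>R z)) \<partial>lborel)"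
          by (rule nn_integral_lborel_scale[OF _ c]) measurable
        also have "\<dots> = (\<integral>\<^sup>+z. ennreal (c ^ ?d) * (ennreal (norm (c *\<^sub>R z) ^ ?d / c ^ (2 * ?d)) * (g (c *\<^sub>R z) * indicator {w. norm w < c} (c *\<^sub>R z))) \<partial>lborel)"
          by (subst nn_integral_cmult) auto
        also have "\<dots> = (\<integral>\<^sup>+z. ennreal (norm z ^ ?d) * (g (c *\<^sub>R z) * indicator B z) \<partial>lborel)"
        proof (rule nn_integral_cong)
          fix z :: 'a
          have "c ^ ?d * (norm (c *\<^sub>R z) ^ ?d / c ^ (2 * ?d)) = norm z ^ ?d"
            using c by (simp add: power_mult_distrib mult_2 power_add)
          moreover have "indicator {w. norm w < c} (c *\<^sub>R z) = (indicator B z :: ennreal)"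
            using c by (auto simp: B_def indicator_def)
          ultimately show "ennreal (c ^ ?d) * (ennreal (norm (c *\<^sub>R z) ^ ?d / c ^ (2 * ?d)) * (g (c *\<^sub>R z) * indicator {w. norm w < c} (c *\<^sub>R z)))
            = ennreal (norm z ^ ?d) * (g (c *\<^sub>R z) * indicator B z)"
            using c by (simp add: mult.assoc[symmetric] ennreal_mult[symmetric])
        qed
        finally show ?case by (simp add: c_def)
      qed
    qed
    also have "\<dots> = (\<integral>\<^sup>+w. (\<integral>\<^sup>+(\<zeta> :: 'a). ennreal (norm w ^ ?d / norm \<zeta> ^ (2 * ?d)) * (g w * indicator {w. norm w < norm \<zeta>} w) \<partial>lborel) \<partial>lborel)"
      by (rule lborel_pair.Fubini') measurable
    also have "\<dots> = (\<integral>\<^sup>+w. K * g w \<partial>lborel)"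
    proof (rule nn_integral_cong_AE)
      show "AE w in lborel. (\<integral>\<^sup>+(\<zeta> :: 'a). ennreal (norm w ^ ?d / norm \<zeta> ^ (2 * ?d)) * (g w * indicator {w. norm w < norm \<zeta>} w) \<partial>lborel) = K * g w"
        using AE_lborel_singleton[of "0::'a"]
      proof eventually_elim
        case (elim w)
        define c where "c = norm w"
        have c: "c > 0" using elim by (simp add: c_def)
        have "(\<integral>\<^sup>+(\<zeta> :: 'a). ennreal (c ^ ?d / norm \<zeta> ^ (2 * ?d)) * (g w * indicator {\<zeta>. c < norm \<zeta>} \<zeta>) \<partial>lborel)
          = ennreal (c ^ ?d) * (\<integral>\<^sup>+(\<eta> :: 'a). ennreal (c ^ ?d / norm (c *\<^sub>R \<eta>) ^ (2 * ?d)) * (g w * indicator {\<zeta>. c < norm \<zeta>} (c *\<^sub>R \<eta>)) \<partial>lborel)"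
          by (rule nn_integral_lborel_scale[OF _ c]) measurable
        also have "\<dots> = (\<integral>\<^sup>+(\<eta> :: 'a). ennreal (c ^ ?d) * (ennreal (c ^ ?d / norm (c *\<^sub>R \<eta>) ^ (2 * ?d)) * (g w * indicator {\<zeta>. c < norm \<zeta>} (c *\<^sub>R \<eta>))) \<partial>lborel)"
          by (subst nn_integral_cmult) auto
        also have "\<dots> = (\<integral>\<^sup>+(\<eta> :: 'a). (ennreal (1 / norm \<eta> ^ (2 * ?d)) * indicator {\<eta>. 1 < norm \<eta>} \<eta>) * g w \<partial>lborel)"
        proof (rule nn_integral_cong)
          fix \<eta> :: 'a
          have "c ^ ?d * (c ^ ?d / norm (c *\<^sub>R \<eta>) ^ (2 * ?d)) = 1 / norm \<eta> ^ (2 * ?d)"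
            using c by (simp add: power_mult_distrib mult_2 power_add)
          moreover have "indicator {\<zeta>. c < norm \<zeta>} (c *\<^sub>R \<eta>) = (indicator {\<eta>. 1 < norm \<eta>} \<eta> :: ennreal)"
            using c by (auto simp: indicator_def)
          ultimately show "ennreal (c ^ ?d) * (ennreal (c ^ ?d / norm (c *\<^sub>R \<eta>) ^ (2 * ?d)) * (g w * indicator {\<zeta>. c < norm \<zeta>} (c *\<^sub>R \<eta>)))
            = (ennreal (1 / norm \<eta> ^ (2 * ?d)) * indicator {\<eta>. 1 < norm \<eta>} \<eta>) * g w"
            using c by (simp add: mult.assoc[symmetric] ennreal_mult[symmetric]) (simp add: mult_ac)
        qed
        also have "\<dots> = K * g w" unfolding K_def by (rule nn_integral_multc) measurable
        finally show ?case by (simp add: c_def indicator_def)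
      qed
    qed
    also have "\<dots> = K * (\<integral>\<^sup>+\<xi>. g \<xi> \<partial>lborel)" by (rule nn_integral_cmult) measurable
    finally show ?thesis .
  qed
  \<comment> \<open>The unit ball as test function identifies \<open>K\<close> with the volume of
    the ball, which also shows that \<open>K\<close> is finite.\<close>
  have "(\<integral>\<^sup>+\<omega>. indicator B (norm \<xi> *\<^sub>R \<omega>) \<partial>sphere_measure) = (indicator B \<xi> :: ennreal)" for \<xi> :: 'a
  proof -
    have "(\<integral>\<^sup>+\<omega>. indicator B (norm \<xi> *\<^sub>R \<omega>) \<partial>sphere_measure) = (\<integral>\<^sup>+(\<omega> :: 'a). (indicator B \<xi> :: ennreal) \<partial>sphere_measure)"
      by (rule nn_integral_cong_AE, rule AE_mp[OF AE_sphere_measure]) (auto simp: B_def indicator_def)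
    then show ?thesis by (simp add: sphere.emeasure_space_1)
  qed
  with main[of "indicator B"] have "emeasure lborel B * emeasure lborel B = K * emeasure lborel B" by simp
  then have "K = emeasure lborel B" using B by (metis ennreal_mult_right_cancel' less_top)
  with main[OF f] have "(\<integral>\<^sup>+\<xi>. \<integral>\<^sup>+\<omega>. f (norm (\<xi> :: 'a) *\<^sub>R \<omega>) \<partial>sphere_measure \<partial>lborel) * emeasure lborel B
      = (\<integral>\<^sup>+\<xi>. f \<xi> \<partial>lborel) * emeasure lborel B" by (simp add: mult.commute)
  then show ?thesis using B by (metis ennreal_mult_right_cancel' less_top)
qed

section \<open>Absolute continuity from a square-integrable Fourier transform\<close>

lemma emeasure_lborel_ball_scale:
  assumes "\<delta> > 0"
  shows "emeasure lborel (ball (y :: 'a::euclidean_space) \<delta>) = ennreal (\<delta> ^ DIM('a)) * emeasure lborel (ball (0::'a) 1)"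
  using assms by (simp add: emeasure_ball ennreal_mult[symmetric] unit_ball_vol_nonneg mult.commute)

lemma compact_neighbourhood_small:
  fixes K :: "'a::euclidean_space set"
  assumes K: "compact K" and U: "K \<subseteq> U" "open U"
  obtains \<delta> where "\<delta> > 0" "(\<Union>y\<in>K. ball y \<delta>) \<subseteq> U"
proof (cases "K = {}")
  case True
  then show ?thesis using that[of 1] by simp
next
  case False
  obtain e where e: "e > 0" "\<And>x. x \<in> K \<Longrightarrow> \<exists>G\<in>{U}. ball x e \<subseteq> G"
    using Heine_Borel_lemma[of K "{U}"] K U by auto
  then show ?thesis using that[of e] by blast
qed

text \<open>With \<open>f x = m (ball x \<delta>) / |ball 0 \<delta>|\<close>, the square integral of \<open>f\<close> is bounded uniformly in \<open>\<delta>\<close>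
  by the energy, while the \<open>\<delta>\<close>-neighbourhood of \<open>K\<close> carries \<open>f\<close>-mass at least \<open>m K\<close>.\<close>

lemma L2_fourier_compact_bound:
  fixes m :: "'a::euclidean_space measure"
  assumes m: "finite_measure m" "sets m = sets borel" and K: "compact K" and V: "open V" "(\<Union>y\<in>K. ball y \<delta>) \<subseteq> V"
    and \<delta>: "\<delta> > 0"
  shows "emeasure m K * emeasure m K * emeasure lborel (ball (0::'a) 1)
    \<le> ennreal (exp pi * 2 ^ DIM('a)) * emeasure lborel V * (\<integral>\<^sup>+\<xi>. ennreal ((cmod (fourier_measure m \<xi>))\<^sup>2) \<partial>lborel)"
proof -
  let ?d = "DIM('a)"
  note [measurable_cong] = m(2)
  interpret finite_measure m by fact
  interpret pair_sigma_finite m lborel ..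
  interpret mm: pair_sigma_finite m m ..
  define v where "v = emeasure lborel (ball (0::'a) 1)"
  define \<E> where "\<E> = (\<integral>\<^sup>+\<xi>. ennreal ((cmod (fourier_measure m \<xi>))\<^sup>2) \<partial>lborel)"
  define b where "b = ennreal (\<delta> ^ ?d)"
  have v: "v \<noteq> 0" "v \<noteq> \<top>" using emeasure_unit_ball[where 'a='a] by (auto simp: v_def)
  have b: "b \<noteq> 0" "b \<noteq> \<top>" using \<delta> by (auto simp: b_def)
  have vb: "emeasure lborel (ball y \<delta>) = b * v" for y :: 'a
    using emeasure_lborel_ball_scale[OF \<delta>, of y] by (simp add: b_def v_def)
  have [measurable]: "K \<in> sets borel" "V \<in> sets borel" using K V(1) by (auto intro: borel_compact)
  define I where "I x y = (indicator {p. dist (fst p) (snd p) < \<delta>} (x, y) :: ennreal)" for x y :: 'a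
  have [measurable]: "{p :: 'a \<times> 'a. dist (fst p) (snd p) < \<delta>} \<in> sets (borel \<Otimes>\<^sub>M borel)"
    unfolding borel_prod by (intro borel_open open_Collect_less continuous_intros)
  have I_meas[measurable]: "(\<lambda>p. I (fst p) (snd p)) \<in> borel_measurable (borel \<Otimes>\<^sub>M borel)"
    unfolding I_def by measurable
  define f where "f x = (\<integral>\<^sup>+y. I x y \<partial>m)" for x
  have [measurable]: "(\<lambda>p. I (fst p) (snd p)) \<in> borel_measurable (borel \<Otimes>\<^sub>M m)" by measurable
  have [measurable]: "case_prod I \<in> borel_measurable (borel \<Otimes>\<^sub>M m)" using I_meas by (simp add: case_prod_beta')
  have f_meas[measurable]: "f \<in> borel_measurable borel" unfolding f_def[abs_def] by measurable
  have ballI: "(\<integral>\<^sup>+x. I x y \<partial>lborel) = b * v" for y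
  proof -
    have "(\<integral>\<^sup>+x. I x y \<partial>lborel) = (\<integral>\<^sup>+x. indicator (ball y \<delta>) x \<partial>lborel)"
      by (intro nn_integral_cong) (auto simp: I_def indicator_def dist_commute)
    then show ?thesis using vb by simp
  qed
  have lower: "b * v * emeasure m K \<le> (\<integral>\<^sup>+x. indicator V x * f x \<partial>lborel)"
  proof -
    have "b * v * emeasure m K = (\<integral>\<^sup>+y. indicator K y * (b * v) \<partial>m)"
      by (subst nn_integral_multc) (auto simp: mult.commute)
    also have "\<dots> = (\<integral>\<^sup>+y. \<integral>\<^sup>+x. indicator K y * I x y \<partial>lborel \<partial>m)"
      by (intro nn_integral_cong) (subst nn_integral_cmult, auto simp: ballI)
    also have "\<dots> \<le> (\<integral>\<^sup>+y. \<integral>\<^sup>+x. indicator V x * I x y \<partial>lborel \<partial>m)"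
    proof (intro nn_integral_mono)
      fix x y
      have "x \<in> V" if "y \<in> K" "dist x y < \<delta>"
        using V(2) that by (metis UN_I dist_commute mem_ball subsetD)
      then show "indicator K y * I x y \<le> indicator V x * I x y" by (auto simp: I_def indicator_def)
    qed
    also have "\<dots> = (\<integral>\<^sup>+x. \<integral>\<^sup>+y. indicator V x * I x y \<partial>m \<partial>lborel)"
      by (rule Fubini'[symmetric]) measurable
    also have "\<dots> = (\<integral>\<^sup>+x. indicator V x * f x \<partial>lborel)"
      unfolding f_def by (intro nn_integral_cong nn_integral_cmult) measurable
    finally show ?thesis .
  qed
  have upper: "(\<integral>\<^sup>+x. (f x)\<^sup>2 \<partial>lborel) \<le> b * v * (ennreal (exp pi * 2 ^ ?d) * b * \<E>)"
  proof -
    have "(f x)\<^sup>2 = (\<integral>\<^sup>+y. \<integral>\<^sup>+z. I x y * I x z \<partial>m \<partial>m)" for x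
      unfolding power2_eq_square
      by (subst nn_integral_cmult) (auto simp: nn_integral_multc f_def)
    then have "(\<integral>\<^sup>+x. (f x)\<^sup>2 \<partial>lborel) = (\<integral>\<^sup>+x. \<integral>\<^sup>+y. \<integral>\<^sup>+z. I x y * I x z \<partial>m \<partial>m \<partial>lborel)" by simp
    also have "\<dots> = (\<integral>\<^sup>+y. \<integral>\<^sup>+x. \<integral>\<^sup>+z. I x y * I x z \<partial>m \<partial>lborel \<partial>m)"
      by (rule Fubini') measurable
    also have "\<dots> = (\<integral>\<^sup>+y. \<integral>\<^sup>+z. \<integral>\<^sup>+x. I x y * I x z \<partial>lborel \<partial>m \<partial>m)"
      by (intro nn_integral_cong Fubini') measurable
    \<comment> \<open>Two balls of radius \<open>\<delta>\<close> meet only if their centres are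
      closer than \<open>2 * \<delta>\<close>. There the Gaussian exponent is at least
      \<open>- pi\<close>, which explains \<open>exp pi\<close>, and
      \<open>(2 * \<delta>) ^ ?d\<close> undoes the normalization of the kernel.\<close>
    also have "\<dots> \<le> (\<integral>\<^sup>+y. \<integral>\<^sup>+z. b * v * (ennreal (exp pi * (2 * \<delta>) ^ ?d) * ennreal (exp (- pi * (norm (y - z))\<^sup>2 / (4 * \<delta>\<^sup>2)) / sqrt (4 * \<delta>\<^sup>2) ^ ?d)) \<partial>m \<partial>m)"
    proof (intro nn_integral_mono)
      fix y z :: 'a
      show "(\<integral>\<^sup>+x. I x y * I x z \<partial>lborel) \<le> b * v * (ennreal (exp pi * (2 * \<delta>) ^ ?d) * ennreal (exp (- pi * (norm (y - z))\<^sup>2 / (4 * \<delta>\<^sup>2)) / sqrt (4 * \<delta>\<^sup>2) ^ ?d))"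
      proof (cases "dist y z < 2 * \<delta>")
        case True
        have "(\<integral>\<^sup>+x. I x y * I x z \<partial>lborel) \<le> (\<integral>\<^sup>+x. I x y \<partial>lborel)"
          by (intro nn_integral_mono) (auto simp: I_def indicator_def)
        also have "\<dots> = b * v * 1" by (simp add: ballI)
        also have "\<dots> \<le> b * v * ennreal (exp (pi - pi * (norm (y - z))\<^sup>2 / (4 * \<delta>\<^sup>2)))"
        proof (rule mult_left_mono)
          have "(norm (y - z))\<^sup>2 \<le> (2 * \<delta>)\<^sup>2" using True by (intro power_mono) (auto simp: dist_norm)
          then have "pi * (norm (y - z))\<^sup>2 / (4 * \<delta>\<^sup>2) \<le> pi" using \<delta> by (simp add: field_simps power_mult_distrib)
          then show "1 \<le> ennreal (exp (pi - pi * (norm (y - z))\<^sup>2 / (4 * \<delta>\<^sup>2)))" by simp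
        qed simp
        also have "ennreal (exp (pi - pi * (norm (y - z))\<^sup>2 / (4 * \<delta>\<^sup>2)))
          = ennreal (exp pi * (2 * \<delta>) ^ ?d) * ennreal (exp (- pi * (norm (y - z))\<^sup>2 / (4 * \<delta>\<^sup>2)) / sqrt (4 * \<delta>\<^sup>2) ^ ?d)"
        proof -
          have "sqrt (4 * \<delta>\<^sup>2) = 2 * \<delta>" using \<delta> by (simp add: real_sqrt_mult)
          moreover have "exp (pi - pi * (norm (y - z))\<^sup>2 / (4 * \<delta>\<^sup>2)) = exp pi * exp (- pi * (norm (y - z))\<^sup>2 / (4 * \<delta>\<^sup>2))"
            by (simp add: exp_add[symmetric])
          ultimately show ?thesis using \<delta> by (simp add: ennreal_mult[symmetric])
        qed
        finally show ?thesis .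
      next
        case False
        then have "I x y * I x z = 0" for x
          using dist_triangle3[of y z x] by (auto simp: I_def indicator_def)
        then have "(\<integral>\<^sup>+x. I x y * I x z \<partial>lborel) = 0" by (simp only: nn_integral_const mult_zero_left)
        then show ?thesis using zero_le by (rule ord_eq_le_trans)
      qed
    qed
    also have "\<dots> = b * v * (ennreal (exp pi * (2 * \<delta>) ^ ?d) * (\<integral>\<^sup>+y. \<integral>\<^sup>+z. ennreal (exp (- pi * (norm (y - z))\<^sup>2 / (4 * \<delta>\<^sup>2)) / sqrt (4 * \<delta>\<^sup>2) ^ ?d) \<partial>m \<partial>m))"
      by (simp add: nn_integral_cmult)
    also have "(\<integral>\<^sup>+y. \<integral>\<^sup>+z. ennreal (exp (- pi * (norm (y - z))\<^sup>2 / (4 * \<delta>\<^sup>2)) / sqrt (4 * \<delta>\<^sup>2) ^ ?d) \<partial>m \<partial>m)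
      = (\<integral>\<^sup>+\<xi>. ennreal (exp (- pi * (4 * \<delta>\<^sup>2) * (norm \<xi>)\<^sup>2) * (cmod (fourier_measure m \<xi>))\<^sup>2) \<partial>lborel)"
      using \<delta> by (intro gauss_energy[symmetric] m) simp
    also have "\<dots> \<le> \<E>"
      unfolding \<E>_def by (intro nn_integral_mono ennreal_leI mult_left_le_one_le) auto
    finally have "(\<integral>\<^sup>+x. (f x)\<^sup>2 \<partial>lborel) \<le> b * v * (ennreal (exp pi * (2 * \<delta>) ^ ?d) * \<E>)"
      by (simp add: mult_left_mono)
    also have "ennreal (exp pi * (2 * \<delta>) ^ ?d) = ennreal (exp pi * 2 ^ ?d) * b"
      using \<delta> by (simp add: power_mult_distrib b_def ennreal_mult[symmetric])
    finally show ?thesis .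
  qed
  \<comment> \<open>Cauchy-Schwarz on \<open>V\<close>. The common factor \<open>b * b * v\<close>
    then cancels, and with it every dependence on \<open>\<delta>\<close>.\<close>
  have "(b * v * emeasure m K)\<^sup>2 \<le> (\<integral>\<^sup>+x. indicator V x * f x \<partial>lborel)\<^sup>2"
    using lower by (intro power_mono) auto
  also have "\<dots> \<le> (\<integral>\<^sup>+x. (indicator V x)\<^sup>2 \<partial>lborel) * (\<integral>\<^sup>+x. (f x)\<^sup>2 \<partial>lborel)"
    by (intro Cauchy_Schwarz_nn_integral) auto
  also have "(\<integral>\<^sup>+x. (indicator V x)\<^sup>2 \<partial>lborel) = emeasure lborel V"
  proof -
    have "(\<integral>\<^sup>+x. (indicator V x)\<^sup>2 \<partial>lborel) = (\<integral>\<^sup>+x. indicator V x \<partial>lborel)"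
      by (rule nn_integral_cong) (simp split: split_indicator)
    then show ?thesis by simp
  qed
  also have "emeasure lborel V * (\<integral>\<^sup>+x. (f x)\<^sup>2 \<partial>lborel) \<le> emeasure lborel V * (b * v * (ennreal (exp pi * 2 ^ ?d) * b * \<E>))"
    using upper by (intro mult_left_mono) auto
  finally have "(b * b * v) * (emeasure m K * emeasure m K * v) \<le> (b * b * v) * (ennreal (exp pi * 2 ^ ?d) * emeasure lborel V * \<E>)"
    by (simp add: power2_eq_square mult_ac)
  then have "emeasure m K * emeasure m K * v \<le> ennreal (exp pi * 2 ^ ?d) * emeasure lborel V * \<E>"
    by (rule ennreal_mult_le_mult_iff[THEN iffD1, rotated 2]) (use b v in \<open>auto simp: ennreal_mult_eq_top_iff\<close>)
  then show ?thesis by (simp add: v_def \<E>_def)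
qed

text \<open>By inner regularity only compact subsets \<open>K\<close> of \<open>Z\<close> have to be
  tested. An open superset of \<open>Z\<close> of measure below \<open>e\<close> contains a
  neighbourhood of \<open>K\<close>, so \<open>L2_fourier_compact_bound\<close> makes the square of
  the mass of \<open>K\<close> a multiple of \<open>e\<close>.\<close>

lemma L2_fourier_absolutely_continuous:
  fixes m :: "'a::euclidean_space measure"
  assumes m: "finite_measure m" "sets m = sets borel"
    and E: "(\<integral>\<^sup>+\<xi>. ennreal ((cmod (fourier_measure m \<xi>))\<^sup>2) \<partial>lborel) < \<infinity>"
    and Z: "Z \<in> null_sets lborel"
  shows "emeasure m Z = 0"
proof -
  interpret finite_measure m by fact
  have Zb: "Z \<in> sets borel" using Z by auto
  let ?v = "emeasure lborel (ball (0::'a) 1)"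
  define \<E> where "\<E> = ennreal (exp pi * 2 ^ DIM('a)) * (\<integral>\<^sup>+\<xi>. ennreal ((cmod (fourier_measure m \<xi>))\<^sup>2) \<partial>lborel)"
  have \<E>: "\<E> < \<top>" using E by (simp add: \<E>_def ennreal_mult_less_top)
  have "emeasure m K = 0" if K: "K \<subseteq> Z" "compact K" for K
  proof -
    have "emeasure m K * emeasure m K * ?v \<le> ennreal e * \<E>" if "e > 0" for e
    proof -
      obtain V where V: "open V" "Z \<subseteq> V" "emeasure lborel V < ennreal e"
      proof -
        obtain V where "open V" "Z \<subseteq> V" "emeasure lborel (V - Z) < ennreal e"
          using outer_regular_lborel[OF Zb \<open>e > 0\<close>] by blast
        moreover have "emeasure lborel V \<le> emeasure lborel Z + emeasure lborel (V - Z)"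
          using \<open>Z \<subseteq> V\<close> \<open>open V\<close> Zb emeasure_subadditive[of Z lborel "V - Z"] by (simp add: Un_absorb1)
        ultimately show thesis using that Z by (auto simp: null_sets_def)
      qed
      obtain \<delta> where \<delta>: "\<delta> > 0" "(\<Union>y\<in>K. ball y \<delta>) \<subseteq> V"
        using compact_neighbourhood_small[OF K(2), of V] K(1) V by blast
      have "emeasure m K * emeasure m K * ?v \<le> ennreal (exp pi * 2 ^ DIM('a)) * emeasure lborel V * (\<integral>\<^sup>+\<xi>. ennreal ((cmod (fourier_measure m \<xi>))\<^sup>2) \<partial>lborel)"
        by (rule L2_fourier_compact_bound[OF m K(2) V(1) \<delta>(2,1)])
      also have "\<dots> = emeasure lborel V * \<E>" by (simp add: \<E>_def mult_ac)
      also have "\<dots> \<le> ennreal e * \<E>" using V(3) by (intro mult_right_mono) auto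
      finally show ?thesis .
    qed
    then have le: "emeasure m K * emeasure m K * ?v \<le> ennreal (1 / real (Suc n)) * \<E>" for n by simp
    have "(\<lambda>n. ennreal (1 / real (Suc n)) * \<E>) \<longlonglongrightarrow> ennreal 0 * \<E>"
      unfolding mult.commute[of _ \<E>] using \<E> by (intro ennreal_tendsto_cmult tendsto_ennrealI) (simp, real_asymp)
    from LIMSEQ_le_const[OF this, of "emeasure m K * emeasure m K * ?v"] le
    have "emeasure m K * emeasure m K * ?v = 0" by auto
    then show ?thesis using emeasure_unit_ball(1)[where 'a='a] by simp
  qed
  moreover have "emeasure m Z = (SUP K \<in> {K. K \<subseteq> Z \<and> compact K}. emeasure m K)"
    by (rule inner_regular[OF m(2) _ Zb]) (simp add: emeasure_finite)
  ultimately have "emeasure m Z \<le> 0" by (metis (no_types, lifting) SUP_least mem_Collect_eq order_refl)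
  then show ?thesis by simp
qed

subsection \<open>Uniform spherical averages\<close>

abbreviation borel_prob :: "'a::euclidean_space measure \<Rightarrow> bool" where
  "borel_prob \<mu> \<equiv> prob_space \<mu> \<and> sets \<mu> = sets borel"

lemma borel_probD:
  assumes "borel_prob \<mu>"
  shows "prob_space \<mu>" "finite_measure \<mu>" "sets \<mu> = sets borel" "space \<mu> = UNIV"
  using assms by (auto simp: prob_space.finite_measure dest: sets_eq_imp_space_eq)

text \<open>The complex conjugate of \<open>fourier_measure\<close> for finite Borel measures,
  assembled from real integrals; only its modulus and its linearity in the measure are used.\<close>

definition ft :: "'a::euclidean_space measure \<Rightarrow> 'a \<Rightarrow> complex" where
  "ft \<mu> \<xi> = Complex (fcos \<mu> \<xi>) (fsin \<mu> \<xi>)"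

lemma cmod_ft:
  assumes "borel_prob \<mu>"
  shows "cmod (ft \<mu> \<xi>) = cmod (fourier_measure \<mu> \<xi>)"
  using cmod_fourier_measure[OF borel_probD(2,3)[OF assms], of \<xi>]
  by (simp add: ft_def cmod_def real_sqrt_unique)

lemma borel_measurable_ft [measurable]:
  assumes "borel_prob \<mu>"
  shows "ft \<mu> \<in> borel_measurable borel"
  using borel_measurable_fcos[OF borel_probD(2,3)[OF assms]]
  unfolding ft_def[abs_def] Complex_eq by measurable

lemma cmod_ft_le_1:
  assumes "borel_prob \<mu>"
  shows "cmod (ft \<mu> \<xi>) \<le> 1"
  using cmod_ft[OF assms] cmod_fourier_measure_le_1[of \<mu> \<xi>] assms by simp

definition sphere_avg :: "'a::euclidean_space measure \<Rightarrow> real \<Rightarrow> real" where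
  "sphere_avg \<mu> r = (\<integral>\<omega>. (cmod (fourier_measure \<mu> (r *\<^sub>R \<omega>)))\<^sup>2 \<partial>sphere_measure)"

lemma sphere_avg_ft:
  assumes "borel_prob \<mu>"
  shows "sphere_avg \<mu> r = (\<integral>\<omega>. (cmod (ft \<mu> (r *\<^sub>R \<omega>)))\<^sup>2 \<partial>sphere_measure)"
  by (simp add: sphere_avg_def cmod_ft[OF assms])

lemma sphere_avg_nonneg: "0 \<le> sphere_avg \<mu> r"
  unfolding sphere_avg_def by (rule integral_nonneg_AE) simp

lemma integrable_sphere:
  fixes f :: "'a::euclidean_space \<Rightarrow> real"
  assumes "f \<in> borel_measurable borel" "\<And>x. \<bar>f x\<bar> \<le> B"
  shows "integrable sphere_measure f"
  using assms by (intro integrable_bounded_finite[OF sphere.finite_measure_axioms, where B=B])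
    (auto simp: measurable_cong_sets[OF sets_sphere_measure refl])

lemma integrable_cmod_ft:
  assumes "borel_prob \<mu>"
  shows "integrable sphere_measure (\<lambda>\<omega>. (cmod (ft \<mu> (r *\<^sub>R \<omega>)))\<^sup>2)"
  using borel_measurable_ft[OF assms]
  by (intro integrable_sphere[where B=1]) (auto simp: power_le_one cmod_ft_le_1[OF assms])

lemma sphere_avg_le_1:
  assumes "borel_prob \<mu>"
  shows "sphere_avg \<mu> r \<le> 1"
proof -
  have "sphere_avg \<mu> r \<le> (\<integral>\<omega>. 1 \<partial>(sphere_measure :: 'a measure))"
    unfolding sphere_avg_ft[OF assms]
    by (intro integral_mono integrable_cmod_ft assms) (auto simp: power_le_one cmod_ft_le_1[OF assms])
  then show ?thesis by (simp add: sphere.prob_space)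
qed

text \<open>Geometric weights have a self-similar tail: a mixture splits into its first component and a
  mixture of the same kind of the remaining ones.\<close>

definition gmix :: "(nat \<Rightarrow> 'a::euclidean_space measure) \<Rightarrow> 'a measure" where
  "gmix y = measure_pmf (geometric_pmf (9/10)) \<bind> y"

lemma gmix_kernel:
  assumes "\<And>n. borel_prob (y n)"
  shows "y \<in> measure_pmf (geometric_pmf (9/10)) \<rightarrow>\<^sub>M subprob_algebra borel"
  using assms by (auto simp: space_subprob_algebra prob_space_imp_subprob_space)

lemma sets_gmix:
  assumes "\<And>n. borel_prob (y n)"
  shows "sets (gmix y) = sets borel"
  unfolding gmix_def using assms by (intro sets_bind) auto

lemma prob_space_gmix:
  assumes "\<And>n. borel_prob (y n)"
  shows "prob_space (gmix y)"
  unfolding gmix_def using assms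
  by (intro measure_pmf.prob_space_bind[where S=borel] gmix_kernel[of y]) auto

lemma borel_prob_gmix:
  assumes "\<And>n. borel_prob (y n)"
  shows "borel_prob (gmix y)"
  using sets_gmix[of y] prob_space_gmix[of y] assms by blast

lemma nn_integral_gmix:
  assumes y: "\<And>n. borel_prob (y n)" and f: "f \<in> borel_measurable borel"
  shows "(\<integral>\<^sup>+x. f x \<partial>gmix y) = (\<integral>\<^sup>+n. \<integral>\<^sup>+x. f x \<partial>y n \<partial>measure_pmf (geometric_pmf (9/10)))"
  unfolding gmix_def by (rule nn_integral_bind[OF f gmix_kernel[of y, OF y]])

lemma nn_integral_gmix_unfold:
  assumes y: "\<And>n. borel_prob (y n)" and f: "f \<in> borel_measurable borel"
  shows "(\<integral>\<^sup>+x. f x \<partial>gmix y) = ennreal (9/10) * (\<integral>\<^sup>+x. f x \<partial>y 0) + ennreal (1/10) * (\<integral>\<^sup>+x. f x \<partial>gmix (\<lambda>n. y (Suc n)))"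
proof -
  let ?g = "\<lambda>n. \<integral>\<^sup>+x. f x \<partial>y n"
  have "(\<integral>\<^sup>+n. ?g n \<partial>measure_pmf (geometric_pmf (9/10)))
    = ennreal (9/10) * ?g 0 + ennreal (1/10) * (\<integral>\<^sup>+n. ?g (Suc n) \<partial>measure_pmf (geometric_pmf (9/10)))"
    by (subst geometric_bind_pmf_unfold) (auto simp: nn_integral_return mult.commute)
  then show ?thesis using nn_integral_gmix[of y, OF y f] nn_integral_gmix[of "\<lambda>n. y (Suc n)", OF y f] by simp
qed

lemma integral_gmix_unfold:
  fixes f :: "'a::euclidean_space \<Rightarrow> real"
  assumes y: "\<And>n. borel_prob (y n)" and f: "f \<in> borel_measurable borel" "\<And>x. \<bar>f x\<bar> \<le> 1"
  shows "(\<integral>x. f x \<partial>gmix y) = 9/10 * (\<integral>x. f x \<partial>y 0) + 1/10 * (\<integral>x. f x \<partial>gmix (\<lambda>n. y (Suc n)))"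
proof -
  have nn: "(\<integral>\<^sup>+x. ennreal (f x + 1) \<partial>\<mu>) = ennreal ((\<integral>x. f x \<partial>\<mu>) + 1)" "0 \<le> (\<integral>x. f x \<partial>\<mu>) + 1"
    if "borel_prob \<mu>" for \<mu> :: "'a measure"
  proof -
    interpret prob_space \<mu> using that by simp
    have int: "integrable \<mu> f"
      using f that by (intro integrable_bounded_finite[where B=1] finite_measure_axioms) (auto simp: measurable_cong_sets[OF conjunct2[OF that] refl])
    have nonneg: "0 \<le> f x + 1" for x using f(2)[of x] by linarith
    have "(\<integral>\<^sup>+x. ennreal (f x + 1) \<partial>\<mu>) = ennreal (\<integral>x. f x + 1 \<partial>\<mu>)"
      using int nonneg by (intro nn_integral_eq_integral) auto
    also have "(\<integral>x. f x + 1 \<partial>\<mu>) = (\<integral>x. f x \<partial>\<mu>) + 1" using int by (simp add: prob_space)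
    finally show "(\<integral>\<^sup>+x. ennreal (f x + 1) \<partial>\<mu>) = ennreal ((\<integral>x. f x \<partial>\<mu>) + 1)" .
    have "0 \<le> (\<integral>x. f x + 1 \<partial>\<mu>)" using nonneg by (intro integral_nonneg_AE) auto
    then show "0 \<le> (\<integral>x. f x \<partial>\<mu>) + 1" using int by (simp add: prob_space)
  qed
  note g = borel_prob_gmix[of y, OF y] borel_prob_gmix[of "\<lambda>n. y (Suc n)", OF y]
  have "ennreal ((\<integral>x. f x \<partial>gmix y) + 1)
      = ennreal (9/10) * ennreal ((\<integral>x. f x \<partial>y 0) + 1) + ennreal (1/10) * ennreal ((\<integral>x. f x \<partial>gmix (\<lambda>n. y (Suc n))) + 1)"
    using nn_integral_gmix_unfold[of y "\<lambda>x. ennreal (f x + 1)", OF y] f(1) by (simp add: nn g y)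
  also have "\<dots> = ennreal (9/10 * ((\<integral>x. f x \<partial>y 0) + 1) + 1/10 * ((\<integral>x. f x \<partial>gmix (\<lambda>n. y (Suc n))) + 1))"
    using nn(2)[OF y[of 0]] nn(2)[OF g(2)] by (simp add: ennreal_mult[symmetric] ennreal_plus[symmetric] del: ennreal_plus)
  finally have "(\<integral>x. f x \<partial>gmix y) + 1 = 9/10 * ((\<integral>x. f x \<partial>y 0) + 1) + 1/10 * ((\<integral>x. f x \<partial>gmix (\<lambda>n. y (Suc n))) + 1)"
    using nn(2)[OF y[of 0]] nn(2)[OF g(2)] nn(2)[OF g(1)] by (subst (asm) ennreal_inj) auto
  moreover have "a = 9/10 * b + 1/10 * c" if "a + 1 = 9/10 * (b + 1) + 1/10 * (c + 1)" for a b c :: real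
    using that by (simp add: field_simps)
  ultimately show ?thesis by blast
qed

lemma ft_gmix_unfold:
  assumes y: "\<And>n. borel_prob (y n)"
  shows "ft (gmix y) \<xi> = (9/10) *\<^sub>R ft (y 0) \<xi> + (1/10) *\<^sub>R ft (gmix (\<lambda>n. y (Suc n))) \<xi>"
  using integral_gmix_unfold[of y "\<lambda>x. cos (2 * pi * (x \<bullet> \<xi>))", OF y] integral_gmix_unfold[of y "\<lambda>x. sin (2 * pi * (x \<bullet> \<xi>))", OF y]
  by (simp add: ft_def fcos_def fsin_def complex_eq_iff)

lemma ft_gmix:
  assumes y: "\<And>n. borel_prob (y n)"
  shows "ft (gmix y) \<xi> = (\<Sum>m<n. (9/10 * (1/10) ^ m) *\<^sub>R ft (y m) \<xi>) + ((1/10) ^ n) *\<^sub>R ft (gmix (\<lambda>j. y (n + j))) \<xi>"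
proof (induction n)
  case (Suc n)
  then show ?case
    using ft_gmix_unfold[of "\<lambda>j. y (n + j)" \<xi>] y by (simp add: algebra_simps)
qed simp

lemma measure_gmix_le:
  assumes y: "\<And>n. borel_prob (y n)" and A: "A \<in> sets borel" and le: "\<And>n. measure (y n) A \<le> c"
  shows "measure (gmix y) A \<le> c"
proof -
  interpret g: prob_space "gmix y" by (rule prob_space_gmix[of y, OF y])
  have c: "c \<ge> 0" using le[of 0] measure_nonneg order_trans by blast
  have "emeasure (gmix y) A = (\<integral>\<^sup>+n. emeasure (y n) A \<partial>measure_pmf (geometric_pmf (9/10)))"
    using nn_integral_gmix[of y "indicator A", OF y] A borel_probD(3)[OF y] sets_gmix[of y, OF y] by simp
  also have "\<dots> \<le> (\<integral>\<^sup>+n. ennreal c \<partial>measure_pmf (geometric_pmf (9/10)))"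
  proof (rule nn_integral_mono)
    fix n
    show "emeasure (y n) A \<le> ennreal c"
      using finite_measure.emeasure_eq_measure[OF borel_probD(2)[OF y[of n]], of A] le[of n] by (simp add: ennreal_leI)
  qed
  also have "\<dots> = ennreal c" by (simp add: measure_pmf.emeasure_space_1)
  finally show ?thesis using c by (simp add: g.emeasure_eq_measure)
qed

lemma cmod_sq_half: "(cmod (a + b))\<^sup>2 \<ge> (cmod a)\<^sup>2 / 2 - (cmod b)\<^sup>2"
proof -
  have "cmod a \<le> cmod (a + b) + cmod b" using norm_triangle_ineq4[of "a + b" b] by simp
  then have "(cmod a)\<^sup>2 \<le> (cmod (a + b) + cmod b)\<^sup>2" by (intro power_mono) auto
  also have "\<dots> \<le> 2 * (cmod (a + b))\<^sup>2 + 2 * (cmod b)\<^sup>2"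
    using zero_le_power2[of "cmod (a + b) - cmod b"] by (simp add: power2_eq_square algebra_simps)
  finally show ?thesis by simp
qed

text \<open>Whatever \<open>p\<close> is, the two sums differ by \<open>w\<close> times
  \<open>a - b\<close>, so they cannot both be small. In the gliding hump \<open>p\<close> is the
  part already built, over which there is no control.\<close>

lemma cmod_sq_choice:
  "(cmod (p + w *\<^sub>R a))\<^sup>2 + (cmod (p + w *\<^sub>R b))\<^sup>2 \<ge> w\<^sup>2 * ((cmod a)\<^sup>2 / 4 - (cmod b)\<^sup>2 / 2)"
proof -
  define u v where "u = p + w *\<^sub>R a" and "v = p + w *\<^sub>R b"
  have "(cmod (u - v))\<^sup>2 \<le> (cmod u + cmod v)\<^sup>2" by (intro power_mono norm_triangle_ineq4) auto
  also have "\<dots> \<le> 2 * (cmod u)\<^sup>2 + 2 * (cmod v)\<^sup>2"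
    using zero_le_power2[of "cmod u - cmod v"] by (simp add: power2_eq_square algebra_simps)
  finally have 1: "(cmod u)\<^sup>2 + (cmod v)\<^sup>2 \<ge> (cmod (u - v))\<^sup>2 / 2" by simp
  have "u - v = w *\<^sub>R (a + - b)" by (simp add: u_def v_def algebra_simps)
  then have 2: "(cmod (u - v))\<^sup>2 = w\<^sup>2 * (cmod (a + - b))\<^sup>2" by (simp add: power_mult_distrib del: add_uminus_conv_diff)
  have "w\<^sup>2 * ((cmod a)\<^sup>2 / 2 - (cmod b)\<^sup>2) \<le> w\<^sup>2 * (cmod (a + - b))\<^sup>2"
    using cmod_sq_half[of a "- b"] by (intro mult_left_mono) auto
  with 1 2 show ?thesis unfolding u_def[symmetric] v_def[symmetric] by (simp add: algebra_simps)
qed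

text \<open>A gliding hump argument: the supremum over the class being unbounded at radii \<open>r n\<close>, one
  superposes near-extremal measures \<open>\<nu> n\<close>, replacing each by a fixed measure where this is better, to
  obtain a single measure of the class violating the estimate.\<close>

lemma uniform_sphere_bound:
  fixes K :: "'a::euclidean_space measure set" and \<phi> :: "real \<Rightarrow> real"
  assumes prob: "\<And>\<mu>. \<mu> \<in> K \<Longrightarrow> borel_prob \<mu>"
    and mix: "\<And>y. (\<And>n. y n \<in> K) \<Longrightarrow> gmix y \<in> K"
    and \<phi>: "\<And>r. r \<ge> 1 \<Longrightarrow> \<phi> r > 0"
    and est: "\<And>\<mu>. \<mu> \<in> K \<Longrightarrow> \<exists>C. \<forall>r\<ge>1. sphere_avg \<mu> r \<le> C * \<phi> r"
  shows "\<exists>C. \<forall>\<mu>\<in>K. \<forall>r\<ge>1. sphere_avg \<mu> r \<le> C * \<phi> r"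
proof (rule ccontr)
  assume neg: "\<not> (\<exists>C. \<forall>\<mu>\<in>K. \<forall>r\<ge>1. sphere_avg \<mu> r \<le> C * \<phi> r)"
  then have "K \<noteq> {}" by blast
  then obtain \<nu>0 where \<nu>0: "\<nu>0 \<in> K" by blast
  define S where "S r = (SUP \<mu>\<in>K. sphere_avg \<mu> r)" for r
  have bdd: "bdd_above ((\<lambda>\<mu>. sphere_avg \<mu> r) ` K)" for r
    using sphere_avg_le_1[OF prob] by (intro bdd_aboveI[of _ 1]) auto
  have le_S: "sphere_avg \<mu> r \<le> S r" if "\<mu> \<in> K" for \<mu> r
    unfolding S_def using that bdd by (intro cSUP_upper)
  \<comment> \<open>The rate \<open>1000 ^ n\<close> is chosen to outrun the factor
    \<open>100 ^ n\<close> lost through the squared weights of the mixture.\<close>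
  have "\<exists>r \<nu>. r \<ge> 1 \<and> 1000 ^ n * \<phi> r < S r \<and> \<nu> \<in> K \<and> S r / 2 \<le> sphere_avg \<nu> r" for n :: nat
  proof -
    obtain \<mu> r where \<mu>: "\<mu> \<in> K" "r \<ge> 1" "1000 ^ n * \<phi> r < sphere_avg \<mu> r"
      using neg by (meson not_less)
    have S: "1000 ^ n * \<phi> r < S r" using \<mu> le_S[of \<mu> r] by simp
    moreover have "0 < 1000 ^ n * \<phi> r" using \<phi>[OF \<mu>(2)] by simp
    ultimately have "S r / 2 < S r" by linarith
    then obtain \<nu> where "\<nu> \<in> K" "S r / 2 < sphere_avg \<nu> r"
      unfolding S_def using less_cSUP_iff[OF \<open>K \<noteq> {}\<close> bdd] by blast
    then show ?thesis using S \<mu>(2) by (intro exI[of _ r] exI[of _ \<nu>]) auto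
  qed
  then obtain r \<nu> where r: "\<And>n::nat. r n \<ge> 1" "\<And>n. 1000 ^ n * \<phi> (r n) < S (r n)"
    and \<nu>: "\<And>n. \<nu> n \<in> K" "\<And>n. S (r n) / 2 \<le> sphere_avg (\<nu> n) (r n)" by metis
  define w where "w n = (9/10 * (1/10) ^ n :: real)" for n :: nat
  define y where "y n c = (if c then \<nu> n else \<nu>0)" for n and c :: bool
  have yK: "y n c \<in> K" for n c using \<nu>(1) \<nu>0 by (simp add: y_def)
  define P where "P f n \<omega> = (\<Sum>m<n. w m *\<^sub>R ft (y m (f m)) (r n *\<^sub>R \<omega>))" for f :: "nat \<Rightarrow> bool" and n and \<omega>
  \<comment> \<open>Half of the integrated lower bound of \<open>cmod_sq_choice\<close> for
    \<open>\<nu> n\<close> against \<open>\<nu>0\<close>, with the spherical average of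
    \<open>\<nu> n\<close> replaced by \<open>S (r n) / 2\<close>.\<close>
  define L where "L n = (w n)\<^sup>2 * (S (r n) / 8 - sphere_avg \<nu>0 (r n) / 2) / 2" for n
  define good where "good f n c \<longleftrightarrow> L n \<le> (\<integral>\<omega>. (cmod (P f n \<omega> + w n *\<^sub>R ft (y n c) (r n *\<^sub>R \<omega>)))\<^sup>2 \<partial>sphere_measure)" for f n c
  have w_pos: "w n \<ge> 0" "w n \<le> 1" for n using power_le_one[of "1/10::real" n] by (auto simp: w_def)
  have Pmeas[measurable]: "P f n \<in> borel_measurable borel" for f n
  proof -
    have [measurable]: "ft (y m (f m)) \<in> borel_measurable borel" for m by (rule borel_measurable_ft[OF prob[OF yK]])
    show ?thesis unfolding P_def[abs_def] by measurable
  qed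
  have ymeas[measurable]: "ft (y n c) \<in> borel_measurable borel" for n c by (rule borel_measurable_ft[OF prob[OF yK]])
  have Pbnd: "cmod (P f n \<omega>) \<le> real n" for f n \<omega>
  proof -
    have "cmod (P f n \<omega>) \<le> (\<Sum>m<n. 1)"
      unfolding P_def
    proof (rule sum_norm_le)
      fix m assume "m \<in> {..<n}"
      show "cmod (w m *\<^sub>R ft (y m (f m)) (r n *\<^sub>R \<omega>)) \<le> 1"
        using w_pos[of m] cmod_ft_le_1[OF prob[OF yK]] by (auto intro!: mult_le_one)
    qed
    then show ?thesis by simp
  qed
  have bnd: "(cmod (P f n \<omega> + w n *\<^sub>R ft (y n c) (r n *\<^sub>R \<omega>)))\<^sup>2 \<le> (real n + 1)\<^sup>2" for f n \<omega> c
  proof (intro power_mono)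
    have "cmod (w n *\<^sub>R ft (y n c) (r n *\<^sub>R \<omega>)) \<le> 1"
      using w_pos[of n] cmod_ft_le_1[OF prob[OF yK]] by (auto intro!: mult_le_one)
    then show "cmod (P f n \<omega> + w n *\<^sub>R ft (y n c) (r n *\<^sub>R \<omega>)) \<le> real n + 1"
      using Pbnd[of f n \<omega>] norm_triangle_le[of "P f n \<omega>"] by (intro norm_triangle_le) linarith
  qed simp
  have int: "integrable sphere_measure (\<lambda>\<omega>. (cmod (P f n \<omega> + w n *\<^sub>R ft (y n c) (r n *\<^sub>R \<omega>)))\<^sup>2)" for f n c
    using bnd by (intro integrable_sphere[where B="(real n + 1)\<^sup>2"]) auto
  \<comment> \<open>Whether a choice at \<open>n\<close> is good depends only on the choices before
    \<open>n\<close>, so the recursion is legitimate. At least one of the two candidates carries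
    half of the combined lower bound.\<close>
  have "\<exists>f. \<forall>n. good f n (f n)"
  proof (rule dependent_wellorder_choice)
    fix c n and f g :: "nat \<Rightarrow> bool"
    assume "\<And>m. m < n \<Longrightarrow> f m = g m"
    then have "P f n = P g n" by (auto simp: P_def fun_eq_iff)
    then show "good f n c = good g n c" by (simp add: good_def)
  next
    fix n f
    have "(\<integral>\<omega>. (w n)\<^sup>2 * ((cmod (ft (\<nu> n) (r n *\<^sub>R \<omega>)))\<^sup>2 / 4 - (cmod (ft \<nu>0 (r n *\<^sub>R \<omega>)))\<^sup>2 / 2) \<partial>sphere_measure)
      \<le> (\<integral>\<omega>. (cmod (P f n \<omega> + w n *\<^sub>R ft (\<nu> n) (r n *\<^sub>R \<omega>)))\<^sup>2 + (cmod (P f n \<omega> + w n *\<^sub>R ft \<nu>0 (r n *\<^sub>R \<omega>)))\<^sup>2 \<partial>sphere_measure)"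
      using int[of f n True] int[of f n False] integrable_cmod_ft[OF prob[OF \<nu>0]] integrable_cmod_ft[OF prob[OF \<nu>(1)]]
      by (intro integral_mono cmod_sq_choice integrable_mult_right Bochner_Integration.integrable_diff Bochner_Integration.integrable_add)
        (auto simp: y_def)
    also have "\<dots> = (\<integral>\<omega>. (cmod (P f n \<omega> + w n *\<^sub>R ft (y n True) (r n *\<^sub>R \<omega>)))\<^sup>2 \<partial>sphere_measure)
       + (\<integral>\<omega>. (cmod (P f n \<omega> + w n *\<^sub>R ft (y n False) (r n *\<^sub>R \<omega>)))\<^sup>2 \<partial>sphere_measure)"
      using int[of f n True] int[of f n False] by (simp add: y_def)
    finally have le: "(\<integral>\<omega>. (w n)\<^sup>2 * ((cmod (ft (\<nu> n) (r n *\<^sub>R \<omega>)))\<^sup>2 / 4 - (cmod (ft \<nu>0 (r n *\<^sub>R \<omega>)))\<^sup>2 / 2) \<partial>sphere_measure)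
      \<le> (\<integral>\<omega>. (cmod (P f n \<omega> + w n *\<^sub>R ft (y n True) (r n *\<^sub>R \<omega>)))\<^sup>2 \<partial>sphere_measure)
       + (\<integral>\<omega>. (cmod (P f n \<omega> + w n *\<^sub>R ft (y n False) (r n *\<^sub>R \<omega>)))\<^sup>2 \<partial>sphere_measure)" .
    have "(\<integral>\<omega>. (w n)\<^sup>2 * ((cmod (ft (\<nu> n) (r n *\<^sub>R \<omega>)))\<^sup>2 / 4 - (cmod (ft \<nu>0 (r n *\<^sub>R \<omega>)))\<^sup>2 / 2) \<partial>sphere_measure)
      = (w n)\<^sup>2 * (sphere_avg (\<nu> n) (r n) / 4 - sphere_avg \<nu>0 (r n) / 2)"
      using integrable_cmod_ft[OF prob[OF \<nu>0]] integrable_cmod_ft[OF prob[OF \<nu>(1)]]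
      by (simp add: sphere_avg_ft[OF prob[OF \<nu>0]] sphere_avg_ft[OF prob[OF \<nu>(1)]])
    from le[unfolded this] have "(w n)\<^sup>2 * (sphere_avg (\<nu> n) (r n) / 4 - sphere_avg \<nu>0 (r n) / 2)
      \<le> (\<integral>\<omega>. (cmod (P f n \<omega> + w n *\<^sub>R ft (y n True) (r n *\<^sub>R \<omega>)))\<^sup>2 \<partial>sphere_measure)
       + (\<integral>\<omega>. (cmod (P f n \<omega> + w n *\<^sub>R ft (y n False) (r n *\<^sub>R \<omega>)))\<^sup>2 \<partial>sphere_measure)" .
    moreover have "2 * L n \<le> (w n)\<^sup>2 * (sphere_avg (\<nu> n) (r n) / 4 - sphere_avg \<nu>0 (r n) / 2)"
      unfolding L_def using \<nu>(2)[of n] by (auto intro!: mult_left_mono)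
    ultimately have "good f n True \<or> good f n False" unfolding good_def by linarith
    then show "\<exists>c. good f n c" by blast
  qed
  then obtain f where f: "\<And>n. good f n (f n)" by blast
  define Y where "Y n = y n (f n)" for n
  have YK: "Y n \<in> K" for n unfolding Y_def by (rule yK)
  have gK: "gmix Y \<in> K" and gK': "gmix (\<lambda>j. Y (n + j)) \<in> K" for n by (auto intro!: mix YK)
  \<comment> \<open>The remaining components form, up to the factor \<open>(1/10) ^ Suc n\<close>, a
    mixture that again lies in \<open>K\<close>. Its spherical average is thus at most
    \<open>S (r n)\<close>, whatever is chosen later.\<close>
  have lower: "L n / 2 - (1/100) ^ Suc n * S (r n) \<le> sphere_avg (gmix Y) (r n)" for n
  proof -
    let ?A = "\<lambda>\<omega>. P f n \<omega> + w n *\<^sub>R ft (y n (f n)) (r n *\<^sub>R \<omega>)"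
    let ?R = "\<lambda>\<omega>. ft (gmix (\<lambda>j. Y (Suc n + j))) (r n *\<^sub>R \<omega>)"
    have split: "ft (gmix Y) (r n *\<^sub>R \<omega>) = ?A \<omega> + ((1/10) ^ Suc n) *\<^sub>R ?R \<omega>" for \<omega>
      using ft_gmix[of Y "r n *\<^sub>R \<omega>" "Suc n", OF prob[OF YK]] by (simp add: P_def Y_def w_def)
    have "(\<integral>\<omega>. (cmod (?A \<omega>))\<^sup>2 / 2 - (1/100) ^ Suc n * (cmod (?R \<omega>))\<^sup>2 \<partial>sphere_measure) \<le> sphere_avg (gmix Y) (r n)"
      unfolding sphere_avg_ft[OF prob[OF gK]]
    proof (rule integral_mono)
      show "integrable sphere_measure (\<lambda>\<omega>. (cmod (?A \<omega>))\<^sup>2 / 2 - (1/100) ^ Suc n * (cmod (?R \<omega>))\<^sup>2)"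
        using int[of f n "f n"] integrable_cmod_ft[OF prob[OF gK'[of "Suc n"]], of "r n"]
        by (intro Bochner_Integration.integrable_diff integrable_mult_right) auto
      show "integrable sphere_measure (\<lambda>\<omega>. (cmod (ft (gmix Y) (r n *\<^sub>R \<omega>)))\<^sup>2)" by (rule integrable_cmod_ft[OF prob[OF gK]])
      fix \<omega>
      have "((1/10) ^ Suc n)\<^sup>2 = ((1/100) ^ Suc n :: real)" by (simp add: power2_eq_square power_mult_distrib[symmetric])
      then show "(cmod (?A \<omega>))\<^sup>2 / 2 - (1/100) ^ Suc n * (cmod (?R \<omega>))\<^sup>2 \<le> (cmod (ft (gmix Y) (r n *\<^sub>R \<omega>)))\<^sup>2"
        unfolding split using cmod_sq_half[of "?A \<omega>" "((1/10) ^ Suc n) *\<^sub>R ?R \<omega>"]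
        by (simp add: power_mult_distrib del: power_Suc)
    qed
    also have "(\<integral>\<omega>. (cmod (?A \<omega>))\<^sup>2 / 2 - (1/100) ^ Suc n * (cmod (?R \<omega>))\<^sup>2 \<partial>sphere_measure)
      = (\<integral>\<omega>. (cmod (?A \<omega>))\<^sup>2 \<partial>sphere_measure) / 2 - (1/100) ^ Suc n * sphere_avg (gmix (\<lambda>j. Y (Suc n + j))) (r n)"
      using int[of f n "f n"] integrable_cmod_ft[OF prob[OF gK'[of "Suc n"]], of "r n"]
      by (subst Bochner_Integration.integral_diff) (auto simp: sphere_avg_ft[OF prob[OF gK'[of "Suc n"]], simplified])
    finally have "(\<integral>\<omega>. (cmod (?A \<omega>))\<^sup>2 \<partial>sphere_measure) / 2 - (1/100) ^ Suc n * sphere_avg (gmix (\<lambda>j. Y (Suc n + j))) (r n)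
       \<le> sphere_avg (gmix Y) (r n)" .
    moreover have "(1/100) ^ Suc n * sphere_avg (gmix (\<lambda>j. Y (Suc n + j))) (r n) \<le> (1/100) ^ Suc n * S (r n)"
      by (intro mult_left_mono le_S gK') auto
    ultimately show ?thesis using f[of n] unfolding good_def by linarith
  qed
  obtain C where C: "\<And>r. r \<ge> 1 \<Longrightarrow> sphere_avg (gmix Y) r \<le> C * \<phi> r" using est[OF gK] by blast
  obtain C0 where C0: "\<And>r. r \<ge> 1 \<Longrightarrow> sphere_avg \<nu>0 r \<le> C0 * \<phi> r" using est[OF \<nu>0] by blast
  have "10 ^ n \<le> 100 * (\<bar>C\<bar> + \<bar>C0\<bar>)" for n :: nat
  proof -
    let ?f = "\<phi> (r n)"
    have f0: "?f > 0" using \<phi> r(1) by blast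
    have wn: "(w n)\<^sup>2 = 81/100 * (1/100) ^ n"
      by (simp add: w_def power_mult_distrib power2_eq_square power_divide) (simp add: power_mult_distrib[symmetric])
    have eq: "100 ^ n * (L n / 2 - (1/100) ^ Suc n * S (r n)) = 81/400 * (S (r n) / 8 - sphere_avg \<nu>0 (r n) / 2) - S (r n) / 100"
    proof -
      have one: "100 ^ n * (1/100) ^ n = (1::real)" by (simp add: power_mult_distrib[symmetric])
      have "100 ^ n * (L n / 2 - (1/100) ^ Suc n * S (r n))
        = (100 ^ n * (1/100) ^ n) * (81/400 * (S (r n) / 8 - sphere_avg \<nu>0 (r n) / 2) - S (r n) / 100)"
        unfolding L_def wn by (simp add: algebra_simps)
      then show ?thesis by (simp only: one mult_1)
    qed
    \<comment> \<open>The weight 9/10 is large enough for this: \<open>81/3200 - 1/100\<close>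
      exceeds \<open>1/100\<close>, so the tail is beaten, and the coefficient \<open>81/800\<close>
      of \<open>a\<close> is below 1.\<close>
    have arith: "s / 100 \<le> c + z" if "81/400 * (s / 8 - a / 2) - s / 100 \<le> c" "a \<le> z" "0 \<le> z" "0 < s" for s a c z :: real
    proof -
      have "81/3200 * s - 81/800 * a - s / 100 \<le> c" using that(1) by (simp add: algebra_simps)
      then show ?thesis using that(2-4) by linarith
    qed
    have "S (r n) / 100 \<le> 100 ^ n * (\<bar>C\<bar> * ?f) + \<bar>C0\<bar> * ?f"
    proof (rule arith)
      have "81/400 * (S (r n) / 8 - sphere_avg \<nu>0 (r n) / 2) - S (r n) / 100 \<le> 100 ^ n * (C * ?f)"
        unfolding eq[symmetric] using lower[of n] C[OF r(1), of n] by (intro mult_left_mono) auto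
      also have "\<dots> \<le> 100 ^ n * (\<bar>C\<bar> * ?f)" using f0 by simp
      finally show "81/400 * (S (r n) / 8 - sphere_avg \<nu>0 (r n) / 2) - S (r n) / 100 \<le> 100 ^ n * (\<bar>C\<bar> * ?f)" .
      have "C0 * ?f \<le> \<bar>C0\<bar> * ?f" using f0 by simp
      then show "sphere_avg \<nu>0 (r n) \<le> \<bar>C0\<bar> * ?f" using C0[OF r(1), of n] by linarith
      show "0 \<le> \<bar>C0\<bar> * ?f" using f0 by simp
      have "0 < 1000 ^ n * ?f" using f0 by simp
      then show "0 < S (r n)" using r(2)[of n] by linarith
    qed
    also have "\<dots> \<le> 100 ^ n * (\<bar>C\<bar> * ?f) + 100 ^ n * (\<bar>C0\<bar> * ?f)"
      using mult_right_mono[OF one_le_power[of "100::real" n], of "\<bar>C0\<bar> * ?f"] f0 by simp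
    finally have "S (r n) \<le> 100 ^ n * (100 * (\<bar>C\<bar> + \<bar>C0\<bar>)) * ?f" by (simp add: algebra_simps)
    with r(2)[of n] have "1000 ^ n * ?f \<le> 100 ^ n * (100 * (\<bar>C\<bar> + \<bar>C0\<bar>)) * ?f" by linarith
    then have "1000 ^ n \<le> 100 ^ n * (100 * (\<bar>C\<bar> + \<bar>C0\<bar>))" using f0 by simp
    moreover have "(1000::real) ^ n = 100 ^ n * 10 ^ n" by (simp add: power_mult_distrib[symmetric])
    ultimately show ?thesis by simp
  qed
  moreover obtain n :: nat where "100 * (\<bar>C\<bar> + \<bar>C0\<bar>) < 10 ^ n"
    using real_arch_pow[of 10 "100 * (\<bar>C\<bar> + \<bar>C0\<bar>)"] by auto
  ultimately show False by (meson not_less)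
qed

section \<open>Convolutions, averages of translates, smoothing\<close>

lemma integral_indicator_vimage:
  assumes "sets M = sets borel" "g \<in> borel_measurable borel" "A \<in> sets borel"
  shows "(\<integral>x. indicat_real A (g x) \<partial>M) = measure M (g -` A)"
proof -
  have "g -` A \<in> sets M" using measurable_sets[OF assms(2,3)] assms(1) by simp
  moreover have "(\<lambda>x. indicat_real A (g x)) = indicat_real (g -` A)" by (auto simp: indicator_def)
  ultimately show ?thesis by simp
qed

definition conv :: "'a::euclidean_space measure \<Rightarrow> 'a measure \<Rightarrow> 'a measure" where
  "conv \<mu> P = distr (\<mu> \<Otimes>\<^sub>M P) borel (\<lambda>p. fst p + snd p)"

context
  fixes \<mu> P :: "'a::euclidean_space measure"
  assumes mu: "borel_prob \<mu>" and P: "borel_prob P"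
begin

interpretation prmu: prob_space \<mu> using mu by simp
interpretation prP: prob_space P using P by simp
interpretation prp: pair_prob_space \<mu> P ..

lemma conv_meas [measurable_cong]: "sets \<mu> = sets borel" "sets P = sets borel"
  using mu P by auto

lemma borel_prob_conv: "borel_prob (conv \<mu> P)"
  unfolding conv_def by (auto intro!: prp.prob_space_distr)

lemma fourier_conv: "fourier_measure (conv \<mu> P) \<xi> = fourier_measure \<mu> \<xi> * fourier_measure P \<xi>"
proof -
  let ?e = "\<lambda>x. exp (- 2 * of_real pi * \<i> * of_real (x \<bullet> \<xi>))"
  have "fourier_measure (conv \<mu> P) \<xi> = (\<integral>p. ?e (fst p) * ?e (snd p) \<partial>(\<mu> \<Otimes>\<^sub>M P))"
    unfolding fourier_measure_def conv_def
    by (subst integral_distr) (auto simp: inner_add_left distrib_left exp_add[symmetric] intro!: Bochner_Integration.integral_cong)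
  also have "\<dots> = (\<integral>x. (\<integral>y. ?e x * ?e y \<partial>P) \<partial>\<mu>)"
    by (subst prp.integral_fst'[symmetric]) (auto intro!: prp.integrable_const_bound[where B=1] simp: norm_mult)
  also have "\<dots> = fourier_measure \<mu> \<xi> * fourier_measure P \<xi>"
    by (simp add: fourier_measure_def)
  finally show ?thesis .
qed

lemma measure_conv:
  assumes [measurable]: "A \<in> sets borel"
  shows "measure (conv \<mu> P) A = (\<integral>u. measure \<mu> ((\<lambda>x. x + u) -` A) \<partial>P)"
    and "measure (conv \<mu> P) A = (\<integral>x. measure P ((\<lambda>u. x + u) -` A) \<partial>\<mu>)"
proof -
  interpret c: prob_space "conv \<mu> P" using borel_prob_conv by simp
  have spmu: "space \<mu> = UNIV" and spP: "space P = UNIV"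
    using borel_probD(4)[OF mu] borel_probD(4)[OF P] by auto
  have 1: "measure (conv \<mu> P) A = (\<integral>p. indicat_real A (fst p + snd p) \<partial>(\<mu> \<Otimes>\<^sub>M P))"
  proof -
    have "measure (conv \<mu> P) A = (\<integral>x. indicat_real A x \<partial>conv \<mu> P)" by (simp add: conv_def)
    also have "\<dots> = (\<integral>p. indicat_real A (fst p + snd p) \<partial>(\<mu> \<Otimes>\<^sub>M P))"
      unfolding conv_def by (subst integral_distr) auto
    finally show ?thesis .
  qed
  have int: "integrable (\<mu> \<Otimes>\<^sub>M P) (\<lambda>p. indicat_real A (fst p + snd p) :: real)"
    by (rule prp.integrable_const_bound[where B=1]) (auto simp: indicator_def)
  have "(\<integral>p. indicat_real A (fst p + snd p) \<partial>(\<mu> \<Otimes>\<^sub>M P)) = (\<integral>u. (\<integral>x. indicat_real A (x + u) \<partial>\<mu>) \<partial>P)"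
    using prp.integral_snd[of "\<lambda>x u. indicat_real A (x + u) :: real"] int by (simp add: case_prod_beta')
  also have "\<dots> = (\<integral>u. measure \<mu> ((\<lambda>x. x + u) -` A) \<partial>P)"
    by (intro Bochner_Integration.integral_cong refl)
      (simp add: integral_indicator_vimage[OF borel_probD(3)[OF mu]])
  finally show "measure (conv \<mu> P) A = (\<integral>u. measure \<mu> ((\<lambda>x. x + u) -` A) \<partial>P)" using 1 by simp
  have "(\<integral>p. indicat_real A (fst p + snd p) \<partial>(\<mu> \<Otimes>\<^sub>M P)) = (\<integral>x. (\<integral>u. indicat_real A (x + u) \<partial>P) \<partial>\<mu>)"
    using prp.integral_fst'[OF int] by simp
  also have "\<dots> = (\<integral>x. measure P ((\<lambda>u. x + u) -` A) \<partial>\<mu>)"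
    by (intro Bochner_Integration.integral_cong refl)
      (simp add: integral_indicator_vimage[OF borel_probD(3)[OF P]])
  finally show "measure (conv \<mu> P) A = (\<integral>x. measure P ((\<lambda>u. x + u) -` A) \<partial>\<mu>)" using 1 by simp
qed

end

text \<open>Ensures that translates along \<open>e\<close> have different phases in almost every
  direction, so that their cross terms can be averaged away.\<close>

lemma AE_sphere_inner_neq:
  fixes e :: "'a::euclidean_space"
  assumes "e \<in> Basis"
  shows "AE \<omega> in sphere_measure. \<omega> \<bullet> e \<noteq> 0"
proof -
  have "AE x in uniform_measure lborel (ball (0::'a) 1). sgn x \<bullet> e \<noteq> 0"
    using AE_lborel_inner_neq[OF assms, of 0]
    by (intro AE_uniform_measureI) (auto simp: sgn_div_norm elim!: eventually_mono)
  moreover have "sgn \<in> uniform_measure lborel (ball (0::'a) 1) \<rightarrow>\<^sub>M borel"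
  proof -
    have "(sgn :: 'a \<Rightarrow> 'a) \<in> borel \<rightarrow>\<^sub>M borel" unfolding sgn_div_norm[abs_def] by measurable
    then show ?thesis by (simp only: measurable_cong_sets[OF trans[OF sets_uniform_measure sets_lborel] refl])
  qed
  ultimately show ?thesis
    unfolding sphere_measure_def by (subst AE_distr_iff) auto
qed

lemma uniform_cos_average:
  fixes \<theta> :: real
  assumes n: "n > 0"
  shows "(\<integral>V. cos (2 * pi * \<theta> * V) \<partial>uniform_measure lborel {n..2 * n}) =
    (if \<theta> = 0 then 1 else (sin (2 * pi * \<theta> * (2 * n)) - sin (2 * pi * \<theta> * n)) / (2 * pi * \<theta> * n))"
proof -
  have em: "emeasure lborel {n..2 * n} = ennreal n" using n by simp
  have "(\<integral>V. cos (2 * pi * \<theta> * V) \<partial>uniform_measure lborel {n..2 * n}) = (1 / n) * (\<integral>V. indicator {n..2 * n} V *\<^sub>R cos (2 * pi * \<theta> * V) \<partial>lborel)"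
  proof -
    have "uniform_measure lborel {n..2 * n} = density lborel (\<lambda>V. ennreal (indicator {n..2 * n} V / n))"
      unfolding uniform_measure_def em using divide_ennreal[of 1 n] n
      by (intro arg_cong2[where f=density]) (auto simp: fun_eq_iff split: split_indicator)
    then have "(\<integral>V. cos (2 * pi * \<theta> * V) \<partial>uniform_measure lborel {n..2 * n})
      = (\<integral>V. (indicator {n..2 * n} V / n) *\<^sub>R cos (2 * pi * \<theta> * V) \<partial>lborel)"
      using n by (simp only:) (subst integral_density, auto)
    also have "\<dots> = (\<integral>V. (1 / n) * (indicator {n..2 * n} V *\<^sub>R cos (2 * pi * \<theta> * V)) \<partial>lborel)"
      by (intro Bochner_Integration.integral_cong refl) simp
    finally show ?thesis by simp
  qed
  also have "\<dots> = (if \<theta> = 0 then 1 else (sin (2 * pi * \<theta> * (2 * n)) - sin (2 * pi * \<theta> * n)) / (2 * pi * \<theta> * n))"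
  proof (cases "\<theta> = 0")
    case True
    then show ?thesis using n by simp
  next
    case False
    have "(\<integral>V. indicator {n..2 * n} V *\<^sub>R cos (2 * pi * \<theta> * V) \<partial>lborel)
      = sin (2 * pi * \<theta> * (2 * n)) / (2 * pi * \<theta>) - sin (2 * pi * \<theta> * n) / (2 * pi * \<theta>)"
    proof (rule integral_FTC_atLeastAtMost)
      show "n \<le> 2 * n" using n by simp
      show "((\<lambda>V. sin (2 * pi * \<theta> * V) / (2 * pi * \<theta>)) has_vector_derivative cos (2 * pi * \<theta> * V)) (at V within {n..2 * n})" for V
        unfolding has_real_derivative_iff_has_vector_derivative[symmetric]
        using False by (auto intro!: derivative_eq_intros)
    qed (intro continuous_intros)
    then show ?thesis using False n by (simp add: field_simps)
  qed
  finally show ?thesis .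
qed

text \<open>Averaging over a random spacing in \<open>{n..2 * n}\<close> removes every nonzero
  frequency in the limit. This replaces the choice of particular translations, while spacings in the
  interval are eventually as large as required.\<close>

lemma uniform_cos_average_tendsto:
  "(\<lambda>n. \<integral>V. cos (2 * pi * \<theta> * V) \<partial>uniform_measure lborel {real (Suc n)..2 * real (Suc n)}) \<longlonglongrightarrow> (if \<theta> = 0 then 1 else 0)"
proof (cases "\<theta> = 0")
  case True
  then show ?thesis by (simp add: uniform_cos_average)
next
  case False
  have "(\<lambda>n. (sin (2 * pi * \<theta> * (2 * real (Suc n))) - sin (2 * pi * \<theta> * real (Suc n))) / (2 * pi * \<theta> * real (Suc n))) \<longlonglongrightarrow> 0"
  proof (rule Lim_null_comparison)
    show "\<forall>\<^sub>F n in sequentially. norm ((sin (2 * pi * \<theta> * (2 * real (Suc n))) - sin (2 * pi * \<theta> * real (Suc n))) / (2 * pi * \<theta> * real (Suc n)))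
      \<le> 1 / (pi * \<bar>\<theta>\<bar>) * (1 / real (Suc n))"
    proof (rule always_eventually, rule allI)
      fix n
      have "\<bar>sin (2 * pi * \<theta> * (2 * real (Suc n))) - sin (2 * pi * \<theta> * real (Suc n))\<bar> \<le> 1 + 1"
        by (rule order_trans[OF abs_triangle_ineq4 add_mono]) (rule abs_sin_le_one)+
      then have "\<bar>sin (2 * pi * \<theta> * (2 * real (Suc n))) - sin (2 * pi * \<theta> * real (Suc n))\<bar> / (2 * pi * \<bar>\<theta>\<bar> * real (Suc n)) \<le> 2 / (2 * pi * \<bar>\<theta>\<bar> * real (Suc n))"
        by (intro divide_right_mono) auto
      then show "norm ((sin (2 * pi * \<theta> * (2 * real (Suc n))) - sin (2 * pi * \<theta> * real (Suc n))) / (2 * pi * \<theta> * real (Suc n)))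
        \<le> 1 / (pi * \<bar>\<theta>\<bar>) * (1 / real (Suc n))"
        by (simp add: abs_mult del: of_nat_Suc)
    qed
    have "(\<lambda>n. 1 / real (Suc n)) \<longlonglongrightarrow> 0" by real_asymp
    from tendsto_mult_right_zero[OF this] show "(\<lambda>n. 1 / (pi * \<bar>\<theta>\<bar>) * (1 / real (Suc n))) \<longlonglongrightarrow> 0" .
  qed
  then show ?thesis using False by (simp add: uniform_cos_average del: of_nat_Suc)
qed

text \<open>The average of \<open>M\<close> far apart translates of \<open>\<mu>\<close> has Frostman constant \<open>1\<close>, and for generic
  translations its spherical average is \<open>1 / M\<close> times that of \<open>\<mu>\<close>.\<close>

lemma translates_bound:
  fixes \<mu> :: "'a::euclidean_space measure" and M :: nat
  assumes mu: "borel_prob \<mu>" and supp: "measure \<mu> (ball 0 R) = 1" "R > 0" and s: "s \<ge> 0" and M: "M \<ge> 1" and r: "r > 0"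
    and frost: "\<And>x \<rho>. \<rho> > 0 \<Longrightarrow> measure \<mu> (ball x \<rho>) \<le> real M * \<rho> powr s"
    and K: "\<And>\<nu> :: 'a measure. borel_prob \<nu> \<Longrightarrow> (\<And>x \<rho>. \<rho> > 0 \<Longrightarrow> measure \<nu> (ball x \<rho>) \<le> \<rho> powr s) \<Longrightarrow> sphere_avg \<nu> r \<le> B"
  shows "sphere_avg \<mu> r \<le> real M * B"
proof -
  interpret mu: prob_space \<mu> using mu by simp
  note [measurable_cong] = borel_probD(3)[OF mu]
  obtain e :: 'a where e: "e \<in> Basis" using nonempty_Basis by blast
  then have norm_e: "norm e = 1" by simp
  let ?p = "pmf_of_set {..<M}"
  have ne: "{..<M} \<noteq> {}" using M by (auto simp: lessThan_empty_iff)
  \<comment> \<open>The uniform law on \<open>M\<close> equally spaced points along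
    \<open>e\<close>. Convolution with it averages translates of \<open>\<mu>\<close>, and
    \<open>h V\<close> below is its squared transform on the sphere of radius
    \<open>r\<close>.\<close>
  define P where "P V = distr (measure_pmf ?p) borel (\<lambda>j. (real j * V) *\<^sub>R e)" for V
  have P: "borel_prob (P V)" for V
    unfolding P_def by (auto intro!: measure_pmf.prob_space_distr)
  have intP: "(\<integral>u. f u \<partial>P V) = (\<Sum>j<M. f ((real j * V) *\<^sub>R e)) / real M" if "f \<in> borel_measurable borel" for f :: "'a \<Rightarrow> real" and V
    unfolding P_def using that ne by (subst integral_distr) (auto simp: integral_pmf_of_set)
  define h where "h V \<omega> = (\<Sum>j<M. \<Sum>l<M. cos (2 * pi * ((real j - real l) * (e \<bullet> (r *\<^sub>R \<omega>))) * V)) / (real M)\<^sup>2" for V \<omega>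
  have fourierP: "(cmod (fourier_measure (P V) (r *\<^sub>R \<omega>)))\<^sup>2 = h V \<omega>" for V \<omega>
  proof -
    let ?t = "\<lambda>j. 2 * pi * (real j * V * (e \<bullet> (r *\<^sub>R \<omega>)))"
    have c: "fcos (P V) (r *\<^sub>R \<omega>) = (\<Sum>j<M. cos (?t j)) / real M" "fsin (P V) (r *\<^sub>R \<omega>) = (\<Sum>j<M. sin (?t j)) / real M"
      unfolding fcos_def fsin_def by (subst intP; simp add: mult_ac)+
    have "(cmod (fourier_measure (P V) (r *\<^sub>R \<omega>)))\<^sup>2 = ((\<Sum>j<M. cos (?t j)) * (\<Sum>l<M. cos (?t l)) + (\<Sum>j<M. sin (?t j)) * (\<Sum>l<M. sin (?t l))) / (real M)\<^sup>2"
      unfolding cmod_fourier_measure[OF borel_probD(2,3)[OF P]] c by (simp add: power_divide power2_eq_square add_divide_distrib)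
    also have "\<dots> = (\<Sum>j<M. \<Sum>l<M. cos (?t j - ?t l)) / (real M)\<^sup>2"
      by (simp add: sum_product cos_diff sum.distrib)
    also have "\<dots> = h V \<omega>" unfolding h_def by (simp add: algebra_simps)
    finally show ?thesis .
  qed
  have h_bnd: "\<bar>h V \<omega>\<bar> \<le> 1" for V \<omega>
    unfolding fourierP[symmetric] using cmod_fourier_measure_le_1[of "P V" "r *\<^sub>R \<omega>"] P by (simp add: power_le_one)
  define F where "F \<omega> = (cmod (fourier_measure \<mu> (r *\<^sub>R \<omega>)))\<^sup>2" for \<omega>
  have F_bnd: "0 \<le> F \<omega>" "F \<omega> \<le> 1" for \<omega>
    using cmod_fourier_measure_le_1[of \<mu> "r *\<^sub>R \<omega>"] mu by (auto simp: F_def power_le_one)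
  have [measurable]: "F \<in> borel_measurable borel"
    using borel_measurable_cmod_fourier[OF borel_probD(2,3)[OF mu]] unfolding F_def[abs_def] by measurable
  \<comment> \<open>For \<open>\<rho> \<le> 1\<close>, the spacing lets a ball of radius
    \<open>\<rho>\<close> receive mass from at most one translate, whose weight \<open>1 / M\<close>
    cancels the constant \<open>M\<close>. For \<open>\<rho> > 1\<close> the bound
    \<open>\<rho> powr s\<close> is at least 1.\<close>
  have bound: "(\<integral>\<omega>. F \<omega> * h V \<omega> \<partial>sphere_measure) \<le> B" if V: "V \<ge> 2 * R + 2" for V
  proof -
    have "sphere_avg (conv \<mu> (P V)) r \<le> B"
    proof (rule K[OF borel_prob_conv[OF mu P]])
      fix x :: 'a and \<rho> :: real assume \<rho>: "\<rho> > 0"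
      interpret c: prob_space "conv \<mu> (P V)" using borel_prob_conv[OF mu P] by simp
      let ?b = "\<lambda>j. ball (x - (real j * V) *\<^sub>R e) \<rho>"
      have vb: "(\<lambda>x'. x' + u) -` ball x \<rho> = ball (x - u) \<rho>" for u
        by (auto simp: dist_norm algebra_simps)
      have "measure (conv \<mu> (P V)) (ball x \<rho>) = (\<integral>u. measure \<mu> (ball (x - u) \<rho>) \<partial>P V)"
        by (subst measure_conv(1)[OF mu P]) (auto simp: vb)
      also have "\<dots> = (\<Sum>j<M. measure \<mu> (?b j)) / real M"
      proof (rule intP)
        have "(\<lambda>u. \<integral>z. indicat_real (ball (x - u) \<rho>) z \<partial>\<mu>) \<in> borel_measurable borel"
        proof (rule mu.borel_measurable_lebesgue_integral)
          have "{p :: 'a \<times> 'a. dist (x - fst p) (snd p) < \<rho>} \<in> sets (borel \<Otimes>\<^sub>M borel)"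
            unfolding borel_prod by (intro borel_open open_Collect_less continuous_intros)
          moreover have "(\<lambda>(u, z). indicat_real (ball (x - u) \<rho>) z) = indicat_real {p. dist (x - fst p) (snd p) < \<rho>}"
            by (auto simp: indicator_def fun_eq_iff)
          ultimately have "(\<lambda>(u, z). indicat_real (ball (x - u) \<rho>) z) \<in> borel_measurable (borel \<Otimes>\<^sub>M borel)"
            by simp
          then show "(\<lambda>(u, z). indicat_real (ball (x - u) \<rho>) z) \<in> borel_measurable (borel \<Otimes>\<^sub>M \<mu>)"
            by (simp only: measurable_cong_sets[OF sets_pair_measure_cong[OF refl borel_probD(3)[OF mu]] refl])
        qed
        then show "(\<lambda>u. measure \<mu> (ball (x - u) \<rho>)) \<in> borel_measurable borel" by (simp add: borel_probD(3)[OF mu])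
      qed
      finally have eq: "measure (conv \<mu> (P V)) (ball x \<rho>) = (\<Sum>j<M. measure \<mu> (?b j)) / real M" .
      show "measure (conv \<mu> (P V)) (ball x \<rho>) \<le> \<rho> powr s"
      proof (cases "\<rho> \<le> 1")
        case False
        then have "1 \<le> \<rho> powr s" using s by (intro ge_one_powr_ge_zero) auto
        then show ?thesis using c.prob_le_1 order_trans by blast
      next
        case True
        have far: "\<bar>real j * V - real l * V\<bar> < 2 * (R + \<rho>)" if "measure \<mu> (?b j) \<noteq> 0" "measure \<mu> (?b l) \<noteq> 0" for j l
        proof -
          have meet: "\<exists>z. z \<in> ?b j \<and> z \<in> ball 0 R" if "measure \<mu> (?b j) \<noteq> 0" for j
          proof (rule ccontr)
            assume "\<not> ?thesis"
            then have "measure \<mu> (?b j \<union> ball 0 R) = measure \<mu> (?b j) + measure \<mu> (ball 0 R)"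
              by (intro mu.finite_measure_Union) (auto simp: borel_probD(3)[OF mu])
            moreover have "measure \<mu> (?b j \<union> ball 0 R) \<le> 1" by (rule mu.prob_le_1)
            ultimately show False using that supp measure_nonneg[of \<mu> "?b j"] by linarith
          qed
          have near: "norm (x - (real j * V) *\<^sub>R e) < R + \<rho>" if nz: "measure \<mu> (?b j) \<noteq> 0" for j
          proof -
            obtain z where z: "dist (x - (real j * V) *\<^sub>R e) z < \<rho>" "norm z < R" using meet[OF nz] by auto
            show ?thesis using norm_triangle_sub[of "x - (real j * V) *\<^sub>R e" z] z by (simp add: dist_norm)
          qed
          have "norm ((real j * V) *\<^sub>R e - (real l * V) *\<^sub>R e) < 2 * (R + \<rho>)"
            using norm_triangle_ineq4[of "x - (real l * V) *\<^sub>R e" "x - (real j * V) *\<^sub>R e"] near[OF that(1)] near[OF that(2)]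
            by (simp add: algebra_simps)
          then show ?thesis by (simp add: norm_e flip: scaleR_diff_left)
        qed
        have uniq: "j = l" if "measure \<mu> (?b j) \<noteq> 0" "measure \<mu> (?b l) \<noteq> 0" for j l
        proof (rule ccontr)
          assume "j \<noteq> l"
          then have "1 \<le> \<bar>real j - real l\<bar>" by linarith
          then have "V \<le> \<bar>real j - real l\<bar> * V" using V supp(2) by (simp add: mult_le_cancel_right1)
          also have "\<dots> = \<bar>real j * V - real l * V\<bar>" using V supp(2) by (simp add: abs_mult left_diff_distrib[symmetric])
          also have "\<dots> < 2 * (R + \<rho>)" by (rule far[OF that])
          finally show False using V True by simp
        qed
        have "(\<Sum>j<M. measure \<mu> (?b j)) \<le> real M * \<rho> powr s"
        proof (cases "\<exists>j<M. measure \<mu> (?b j) \<noteq> 0")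
          case True
          then obtain j where j: "j < M" "measure \<mu> (?b j) \<noteq> 0" by blast
          have "(\<Sum>j<M. measure \<mu> (?b j)) = (\<Sum>j\<in>{j}. measure \<mu> (?b j))"
            using uniq j by (intro sum.mono_neutral_right) auto
          then show ?thesis using frost[OF \<rho>, of "x - (real j * V) *\<^sub>R e"] by simp
        next
          case False
          then have "(\<Sum>j<M. measure \<mu> (?b j)) = 0" by (intro sum.neutral) auto
          then show ?thesis by simp
        qed
        then show ?thesis unfolding eq using M by (simp add: field_simps)
      qed
    qed
    also have "sphere_avg (conv \<mu> (P V)) r = (\<integral>\<omega>. F \<omega> * h V \<omega> \<partial>sphere_measure)"
      unfolding sphere_avg_def fourier_conv[OF mu P] F_def fourierP[symmetric] by (simp add: norm_mult power_mult_distrib)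
    finally show ?thesis .
  qed
  define U where "U n = uniform_measure lborel {real (Suc n)..2 * real (Suc n)}" for n
  have U: "prob_space (U n)" "sets (U n) = sets borel" for n
    unfolding U_def by (auto intro!: prob_space_uniform_measure)
  have hmeas: "(\<lambda>p. h (snd p) (fst p)) \<in> borel_measurable (borel \<Otimes>\<^sub>M borel)"
    unfolding h_def by measurable
  have hmeas': "(\<lambda>p. F (snd p) * h (fst p) (snd p)) \<in> borel_measurable (borel \<Otimes>\<^sub>M borel)"
    unfolding h_def by measurable
  have [measurable]: "h V \<in> borel_measurable borel" for V unfolding h_def[abs_def] by measurable
  have Fh: "\<bar>F \<omega> * h V \<omega>\<bar> \<le> 1" for \<omega> V
    using h_bnd[of V \<omega>] F_bnd[of \<omega>] by (auto simp: abs_mult intro!: mult_le_one)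
  define A where "A n \<omega> = (\<integral>V. h V \<omega> \<partial>U n)" for n \<omega>
  have A_eq: "A n \<omega> = (\<Sum>j<M. \<Sum>l<M. (\<integral>V. cos (2 * pi * ((real j - real l) * (e \<bullet> (r *\<^sub>R \<omega>))) * V) \<partial>U n)) / (real M)\<^sup>2" for n \<omega>
  proof -
    interpret U: prob_space "U n" by (rule U)
    have "integrable (U n) (\<lambda>V. cos (2 * pi * ((real j - real l) * (e \<bullet> (r *\<^sub>R \<omega>))) * V))" for j l
      using U(2)[of n] by (intro integrable_bounded_finite[where B=1] U.finite_measure_axioms) (auto simp: measurable_cong_sets[OF U(2) refl])
    then show ?thesis by (simp add: A_def h_def)
  qed
  have A_meas[measurable]: "A n \<in> borel_measurable borel" for n
  proof -
    interpret U: prob_space "U n" by (rule U)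
    note [measurable_cong] = U(2)[of n]
    have "(\<lambda>(\<omega>, V). h V \<omega>) \<in> borel_measurable (borel \<Otimes>\<^sub>M U n)"
      using hmeas by (simp only: case_prod_beta' measurable_cong_sets[OF sets_pair_measure_cong[OF refl U(2)] refl])
    then show ?thesis unfolding A_def[abs_def] by (rule U.borel_measurable_lebesgue_integral)
  qed
  have A_bnd: "\<bar>A n \<omega>\<bar> \<le> 1" for n \<omega>
  proof -
    interpret U: prob_space "U n" by (rule U)
    have "\<bar>A n \<omega>\<bar> \<le> (\<integral>V. \<bar>h V \<omega>\<bar> \<partial>U n)" unfolding A_def by (rule integral_abs_bound)
    also have "\<dots> \<le> (\<integral>V. 1 \<partial>U n)"
      using h_bnd by (intro integral_mono integrable_bounded_finite[where B=1] U.finite_measure_axioms)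
        (auto simp: measurable_cong_sets[OF U(2) refl] h_def)
    finally show ?thesis by (simp add: U.prob_space)
  qed
  have FA: "(\<integral>\<omega>. F \<omega> * A n \<omega> \<partial>sphere_measure) \<le> B" if n: "real (Suc n) \<ge> 2 * R + 2" for n
  proof -
    interpret U: prob_space "U n" by (rule U)
    note [measurable_cong] = U(2)[of n]
    interpret pair_prob_space "U n" "sphere_measure :: 'a measure" ..
    have "(\<integral>\<omega>. F \<omega> * A n \<omega> \<partial>sphere_measure) = (\<integral>\<omega>. (\<integral>V. F \<omega> * h V \<omega> \<partial>U n) \<partial>sphere_measure)"
      by (simp add: A_def)
    also have "\<dots> = (\<integral>V. (\<integral>\<omega>. F \<omega> * h V \<omega> \<partial>sphere_measure) \<partial>U n)"
    proof (rule Fubini_integral)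
      show "integrable (U n \<Otimes>\<^sub>M sphere_measure) (\<lambda>(V, \<omega>). F \<omega> * h V \<omega>)"
      proof (rule P.integrable_const_bound[where B=1])
        show "AE p in U n \<Otimes>\<^sub>M sphere_measure. norm (case p of (V, \<omega>) \<Rightarrow> F \<omega> * h V \<omega>) \<le> 1"
          using Fh by (intro AE_I2) auto
        show "(\<lambda>(V, \<omega>). F \<omega> * h V \<omega>) \<in> borel_measurable (U n \<Otimes>\<^sub>M sphere_measure)"
          using hmeas' by (simp only: case_prod_beta' measurable_cong_sets[OF sets_pair_measure_cong[OF U(2) sets_sphere_measure] refl])
      qed
    qed
    also have "\<dots> \<le> (\<integral>V. B \<partial>U n)"
    proof (rule integral_mono_AE)
      show "integrable (U n) (\<lambda>V. \<integral>\<omega>. F \<omega> * h V \<omega> \<partial>sphere_measure)"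
      proof (rule U.integrable_const_bound[where B=1])
        show "AE V in U n. norm (\<integral>\<omega>. F \<omega> * h V \<omega> \<partial>sphere_measure) \<le> 1"
        proof (intro AE_I2)
          fix V
          have "\<bar>\<integral>\<omega>. F \<omega> * h V \<omega> \<partial>sphere_measure\<bar> \<le> (\<integral>\<omega>. \<bar>F \<omega> * h V \<omega>\<bar> \<partial>sphere_measure)" by (rule integral_abs_bound)
          also have "\<dots> \<le> (\<integral>\<omega>. 1 \<partial>(sphere_measure :: 'a measure))"
            using Fh by (intro integral_mono integrable_sphere[where B=1]) auto
          finally show "norm (\<integral>\<omega>. F \<omega> * h V \<omega> \<partial>sphere_measure) \<le> 1" by (simp add: sphere.prob_space)
        qed
        have "(\<lambda>(V, \<omega>). F \<omega> * h V \<omega>) \<in> borel_measurable (U n \<Otimes>\<^sub>M sphere_measure)"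
          using hmeas' by (simp only: case_prod_beta' measurable_cong_sets[OF sets_pair_measure_cong[OF U(2) sets_sphere_measure] refl])
        then show "(\<lambda>V. \<integral>\<omega>. F \<omega> * h V \<omega> \<partial>sphere_measure) \<in> borel_measurable (U n)"
          by (rule sphere.borel_measurable_lebesgue_integral)
      qed
      show "AE V in U n. (\<integral>\<omega>. F \<omega> * h V \<omega> \<partial>sphere_measure) \<le> B"
        unfolding U_def using n by (intro AE_uniform_measureI AE_I2 impI bound) auto
    qed simp
    finally show ?thesis by (simp add: U.prob_space)
  qed
  \<comment> \<open>Only the \<open>M\<close> diagonal terms of the double sum survive, and
    \<open>M / M\<^sup>2 = 1 / M\<close>. This orthogonality yields the factor \<open>M\<close>
    where bounding \<open>\<mu>\<close> as one component of a mixture of weight \<open>1 / M\<close>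
    would give \<open>M\<^sup>2\<close>.\<close>
  have "(\<lambda>n. \<integral>\<omega>. F \<omega> * A n \<omega> \<partial>sphere_measure) \<longlonglongrightarrow> (\<integral>\<omega>. F \<omega> * (1 / real M) \<partial>sphere_measure)"
  proof (rule integral_dominated_convergence[where w="\<lambda>_. 1"])
    show "AE \<omega> in sphere_measure. (\<lambda>n. F \<omega> * A n \<omega>) \<longlonglongrightarrow> F \<omega> * (1 / real M)"
      using AE_sphere_inner_neq[OF e]
    proof eventually_elim
      case (elim \<omega>)
      have t: "e \<bullet> (r *\<^sub>R \<omega>) \<noteq> 0" using elim r by (simp add: inner_commute)
      have "(\<lambda>n. A n \<omega>) \<longlonglongrightarrow> (\<Sum>j<M. \<Sum>l<M. if (real j - real l) * (e \<bullet> (r *\<^sub>R \<omega>)) = 0 then 1 else 0) / (real M)\<^sup>2"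
        unfolding A_eq U_def by (intro tendsto_divide tendsto_sum uniform_cos_average_tendsto tendsto_const) (use M in auto)
      also have "(\<Sum>j<M. \<Sum>l<M. if (real j - real l) * (e \<bullet> (r *\<^sub>R \<omega>)) = 0 then 1 else 0) = real M"
        using t by (simp add: sum.delta)
      also have "real M / (real M)\<^sup>2 = 1 / real M" by (simp add: power2_eq_square)
      finally show ?case by (intro tendsto_mult tendsto_const)
    qed
    show "AE \<omega> in sphere_measure. norm (F \<omega> * A n \<omega>) \<le> 1" for n
      using F_bnd A_bnd by (intro AE_I2) (auto simp: abs_mult intro!: mult_le_one)
    show "(\<lambda>\<omega>. F \<omega> * (1 / real M)) \<in> borel_measurable sphere_measure"
      "(\<lambda>\<omega>. F \<omega> * A n \<omega>) \<in> borel_measurable sphere_measure" for n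
      unfolding measurable_cong_sets[OF sets_sphere_measure refl] by measurable
  qed simp
  moreover have "eventually (\<lambda>n. (\<integral>\<omega>. F \<omega> * A n \<omega> \<partial>sphere_measure) \<le> B) sequentially"
  proof -
    obtain N where "2 * R + 2 \<le> real N" using real_arch_simple by blast
    then show ?thesis by (intro eventually_sequentiallyI[of N] FA) simp
  qed
  ultimately have "(\<integral>\<omega>. F \<omega> * (1 / real M) \<partial>sphere_measure) \<le> B"
    by (rule tendsto_upperbound) simp
  also have "(\<integral>\<omega>. F \<omega> * (1 / real M) \<partial>sphere_measure) = sphere_avg \<mu> r / real M"
    by (simp add: sphere_avg_def F_def)
  finally show ?thesis using M by (simp add: field_simps)
qed

text \<open>\<open>\<nu>\<close> is \<open>\<mu>\<close> convolved with the uniform law on a ball of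
  radius comparable to \<open>1 / r\<close>. Above that scale
  \<open>(r * \<rho>) powr (s0 - s)\<close> is at least 1 and pays for the larger exponent; below it
  \<open>\<nu>\<close> has bounded density and \<open>s0 \<le> DIM('a)\<close> suffices. At
  frequency \<open>r\<close> the transform of the smoothing law stays at least 1/2, whence the
  factor 4.\<close>

lemma smoothing_bound:
  fixes \<mu> :: "'a::euclidean_space measure" and s s0 :: real
  assumes mu: "borel_prob \<mu>" and supp: "measure \<mu> (ball 0 R) = 1" "R > 0"
    and s: "0 \<le> s" "s \<le> s0" "s0 \<le> real DIM('a)" and r: "r \<ge> 1" and c: "c \<ge> 0"
    and frost: "\<And>x \<rho>. \<rho> > 0 \<Longrightarrow> measure \<mu> (ball x \<rho>) \<le> c * \<rho> powr s"
  obtains \<nu> :: "'a measure" where "borel_prob \<nu>" "measure \<nu> (ball 0 (R + 1)) = 1"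
    "\<And>x \<rho>. \<rho> > 0 \<Longrightarrow> measure \<nu> (ball x \<rho>) \<le> (12 ^ DIM('a) * c * r powr (s0 - s)) * \<rho> powr s0"
    "sphere_avg \<mu> r \<le> 4 * sphere_avg \<nu> r"
proof -
  interpret mu: prob_space \<mu> using mu by simp
  let ?d = "DIM('a)"
  \<comment> \<open>With this radius the phases at frequency \<open>r\<close> are at most
    \<open>2 * pi * \<delta> * r = pi / 3\<close>, whose cosine is 1/2.\<close>
  define \<delta> where "\<delta> = 1 / (6 * r)"
  have \<delta>: "\<delta> > 0" "\<delta> \<le> 1" "\<delta> < 1 / r" using r by (auto simp: \<delta>_def field_simps)
  define U where "U = uniform_measure lborel (ball (0::'a) \<delta>)"
  have ball_em: "emeasure lborel (ball x t) = ennreal (t ^ ?d) * emeasure lborel (ball (0::'a) 1)" if "t > 0" for x :: 'a and t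
    by (rule emeasure_lborel_ball_scale[OF that])
  have ball_meas: "measure lborel (ball x t) = t ^ ?d * measure lborel (ball (0::'a) 1)" if "t > 0" for x :: 'a and t
    using ball_em[OF that, of x] that by (simp add: measure_def enn2real_mult)
  have b1: "measure lborel (ball (0::'a) 1) > 0"
    using emeasure_unit_ball[where 'a='a] by (simp add: measure_def enn2real_positive_iff less_top zero_less_iff_neq_zero)
  have emU: "emeasure lborel (ball (0::'a) \<delta>) \<noteq> 0" "emeasure lborel (ball (0::'a) \<delta>) \<noteq> \<infinity>"
    using ball_em[of \<delta> 0] \<delta> emeasure_unit_ball[where 'a='a] by (auto simp: ennreal_mult_eq_top_iff)
  have U: "borel_prob U" unfolding U_def using emU by (auto intro!: prob_space_uniform_measure)
  interpret U: prob_space U using U by simp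
  have U_le: "measure U A \<le> measure lborel A / (\<delta> ^ ?d * measure lborel (ball (0::'a) 1))"
    if A: "A \<in> sets borel" "emeasure lborel A < \<infinity>" for A
  proof -
    have "measure U A = measure lborel (ball 0 \<delta> \<inter> A) / measure lborel (ball (0::'a) \<delta>)"
      unfolding U_def using A emU by (intro measure_uniform_measure) auto
    also have "\<dots> \<le> measure lborel A / measure lborel (ball (0::'a) \<delta>)"
      using A by (intro divide_right_mono measure_mono_fmeasurable) (auto simp: fmeasurable_def)
    finally show ?thesis using ball_meas[OF \<delta>(1), of 0] by simp
  qed
  have aeU: "AE u in U. norm u < \<delta>"
    unfolding U_def by (intro AE_uniform_measureI) auto
  define \<nu> where "\<nu> = conv \<mu> U"
  have nu: "borel_prob \<nu>" unfolding \<nu>_def by (rule borel_prob_conv[OF mu U])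
  interpret nu: prob_space \<nu> using nu by simp
  have vb: "(\<lambda>x'. x' + u) -` ball x \<rho> = ball (x - u) \<rho>" "(\<lambda>u. u' + u) -` ball x \<rho> = ball (x - u') \<rho>" for u u' x :: 'a and \<rho>
    by (auto simp: dist_norm algebra_simps)
  have meas_shift: "(\<lambda>u. measure \<mu>' (ball (x - u) \<rho>)) \<in> borel_measurable borel"
    if "borel_prob \<mu>'" for \<mu>' :: "'a measure" and x :: 'a and \<rho>
  proof -
    interpret m: prob_space \<mu>' using that by simp
    have "(\<lambda>u. \<integral>z. indicat_real (ball (x - u) \<rho>) z \<partial>\<mu>') \<in> borel_measurable borel"
    proof (rule m.borel_measurable_lebesgue_integral)
      have "{p :: 'a \<times> 'a. dist (x - fst p) (snd p) < \<rho>} \<in> sets (borel \<Otimes>\<^sub>M borel)"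
        unfolding borel_prod by (intro borel_open open_Collect_less continuous_intros)
      moreover have "(\<lambda>(u, z). indicat_real (ball (x - u) \<rho>) z) = indicat_real {p. dist (x - fst p) (snd p) < \<rho>}"
        by (auto simp: indicator_def fun_eq_iff)
      ultimately have "(\<lambda>(u, z). indicat_real (ball (x - u) \<rho>) z) \<in> borel_measurable (borel \<Otimes>\<^sub>M borel)" by simp
      then show "(\<lambda>(u, z). indicat_real (ball (x - u) \<rho>) z) \<in> borel_measurable (borel \<Otimes>\<^sub>M \<mu>')"
        by (simp only: measurable_cong_sets[OF sets_pair_measure_cong[OF refl borel_probD(3)[OF that]] refl])
    qed
    then show ?thesis by (simp add: borel_probD(3)[OF that])
  qed
  have nu_mu: "measure \<nu> (ball x \<rho>) = (\<integral>u. measure \<mu> (ball (x - u) \<rho>) \<partial>U)" for x \<rho>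
    unfolding \<nu>_def by (subst measure_conv(1)[OF mu U]) (auto simp: vb)
  have nu_U: "measure \<nu> (ball x \<rho>) = (\<integral>z. measure U (ball (x - z) \<rho>) \<partial>\<mu>)" for x \<rho>
    unfolding \<nu>_def by (subst measure_conv(2)[OF mu U]) (auto simp: vb)
  show thesis
  proof (rule that[OF nu])
    have "AE u in U. measure \<mu> (ball (0 - u) (R + 1)) = 1"
      using aeU
    proof eventually_elim
      case (elim u)
      have "ball 0 R \<subseteq> ball (0 - u) (R + 1)"
      proof
        fix z :: 'a assume "z \<in> ball 0 R"
        then show "z \<in> ball (0 - u) (R + 1)"
          using norm_triangle_ineq[of z u] elim \<delta>(2) by (simp add: dist_norm norm_minus_commute add.commute)
      qed
      then have "measure \<mu> (ball 0 R) \<le> measure \<mu> (ball (0 - u) (R + 1))"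
        by (intro mu.finite_measure_mono) (auto simp: borel_probD(3)[OF mu])
      then show ?case using supp(1) mu.prob_le_1[of "ball (0 - u) (R + 1)"] by linarith
    qed
    then have "(\<integral>u. measure \<mu> (ball (0 - u) (R + 1)) \<partial>U) = (\<integral>u. 1 \<partial>U)"
      using meas_shift[OF mu, of 0] by (intro integral_cong_AE) (auto simp: measurable_cong_sets[OF borel_probD(3)[OF U] refl])
    then show "measure \<nu> (ball 0 (R + 1)) = 1" unfolding nu_mu by (simp add: U.prob_space)
  next
    fix x :: 'a and \<rho> :: real assume \<rho>: "\<rho> > 0"
    have r0: "r powr (s0 - s) > 0" using r by simp
    show "measure \<nu> (ball x \<rho>) \<le> (12 ^ ?d * c * r powr (s0 - s)) * \<rho> powr s0"
    proof (cases "1 / r \<le> \<rho>")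
      case True
      have "measure \<nu> (ball x \<rho>) \<le> (\<integral>u. c * \<rho> powr s \<partial>U)"
        unfolding nu_mu
      proof (rule integral_mono)
        show "integrable U (\<lambda>u. measure \<mu> (ball (x - u) \<rho>))"
          using meas_shift[OF mu, of x \<rho>] by (intro integrable_bounded_finite[where B=1] U.finite_measure_axioms)
            (auto simp: measurable_cong_sets[OF borel_probD(3)[OF U] refl])
      qed (use frost[OF \<rho>] in auto)
      also have "\<dots> = c * \<rho> powr s * 1" by (simp add: U.prob_space)
      also have "\<dots> \<le> c * \<rho> powr s * (12 ^ ?d * (r * \<rho>) powr (s0 - s))"
      proof (intro mult_left_mono)
        have "1 \<le> r * \<rho>" using True r by (simp add: field_simps)
        then have "1 \<le> (r * \<rho>) powr (s0 - s)" using s by (intro ge_one_powr_ge_zero) auto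
        moreover have "1 \<le> (12::real) ^ ?d" by simp
        ultimately show "1 \<le> 12 ^ ?d * (r * \<rho>) powr (s0 - s)" using mult_mono[of 1 "12 ^ ?d" 1 "(r * \<rho>) powr (s0 - s)"] by simp
      qed (use c in auto)
      also have "\<dots> = (12 ^ ?d * c * r powr (s0 - s)) * (\<rho> powr s * \<rho> powr (s0 - s))"
        using r \<rho> by (simp add: powr_mult)
      also have "\<rho> powr s * \<rho> powr (s0 - s) = \<rho> powr s0" by (simp add: powr_add[symmetric])
      finally show ?thesis .
    next
      case False
      then have \<rho>r: "\<rho> * r < 1" using r by (simp add: field_simps)
      define q where "q = (\<rho> / \<delta>) ^ ?d"
      have q: "q \<ge> 0" using \<rho> \<delta> by (simp add: q_def)
      have pt: "AE z in \<mu>. measure U (ball (x - z) \<rho>) \<le> q * indicat_real (ball x (2 / r)) z"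
      proof (intro AE_I2)
        fix z
        show "measure U (ball (x - z) \<rho>) \<le> q * indicat_real (ball x (2 / r)) z"
        proof (cases "z \<in> ball x (2 / r)")
          case True
          have "measure U (ball (x - z) \<rho>) \<le> measure lborel (ball (x - z) \<rho>) / (\<delta> ^ ?d * measure lborel (ball (0::'a) 1))"
            by (rule U_le[OF _ emeasure_lborel_ball_finite]) simp
          also have "\<dots> = q"
            using ball_meas[OF \<rho>, of "x - z"] b1 by (simp add: q_def power_divide)
          finally show ?thesis using True by simp
        next
          case far: False
          have "measure U (ball (x - z) \<rho>) = 0"
          proof -
            have "AE u in U. u \<notin> ball (x - z) \<rho>"
              using aeU
            proof eventually_elim
              case (elim u)
              have "2 / r \<le> norm (x - z)" using far by (simp add: dist_norm)
              moreover have "norm (x - z) \<le> norm (x - z - u) + norm u" using norm_triangle_ineq[of "x - z - u" u] by simp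
              moreover have "\<rho> + \<delta> < 2 / r" using \<delta>(3) False by (simp add: not_le field_simps)
              ultimately show ?case using elim by (simp add: dist_norm)
            qed
            then show ?thesis by (subst U.prob_eq_0) (auto simp: borel_probD(3)[OF U])
          qed
          then show ?thesis using q by simp
        qed
      qed
      have "measure \<nu> (ball x \<rho>) \<le> (\<integral>z. q * indicat_real (ball x (2 / r)) z \<partial>\<mu>)"
        unfolding nu_U
      proof (rule integral_mono_AE[OF _ _ pt])
        show "integrable \<mu> (\<lambda>z. measure U (ball (x - z) \<rho>))"
          using meas_shift[OF U, of x \<rho>] by (intro integrable_bounded_finite[where B=1] mu.finite_measure_axioms)
            (auto simp: measurable_cong_sets[OF borel_probD(3)[OF mu] refl])
        show "integrable \<mu> (\<lambda>z. q * indicat_real (ball x (2 / r)) z)"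
          by (intro integrable_mult_right integrable_bounded_finite[where B=1] mu.finite_measure_axioms)
            (auto simp: measurable_cong_sets[OF borel_probD(3)[OF mu] refl] indicator_def)
      qed
      also have "\<dots> = q * measure \<mu> (ball x (2 / r))" by (simp add: borel_probD(3)[OF mu])
      also have "\<dots> \<le> q * (c * (2 / r) powr s)" using r q by (intro mult_left_mono frost) auto
      also have "q = 6 ^ ?d * (\<rho> * r) ^ ?d" unfolding q_def \<delta>_def by (simp add: power_mult_distrib mult_ac)
      \<comment> \<open>Since \<open>\<rho> * r < 1\<close>, lowering the exponent from the
        dimension to \<open>s0\<close> increases the power. The constant 12 is \<open>6 * 2\<close>:
        6 from \<open>\<delta>\<close>, and \<open>2 ^ ?d\<close> dominates the
        \<open>2 powr s\<close> of the doubled radius.\<close>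
      also have "6 ^ ?d * (\<rho> * r) ^ ?d * (c * (2 / r) powr s) \<le> 6 ^ ?d * (\<rho> * r) powr s0 * (c * (2 ^ ?d * r powr (- s)))"
      proof (intro mult_mono)
        have "(\<rho> * r) powr (real ?d) \<le> (\<rho> * r) powr s0" using \<rho> r \<rho>r s by (intro powr_mono') auto
        then show "(\<rho> * r) ^ ?d \<le> (\<rho> * r) powr s0" using \<rho> r by (simp add: powr_realpow)
        have "(2::real) powr s \<le> 2 powr (real ?d)" using s by (intro powr_mono) auto
        then have "2 powr s * r powr (- s) \<le> 2 ^ ?d * r powr (- s)" by (intro mult_right_mono) (auto simp: powr_realpow)
        then show "(2 / r) powr s \<le> 2 ^ ?d * r powr (- s)" using r by (simp add: powr_divide powr_minus field_simps)
      qed (use \<rho> r c in auto)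
      also have "\<dots> = ((6 * 2) ^ ?d) * c * (r powr s0 * r powr (- s)) * \<rho> powr s0"
        unfolding power_mult_distrib using \<rho> r by (simp add: powr_mult mult_ac)
      also have "r powr s0 * r powr (- s) = r powr (s0 - s)" by (simp add: powr_add[symmetric])
      finally show ?thesis by simp
    qed
  next
    have half: "1/2 \<le> cmod (fourier_measure U (r *\<^sub>R \<omega>))" if \<omega>: "norm \<omega> = 1" for \<omega>
    proof -
      have "1/2 = (\<integral>u. (1/2 :: real) \<partial>U)" by (simp add: U.prob_space)
      also have "\<dots> \<le> (\<integral>u. cos (2 * pi * (u \<bullet> (r *\<^sub>R \<omega>))) \<partial>U)"
      proof (rule integral_mono_AE)
        show "AE u in U. 1/2 \<le> cos (2 * pi * (u \<bullet> (r *\<^sub>R \<omega>)))"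
          using aeU
        proof eventually_elim
          case (elim u)
          have "\<bar>u \<bullet> (r *\<^sub>R \<omega>)\<bar> \<le> norm u * norm (r *\<^sub>R \<omega>)" by (rule Cauchy_Schwarz_ineq2)
          also have "\<dots> \<le> \<delta> * r" using \<omega> r elim by (simp add: mult_right_mono)
          also have "\<dots> = 1/6" using r by (simp add: \<delta>_def)
          finally have "\<bar>u \<bullet> (r *\<^sub>R \<omega>)\<bar> \<le> 1/6" .
          then have "\<bar>2 * pi * (u \<bullet> (r *\<^sub>R \<omega>))\<bar> \<le> pi / 3" by (simp add: abs_mult)
          then have "cos (pi / 3) \<le> cos \<bar>2 * pi * (u \<bullet> (r *\<^sub>R \<omega>))\<bar>" by (intro cos_monotone_0_pi_le) auto
          then show ?case by (simp add: cos_60)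
        qed
        show "integrable U (\<lambda>u. cos (2 * pi * (u \<bullet> (r *\<^sub>R \<omega>))))"
          by (intro integrable_bounded_finite[where B=1] U.finite_measure_axioms) (auto simp: measurable_cong_sets[OF borel_probD(3)[OF U] refl])
      qed simp
      also have "\<dots> = Re (ft U (r *\<^sub>R \<omega>))" by (simp add: ft_def fcos_def)
      also have "\<dots> \<le> cmod (ft U (r *\<^sub>R \<omega>))" by (rule complex_Re_le_cmod)
      finally show ?thesis by (simp add: cmod_ft[OF U])
    qed
    have "sphere_avg \<mu> r \<le> (\<integral>\<omega>. 4 * (cmod (fourier_measure \<nu> (r *\<^sub>R \<omega>)))\<^sup>2 \<partial>sphere_measure)"
      unfolding sphere_avg_def
    proof (rule integral_mono_AE)
      show "integrable sphere_measure (\<lambda>\<omega>. (cmod (fourier_measure \<mu> (r *\<^sub>R \<omega>)))\<^sup>2)"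
        using integrable_cmod_ft[OF mu] by (simp add: cmod_ft[OF mu])
      show "integrable sphere_measure (\<lambda>\<omega>. 4 * (cmod (fourier_measure \<nu> (r *\<^sub>R \<omega>)))\<^sup>2)"
        using integrable_cmod_ft[OF nu] by (simp add: cmod_ft[OF nu])
      show "AE \<omega> in sphere_measure. (cmod (fourier_measure \<mu> (r *\<^sub>R \<omega>)))\<^sup>2 \<le> 4 * (cmod (fourier_measure \<nu> (r *\<^sub>R \<omega>)))\<^sup>2"
        using AE_sphere_measure
      proof eventually_elim
        case (elim \<omega>)
        have "cmod (fourier_measure \<mu> (r *\<^sub>R \<omega>)) * 1 \<le> cmod (fourier_measure \<mu> (r *\<^sub>R \<omega>)) * (2 * cmod (fourier_measure U (r *\<^sub>R \<omega>)))"
          using half[OF elim] by (intro mult_left_mono) auto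
        then have "cmod (fourier_measure \<mu> (r *\<^sub>R \<omega>)) \<le> 2 * cmod (fourier_measure \<nu> (r *\<^sub>R \<omega>))"
          unfolding \<nu>_def fourier_conv[OF mu U] by (simp add: norm_mult)
        then have "(cmod (fourier_measure \<mu> (r *\<^sub>R \<omega>)))\<^sup>2 \<le> (2 * cmod (fourier_measure \<nu> (r *\<^sub>R \<omega>)))\<^sup>2" by (intro power_mono) auto
        then show ?case by (simp add: power_mult_distrib)
      qed
    qed
    then show "sphere_avg \<mu> r \<le> 4 * sphere_avg \<nu> r" by (simp add: sphere_avg_def)
  qed
qed

text \<open>The measures with Frostman constant 1 at exponent \<open>s0\<close> are closed under
  \<open>gmix\<close>, so they obey a uniform bound. A general measure is first smoothed, which
  raises the exponent to \<open>s0\<close> and the constant to \<open>k\<close>, and then replaced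
  by averages of about \<open>k\<close> translates, which lie in that class.\<close>

theorem sphere_avg_frostman_bound:
  fixes \<beta> :: "real \<Rightarrow> real" and s s0 :: real
  assumes est: "spherical_average_estimate TYPE('a::euclidean_space) \<beta>"
    and s: "0 \<le> s" "s \<le> s0" "s0 \<le> real DIM('a)" and \<epsilon>: "\<epsilon> > 0"
  obtains C where "C > 0"
    "\<And>(\<mu> :: 'a measure) R c (r :: real). borel_prob \<mu> \<Longrightarrow> R > 0 \<Longrightarrow> measure \<mu> (ball 0 R) = 1 \<Longrightarrow> c \<ge> 1 \<Longrightarrow> r \<ge> 1 \<Longrightarrow>
      (\<And>x \<rho>. \<rho> > 0 \<Longrightarrow> measure \<mu> (ball x \<rho>) \<le> c * \<rho> powr s) \<Longrightarrow>
      sphere_avg \<mu> r \<le> C * c * r powr (s0 - s - \<beta> s0 + \<epsilon>)"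
proof -
  define K where "K = {\<nu> :: 'a measure. borel_prob \<nu> \<and> (\<forall>x. \<forall>\<rho>>0. measure \<nu> (ball x \<rho>) \<le> \<rho> powr s0)}"
  define \<phi> where "\<phi> r = r powr (- \<beta> s0 + \<epsilon>)" for r :: real
  have "\<exists>C. \<forall>\<mu>\<in>K. \<forall>r\<ge>1. sphere_avg \<mu> r \<le> C * \<phi> r"
  proof (rule uniform_sphere_bound)
    show "borel_prob \<mu>" if "\<mu> \<in> K" for \<mu> using that by (simp add: K_def)
    show "gmix y \<in> K" if y: "\<And>n. y n \<in> K" for y
    proof -
      have yp: "borel_prob (y n)" for n using y[of n] by (simp add: K_def)
      have "measure (gmix y) (ball x \<rho>) \<le> \<rho> powr s0" if "\<rho> > 0" for x \<rho>
        using y that by (intro measure_gmix_le[of y, OF yp]) (auto simp: K_def)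
      then show ?thesis using borel_prob_gmix[of y, OF yp] by (simp add: K_def)
    qed
    show "\<phi> r > 0" if "r \<ge> 1" for r using that by (simp add: \<phi>_def)
    fix \<mu> assume "\<mu> \<in> K"
    then have \<mu>: "prob_space \<mu> \<and> sets \<mu> = sets borel \<and> (\<exists>C>0. \<forall>x. \<forall>r>0. measure \<mu> (ball x r) \<le> C * r powr s0)"
      by (auto simp: K_def intro!: exI[of _ 1])
    show "\<exists>C. \<forall>r\<ge>1. sphere_avg \<mu> r \<le> C * \<phi> r"
      using est[unfolded spherical_average_estimate_def, rule_format, OF \<mu> \<epsilon>]
      unfolding sphere_avg_def \<phi>_def by blast
  qed
  then obtain C where C: "\<And>\<mu> r. \<mu> \<in> K \<Longrightarrow> r \<ge> 1 \<Longrightarrow> sphere_avg \<mu> r \<le> C * \<phi> r" by blast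
  define C' where "C' = max C 1"
  have C': "\<mu> \<in> K \<Longrightarrow> r \<ge> 1 \<Longrightarrow> sphere_avg \<mu> r \<le> C' * \<phi> r" "C' > 0" for \<mu> r
  proof -
    assume *: "\<mu> \<in> K" "r \<ge> 1"
    have "C * \<phi> r \<le> C' * \<phi> r" using * by (intro mult_right_mono) (auto simp: C'_def \<phi>_def)
    then show "sphere_avg \<mu> r \<le> C' * \<phi> r" using C[OF *] by simp
  qed (simp add: C'_def)
  show thesis
  proof (rule that[of "8 * 12 ^ DIM('a) * C'"])
    show "8 * 12 ^ DIM('a) * C' > 0" using C'(2) by simp
    fix \<mu> :: "'a measure" and R c r :: real
    assume mu: "borel_prob \<mu>" and R: "R > 0" "measure \<mu> (ball 0 R) = 1" and c: "c \<ge> 1" and r: "r \<ge> 1"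
      and frost: "\<And>x \<rho>. \<rho> > 0 \<Longrightarrow> measure \<mu> (ball x \<rho>) \<le> c * \<rho> powr s"
    define k where "k = 12 ^ DIM('a) * c * r powr (s0 - s)"
    have c0: "c \<ge> 0" using c by simp
    obtain \<nu> :: "'a measure" where nu: "borel_prob \<nu>" "measure \<nu> (ball 0 (R + 1)) = 1"
      "\<And>x \<rho>. \<rho> > 0 \<Longrightarrow> measure \<nu> (ball x \<rho>) \<le> k * \<rho> powr s0" "sphere_avg \<mu> r \<le> 4 * sphere_avg \<nu> r"
    proof (rule smoothing_bound[OF mu R(2,1) s r c0 frost])
      fix \<nu> :: "'a measure"
      assume a: "borel_prob \<nu>" "measure \<nu> (ball 0 (R + 1)) = 1"
        "\<And>x \<rho>. \<rho> > 0 \<Longrightarrow> measure \<nu> (ball x \<rho>) \<le> (12 ^ DIM('a) * c * r powr (s0 - s)) * \<rho> powr s0"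
        "sphere_avg \<mu> r \<le> 4 * sphere_avg \<nu> r"
      show thesis by (rule that[OF a(1,2) _ a(4)]) (unfold k_def, rule a(3))
    qed
    have "1 \<le> r powr (s0 - s)" using r s by (intro ge_one_powr_ge_zero) auto
    moreover have "1 \<le> 12 ^ DIM('a) * c" using c mult_mono[of 1 "12 ^ DIM('a)" 1 c] by simp
    ultimately have k: "k \<ge> 1" unfolding k_def using mult_mono[of 1 "12 ^ DIM('a) * c" 1 "r powr (s0 - s)"] by simp
    \<comment> \<open>Rounding up at most doubles \<open>k\<close>, because
      \<open>k \<ge> 1\<close>. The constant 8 combines this with the factor 4 of the
      smoothing.\<close>
    define M where "M = nat \<lceil>k\<rceil>"
    have M: "M \<ge> 1" "k \<le> real M" "real M \<le> 2 * k" using k by (auto simp: M_def) linarith+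
    have "sphere_avg \<nu> r \<le> real M * (C' * \<phi> r)"
    proof (rule translates_bound[OF nu(1,2)])
      show "0 < R + 1" "0 \<le> s0" "1 \<le> M" "0 < r" using R s M r by auto
      show "measure \<nu> (ball x \<rho>) \<le> real M * \<rho> powr s0" if "\<rho> > 0" for x \<rho>
        using nu(3)[OF that, of x] mult_right_mono[OF M(2), of "\<rho> powr s0"] by simp
      show "sphere_avg \<nu>' r \<le> C' * \<phi> r" if "borel_prob \<nu>'" "\<And>x \<rho>. \<rho> > 0 \<Longrightarrow> measure \<nu>' (ball x \<rho>) \<le> \<rho> powr s0" for \<nu>' :: "'a measure"
        using that by (intro C'(1) r) (simp add: K_def)
    qed
    also have "\<dots> \<le> 2 * k * (C' * \<phi> r)" using M(3) C'(2) by (intro mult_right_mono) (auto simp: \<phi>_def)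
    finally have "sphere_avg \<mu> r \<le> 4 * (2 * k * (C' * \<phi> r))" using nu(4) by simp
    also have "\<dots> = 8 * 12 ^ DIM('a) * C' * c * (r powr (s0 - s) * r powr (- \<beta> s0 + \<epsilon>))"
      by (simp add: k_def \<phi>_def)
    also have "r powr (s0 - s) * r powr (- \<beta> s0 + \<epsilon>) = r powr (s0 - s - \<beta> s0 + \<epsilon>)"
      by (simp add: powr_add[symmetric] algebra_simps)
    finally show "sphere_avg \<mu> r \<le> 8 * 12 ^ DIM('a) * C' * c * r powr (s0 - s - \<beta> s0 + \<epsilon>)" .
  qed
qed

subsection \<open>Pinned distances and chains\<close>

text \<open>Cut into unit shells of \<open>T * norm (x - y)\<close>: on the \<open>k\<close>-th
  shell the Gaussian is at most \<open>exp (- k)\<close>, which beats the growth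
  \<open>(k + 1) powr s\<close> of the mass of balls.\<close>

lemma frostman_gauss:
  fixes \<mu> :: "'a::euclidean_space measure"
  assumes mu: "borel_prob \<mu>" and s: "s > 0"
    and frost: "\<And>x \<rho>. \<rho> > 0 \<Longrightarrow> measure \<mu> (ball x \<rho>) \<le> c * \<rho> powr s"
  obtains C where "C \<ge> 0"
    "\<And>x T. T > 0 \<Longrightarrow> (\<integral>\<^sup>+y. ennreal (exp (- pi * T\<^sup>2 * (norm (x - y))\<^sup>2)) \<partial>\<mu>) \<le> ennreal (C * T powr (- s))"
proof -
  interpret prob_space \<mu> using mu by simp
  note [measurable_cong] = borel_probD(3)[OF mu]
  have c: "c \<ge> 0" using order_trans[OF measure_nonneg frost[of 1 0]] by simp
  define g where "g k = exp (- real k) * (c * (real k + 1) powr s)" for k :: nat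
  have g0: "g k \<ge> 0" for k using c by (simp add: g_def)
  have sum: "summable g"
  proof -
    have "(\<lambda>k. exp (- real k) * (real k + 1) powr s) \<in> O(\<lambda>k. exp (- real k / 2))" by real_asymp
    moreover have "summable (\<lambda>k. norm (exp (- real k / 2)))"
    proof -
      have "exp (- real k / 2) = exp (- 1 / 2) ^ k" for k by (simp add: exp_of_nat_mult[symmetric])
      then show ?thesis by (simp add: summable_geometric)
    qed
    ultimately have "summable (\<lambda>k. exp (- real k) * (real k + 1) powr s)" by (rule summable_comparison_test_bigo[rotated])
    from summable_mult[OF this, of c] show ?thesis by (simp add: g_def[abs_def] mult_ac)
  qed
  show thesis
  proof (rule that[of "suminf g"])
    show "suminf g \<ge> 0" using sum g0 by (intro suminf_nonneg)
    fix x :: 'a and T :: real assume T: "T > 0"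
    have "(\<integral>\<^sup>+y. ennreal (exp (- pi * T\<^sup>2 * (norm (x - y))\<^sup>2)) \<partial>\<mu>)
      \<le> (\<integral>\<^sup>+y. (\<Sum>k. ennreal (exp (- real k)) * indicator (ball x ((real k + 1) / T)) y) \<partial>\<mu>)"
    proof (rule nn_integral_mono)
      fix y
      define \<rho> where "\<rho> = T * norm (x - y)"
      define k where "k = nat \<lfloor>\<rho>\<rfloor>"
      have \<rho>: "\<rho> \<ge> 0" using T by (simp add: \<rho>_def)
      have k: "real k \<le> \<rho>" "\<rho> < real k + 1" using \<rho> by (auto simp: k_def)
      have "real k \<le> (real k)\<^sup>2" by (cases k) (auto simp: power2_eq_square)
      also have "\<dots> \<le> \<rho>\<^sup>2" using k by (intro power_mono) auto
      also have "\<dots> \<le> pi * \<rho>\<^sup>2" using pi_ge_two by (simp add: mult_le_cancel_right1)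
      finally have "exp (- pi * T\<^sup>2 * (norm (x - y))\<^sup>2) \<le> exp (- real k)" by (simp add: \<rho>_def power_mult_distrib mult.assoc)
      moreover have "y \<in> ball x ((real k + 1) / T)" using k T by (simp add: \<rho>_def dist_norm field_simps)
      ultimately have "ennreal (exp (- pi * T\<^sup>2 * (norm (x - y))\<^sup>2)) \<le> ennreal (exp (- real k)) * indicator (ball x ((real k + 1) / T)) y"
        by (simp add: ennreal_leI)
      also have "\<dots> = (\<Sum>j\<in>{k}. ennreal (exp (- real j)) * indicator (ball x ((real j + 1) / T)) y)"
        by (simp only: sum.insert sum.empty finite.emptyI empty_iff not_False_eq_True add_0_right)
      also have "\<dots> \<le> (\<Sum>j. ennreal (exp (- real j)) * indicator (ball x ((real j + 1) / T)) y)"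
        by (intro sum_le_suminf) auto
      finally show "ennreal (exp (- pi * T\<^sup>2 * (norm (x - y))\<^sup>2)) \<le> (\<Sum>k. ennreal (exp (- real k)) * indicator (ball x ((real k + 1) / T)) y)" .
    qed
    also have "\<dots> = (\<Sum>k. \<integral>\<^sup>+y. ennreal (exp (- real k)) * indicator (ball x ((real k + 1) / T)) y \<partial>\<mu>)"
      by (rule nn_integral_suminf, unfold measurable_cong_sets[OF borel_probD(3)[OF mu] refl])
        (intro borel_measurable_times_ennreal borel_measurable_const borel_measurable_indicator borel_open open_ball)
    also have "\<dots> = (\<Sum>k. ennreal (exp (- real k)) * emeasure \<mu> (ball x ((real k + 1) / T)))"
      by (intro suminf_cong nn_integral_cmult_indicator) (simp add: borel_probD(3)[OF mu])
    also have "\<dots> \<le> (\<Sum>k. ennreal (g k * T powr (- s)))"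
    proof (rule suminf_le)
      fix k
      have "measure \<mu> (ball x ((real k + 1) / T)) \<le> c * ((real k + 1) / T) powr s" using T by (intro frost) auto
      also have "\<dots> = c * (real k + 1) powr s * T powr (- s)" using T by (simp add: powr_divide powr_minus field_simps)
      finally have "exp (- real k) * measure \<mu> (ball x ((real k + 1) / T)) \<le> g k * T powr (- s)"
        unfolding g_def mult.assoc by (intro mult_left_mono) auto
      then show "ennreal (exp (- real k)) * emeasure \<mu> (ball x ((real k + 1) / T)) \<le> ennreal (g k * T powr (- s))"
        by (simp add: emeasure_eq_measure ennreal_mult[symmetric] ennreal_leI)
    qed auto
    also have "\<dots> = ennreal (suminf g * T powr (- s))"
      using sum g0 by (subst suminf_ennreal_eq[OF _ sums_mult2[OF summable_sums[OF sum]]]) auto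
    finally show "(\<integral>\<^sup>+y. ennreal (exp (- pi * T\<^sup>2 * (norm (x - y))\<^sup>2)) \<partial>\<mu>) \<le> ennreal (suminf g * T powr (- s))" .
  qed
qed

text \<open>On the ball of radius \<open>T\<close> the Gaussian cutoff with
  \<open>a = 1 / T\<^sup>2\<close> is at least \<open>exp (- pi)\<close>. On the space side this
  cutoff is \<open>T ^ DIM('a)\<close> times a Gaussian of width \<open>1 / T\<close>, whose mass
  under \<open>\<mu>\<close> is of order \<open>T powr (- s)\<close>.\<close>

lemma frostman_energy:
  fixes \<mu> :: "'a::euclidean_space measure"
  assumes mu: "borel_prob \<mu>" and s: "s > 0"
    and frost: "\<And>x \<rho>. \<rho> > 0 \<Longrightarrow> measure \<mu> (ball x \<rho>) \<le> c * \<rho> powr s"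
  obtains C where "C \<ge> 0"
    "\<And>T. T \<ge> 1 \<Longrightarrow> (\<integral>\<^sup>+\<xi>. ennreal ((cmod (fourier_measure \<mu> \<xi>))\<^sup>2) * indicator (ball 0 T) \<xi> \<partial>lborel)
      \<le> ennreal (C * T powr (real DIM('a) - s))"
proof -
  let ?d = "DIM('a)"
  interpret prob_space \<mu> using mu by simp
  obtain C where C: "C \<ge> 0" "\<And>(x :: 'a) T. T > 0 \<Longrightarrow> (\<integral>\<^sup>+y. ennreal (exp (- pi * T\<^sup>2 * (norm (x - y))\<^sup>2)) \<partial>\<mu>) \<le> ennreal (C * T powr (- s))"
  proof (rule frostman_gauss[OF mu s frost])
    fix C assume "C \<ge> 0" "\<And>(x :: 'a) T. T > 0 \<Longrightarrow> (\<integral>\<^sup>+y. ennreal (exp (- pi * T\<^sup>2 * (norm (x - y))\<^sup>2)) \<partial>\<mu>) \<le> ennreal (C * T powr (- s))"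
    then show thesis by (rule that)
  qed
  show thesis
  proof (rule that[of "exp pi * C"])
    show "exp pi * C \<ge> 0" using C(1) by simp
    fix T :: real assume T: "T \<ge> 1"
    define a where "a = 1 / T\<^sup>2"
    have a: "a > 0" using T by (simp add: a_def)
    have "(\<integral>\<^sup>+\<xi>. ennreal ((cmod (fourier_measure \<mu> \<xi>))\<^sup>2) * indicator (ball 0 T) \<xi> \<partial>lborel)
      \<le> (\<integral>\<^sup>+\<xi>. ennreal (exp pi) * ennreal (exp (- pi * a * (norm \<xi>)\<^sup>2) * (cmod (fourier_measure \<mu> \<xi>))\<^sup>2) \<partial>lborel)"
    proof (rule nn_integral_mono)
      fix \<xi> :: 'a
      show "ennreal ((cmod (fourier_measure \<mu> \<xi>))\<^sup>2) * indicator (ball 0 T) \<xi>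
        \<le> ennreal (exp pi) * ennreal (exp (- pi * a * (norm \<xi>)\<^sup>2) * (cmod (fourier_measure \<mu> \<xi>))\<^sup>2)"
      proof (cases "norm \<xi> < T")
        case True
        have "(norm \<xi>)\<^sup>2 \<le> T\<^sup>2" using True by (intro power_mono) auto
        then have "a * (norm \<xi>)\<^sup>2 \<le> 1" using T by (simp add: a_def)
        then have "pi * (a * (norm \<xi>)\<^sup>2) \<le> pi * 1" by (intro mult_left_mono) auto
        then have "1 \<le> exp (pi + - pi * a * (norm \<xi>)\<^sup>2)" by simp
        then have "1 * (cmod (fourier_measure \<mu> \<xi>))\<^sup>2 \<le> (exp pi * exp (- pi * a * (norm \<xi>)\<^sup>2)) * (cmod (fourier_measure \<mu> \<xi>))\<^sup>2"
          unfolding exp_add by (intro mult_right_mono) auto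
        then show ?thesis using True by (simp add: ennreal_mult[symmetric] ennreal_leI mult.assoc)
      qed simp
    qed
    also have "\<dots> = ennreal (exp pi) * (\<integral>\<^sup>+\<xi>. ennreal (exp (- pi * a * (norm \<xi>)\<^sup>2) * (cmod (fourier_measure \<mu> \<xi>))\<^sup>2) \<partial>lborel)"
      by (rule nn_integral_cmult) (use borel_measurable_cmod_fourier[OF borel_probD(2,3)[OF mu]] in simp)
    also have "(\<integral>\<^sup>+\<xi>. ennreal (exp (- pi * a * (norm \<xi>)\<^sup>2) * (cmod (fourier_measure \<mu> \<xi>))\<^sup>2) \<partial>lborel)
      = (\<integral>\<^sup>+x. \<integral>\<^sup>+y. ennreal (exp (- pi * (norm (x - y))\<^sup>2 / a) / sqrt a ^ ?d) \<partial>\<mu> \<partial>\<mu>)"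
      by (rule gauss_energy[OF borel_probD(2,3)[OF mu] a])
    also have "\<dots> \<le> (\<integral>\<^sup>+x. ennreal (T ^ ?d) * ennreal (C * T powr (- s)) \<partial>\<mu>)"
    proof (rule nn_integral_mono)
      fix x :: 'a
      have "exp (- pi * (norm (x - y))\<^sup>2 / a) / sqrt a ^ ?d = T ^ ?d * exp (- pi * T\<^sup>2 * (norm (x - y))\<^sup>2)" for y
        using T by (simp add: a_def real_sqrt_divide power_divide mult_ac)
      then have "(\<integral>\<^sup>+y. ennreal (exp (- pi * (norm (x - y))\<^sup>2 / a) / sqrt a ^ ?d) \<partial>\<mu>)
        = ennreal (T ^ ?d) * (\<integral>\<^sup>+y. ennreal (exp (- pi * T\<^sup>2 * (norm (x - y))\<^sup>2)) \<partial>\<mu>)"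
        using T by (subst nn_integral_cmult[symmetric]) (auto simp: ennreal_mult measurable_cong_sets[OF borel_probD(3)[OF mu] refl])
      also have "\<dots> \<le> ennreal (T ^ ?d) * ennreal (C * T powr (- s))"
        using T by (intro mult_left_mono C(2)) auto
      finally show "(\<integral>\<^sup>+y. ennreal (exp (- pi * (norm (x - y))\<^sup>2 / a) / sqrt a ^ ?d) \<partial>\<mu>) \<le> ennreal (T ^ ?d) * ennreal (C * T powr (- s))" .
    qed
    also have "\<dots> = ennreal (T ^ ?d) * ennreal (C * T powr (- s))" by (simp add: emeasure_space_1)
    also have "ennreal (exp pi) * \<dots> = ennreal (exp pi * C * T powr (real ?d - s))"
      using T C(1) by (simp add: ennreal_mult[symmetric] powr_diff powr_realpow powr_minus field_simps)
    finally show "(\<integral>\<^sup>+\<xi>. ennreal ((cmod (fourier_measure \<mu> \<xi>))\<^sup>2) * indicator (ball 0 T) \<xi> \<partial>lborel)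
      \<le> ennreal (exp pi * C * T powr (real ?d - s))" by (simp add: mult_left_mono)
  qed
qed

text \<open>On the dyadic shell between \<open>2 ^ k\<close> and \<open>2 ^ Suc k\<close> the weight
  is at most \<open>2 powr (- b * k)\<close>, so the growth hypothesis leaves a geometric series of
  ratio \<open>2 powr (a - b)\<close>.\<close>

lemma weighted_integral_finite:
  fixes f :: "'a::euclidean_space \<Rightarrow> ennreal"
  assumes [measurable]: "f \<in> borel_measurable borel"
    and growth: "\<And>T. T \<ge> 1 \<Longrightarrow> (\<integral>\<^sup>+\<xi>. f \<xi> * indicator (ball 0 T) \<xi> \<partial>lborel) \<le> ennreal (C * T powr a)"
    and C: "C \<ge> 0" and b: "b > a" "b \<ge> 0"
  shows "(\<integral>\<^sup>+\<xi>. ennreal (norm \<xi> powr (- b)) * indicator {\<xi>. 1 \<le> norm \<xi>} \<xi> * f \<xi> \<partial>lborel) < \<infinity>"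
proof -
  define q where "q = 2 powr (a - b)"
  have q: "0 < q" "q < 1" using b by (auto simp: q_def powr_less_one)
  have "(\<integral>\<^sup>+\<xi>. ennreal (norm \<xi> powr (- b)) * indicator {\<xi>. 1 \<le> norm \<xi>} \<xi> * f \<xi> \<partial>lborel)
    \<le> (\<integral>\<^sup>+\<xi>. (\<Sum>k. ennreal (2 powr (- b * real k)) * (f \<xi> * indicator (ball 0 (2 ^ Suc k)) \<xi>)) \<partial>lborel)"
  proof (rule nn_integral_mono)
    fix \<xi> :: 'a
    show "ennreal (norm \<xi> powr (- b)) * indicator {\<xi>. 1 \<le> norm \<xi>} \<xi> * f \<xi>
      \<le> (\<Sum>k. ennreal (2 powr (- b * real k)) * (f \<xi> * indicator (ball 0 (2 ^ Suc k)) \<xi>))"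
    proof (cases "1 \<le> norm \<xi>")
      case True
      define k where "k = nat \<lfloor>log 2 (norm \<xi>)\<rfloor>"
      have "0 < norm \<xi>" using True by linarith
      then have l: "0 \<le> log 2 (norm \<xi>)" using True by simp
      have "real k \<le> log 2 (norm \<xi>)" "log 2 (norm \<xi>) < real (Suc k)" using l unfolding k_def by linarith+
      then have k: "2 powr real k \<le> norm \<xi>" "norm \<xi> < 2 powr real (Suc k)"
        using \<open>0 < norm \<xi>\<close> by (simp_all add: le_log_iff log_less_iff del: of_nat_Suc)
      have "norm \<xi> powr (- b) \<le> (2 powr real k) powr (- b)" using k b by (intro powr_mono2') auto
      also have "\<dots> = 2 powr (- b * real k)" by (simp add: powr_powr mult.commute)
      finally have "ennreal (norm \<xi> powr (- b)) * indicator {\<xi>. 1 \<le> norm \<xi>} \<xi> * f \<xi>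
        \<le> ennreal (2 powr (- b * real k)) * (f \<xi> * indicator (ball 0 (2 ^ Suc k)) \<xi>)"
        using True k(2) by (simp add: powr_realpow[symmetric] ennreal_leI mult_right_mono del: of_nat_Suc power_Suc)
      also have "\<dots> = (\<Sum>j\<in>{k}. ennreal (2 powr (- b * real j)) * (f \<xi> * indicator (ball 0 (2 ^ Suc j)) \<xi>))" by simp
      also have "\<dots> \<le> (\<Sum>j. ennreal (2 powr (- b * real j)) * (f \<xi> * indicator (ball 0 (2 ^ Suc j)) \<xi>))"
        by (intro sum_le_suminf) auto
      finally show ?thesis .
    qed simp
  qed
  also have "\<dots> = (\<Sum>k. \<integral>\<^sup>+\<xi>. ennreal (2 powr (- b * real k)) * (f \<xi> * indicator (ball 0 (2 ^ Suc k)) \<xi>) \<partial>lborel)"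
    by (rule nn_integral_suminf, unfold measurable_lborel2)
      (intro borel_measurable_times_ennreal borel_measurable_const borel_measurable_indicator borel_open open_ball assms(1))
  also have "\<dots> \<le> (\<Sum>k. ennreal (C * 2 powr a * q ^ k))"
  proof (rule suminf_le)
    fix k
    have "(\<integral>\<^sup>+\<xi>. ennreal (2 powr (- b * real k)) * (f \<xi> * indicator (ball 0 (2 ^ Suc k)) \<xi>) \<partial>lborel)
      = ennreal (2 powr (- b * real k)) * (\<integral>\<^sup>+\<xi>. f \<xi> * indicator (ball 0 (2 ^ Suc k)) \<xi> \<partial>lborel)"
      by (rule nn_integral_cmult, unfold measurable_lborel2)
        (intro borel_measurable_times_ennreal borel_measurable_indicator borel_open open_ball assms(1))
    also have "\<dots> \<le> ennreal (2 powr (- b * real k)) * ennreal (C * (2 ^ Suc k) powr a)"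
      by (rule mult_left_mono[OF growth[OF one_le_power]]) auto
    also have "\<dots> = ennreal (C * 2 powr a * q ^ k)"
    proof -
      have "(2 ^ Suc k) powr a = 2 powr a * 2 powr (a * real k)"
        by (simp add: powr_realpow[symmetric] powr_powr powr_add[symmetric] algebra_simps del: power_Suc of_nat_Suc) (simp add: algebra_simps)
      moreover have "q ^ k = 2 powr (a * real k) * 2 powr (- b * real k)"
        unfolding q_def by (simp add: powr_realpow[symmetric] powr_powr powr_add[symmetric] algebra_simps)
      ultimately show ?thesis using C by (simp add: ennreal_mult[symmetric] mult_ac)
    qed
    finally show "(\<integral>\<^sup>+\<xi>. ennreal (2 powr (- b * real k)) * (f \<xi> * indicator (ball 0 (2 ^ Suc k)) \<xi>) \<partial>lborel) \<le> ennreal (C * 2 powr a * q ^ k)" .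
  qed auto
  also have "\<dots> = ennreal (\<Sum>k. C * 2 powr a * q ^ k)"
    using q C by (intro suminf_ennreal2 summable_mult summable_geometric) auto
  also have "\<dots> < \<infinity>" by simp
  finally show ?thesis .
qed

text \<open>A truncated layer-cake formula. A weak-type bound controls every dyadic level equally
  well, so the series over all levels would diverge; stopping at \<open>J\<close> costs only
  \<open>(1/4) ^ J\<close>.\<close>

lemma dyadic_square_bound:
  fixes g :: real
  assumes "0 \<le> g" "g \<le> 1"
  shows "g\<^sup>2 \<le> (1/4) ^ J + (\<Sum>j<J. (1/4) ^ j * indicat_real {(1/2) ^ Suc j<..} g)"
proof -
  have "g \<le> (1/2) ^ J \<or> g\<^sup>2 \<le> (\<Sum>j<J. (1/4) ^ j * indicat_real {(1/2) ^ Suc j<..} g)"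
  proof (induction J)
    case (Suc J)
    show ?case
    proof (cases "g \<le> (1/2) ^ Suc J")
      case False
      from Suc show ?thesis
      proof
        assume "g \<le> (1/2) ^ J"
        then have "g\<^sup>2 \<le> ((1/2) ^ J)\<^sup>2" using assms by (intro power_mono)
        also have "\<dots> = (1/4) ^ J" by (simp add: power2_eq_square power_mult_distrib[symmetric])
        also have "\<dots> = (1/4) ^ J * indicat_real {(1/2) ^ Suc J<..} g" using False by simp
        also have "\<dots> \<le> (\<Sum>j<Suc J. (1/4) ^ j * indicat_real {(1/2) ^ Suc j<..} g)"
          by (simp add: sum_nonneg)
        finally show ?thesis by blast
      next
        assume "g\<^sup>2 \<le> (\<Sum>j<J. (1/4) ^ j * indicat_real {(1/2) ^ Suc j<..} g)"
        then show ?thesis by (simp add: add_increasing2)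
      qed
    qed simp
  qed (use assms in simp)
  then show ?thesis
  proof
    assume "g \<le> (1/2) ^ J"
    then have "g\<^sup>2 \<le> ((1/2) ^ J)\<^sup>2" using assms by (intro power_mono)
    also have "\<dots> = (1/4) ^ J" by (simp add: power2_eq_square power_mult_distrib[symmetric])
    finally show ?thesis by (simp add: add_increasing2 sum_nonneg)
  qed (simp add: add_increasing)
qed

section \<open>Weak-type and square bounds for the spherical convolution\<close>

definition sphere_conv :: "'a::euclidean_space measure \<Rightarrow> real \<Rightarrow> 'a \<Rightarrow> real" where
  "sphere_conv \<mu> r x = (\<integral>y. fcos sphere_measure (r *\<^sub>R (x - y)) \<partial>\<mu>)"

lemma fcos_sphere_meas [measurable]: "fcos sphere_measure \<in> borel_measurable borel"
  by (rule borel_measurable_fcos[OF sphere.finite_measure_axioms sets_sphere_measure])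

lemma abs_fcos_sphere_le: "\<bar>fcos sphere_measure u\<bar> \<le> 1"
  by (rule abs_fcos_le[OF prob_space_sphere_measure sets_sphere_measure])

lemma sphere_conv_measurable:
  fixes \<mu> :: "'a::euclidean_space measure"
  assumes mu: "borel_prob \<mu>"
  shows "(\<lambda>p. sphere_conv \<mu> (fst p) (snd p)) \<in> borel_measurable (borel \<Otimes>\<^sub>M borel)"
proof -
  interpret prob_space \<mu> using mu by simp
  have "(\<lambda>(p, y). fcos sphere_measure (fst p *\<^sub>R (snd p - y :: 'a))) \<in> borel_measurable ((borel \<Otimes>\<^sub>M borel) \<Otimes>\<^sub>M borel)"
    by measurable
  then have "(\<lambda>(p, y). fcos sphere_measure (fst p *\<^sub>R (snd p - y :: 'a))) \<in> borel_measurable ((borel \<Otimes>\<^sub>M borel) \<Otimes>\<^sub>M \<mu>)"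
    by (simp only: measurable_cong_sets[OF sets_pair_measure_cong[OF refl borel_probD(3)[OF mu]] refl])
  then show ?thesis unfolding sphere_conv_def by (rule borel_measurable_lebesgue_integral)
qed

lemma sphere_conv_measurable1:
  assumes "borel_prob \<mu>"
  shows "sphere_conv \<mu> r \<in> borel_measurable borel"
  using measurable_compose[OF measurable_Pair1'[of r borel borel] sphere_conv_measurable[OF assms]] by simp

lemma abs_sphere_conv_le:
  assumes mu: "borel_prob \<mu>"
  shows "\<bar>sphere_conv \<mu> r x\<bar> \<le> 1"
proof -
  interpret prob_space \<mu> using mu by simp
  have "\<bar>sphere_conv \<mu> r x\<bar> \<le> (\<integral>y. \<bar>fcos sphere_measure (r *\<^sub>R (x - y))\<bar> \<partial>\<mu>)"
    unfolding sphere_conv_def by (rule integral_abs_bound)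
  also have "\<dots> \<le> (\<integral>y. 1 \<partial>\<mu>)"
    using abs_fcos_sphere_le by (intro integral_mono integrable_bounded_finite[where B=1] finite_measure_axioms)
      (auto simp: measurable_cong_sets[OF borel_probD(3)[OF mu] refl])
  finally show ?thesis by (simp add: prob_space)
qed

text \<open>\<open>sphere_conv\<close> is the \<open>G r\<close> of the overview.
  \<open>fcos_bilinear\<close> on the sphere of radius \<open>r\<close> expresses the pairing
  through the two transforms; Cauchy-Schwarz appears in its weighted arithmetic form, with
  \<open>\<kappa>\<close> left free so that square roots are avoided.\<close>

lemma sphere_conv_pairing:
  fixes \<mu> \<mu>' :: "'a::euclidean_space measure"
  assumes mu: "borel_prob \<mu>" and mu': "borel_prob \<mu>'" and \<kappa>: "\<kappa> > 0"
  shows "2 * \<bar>\<integral>x. sphere_conv \<mu> r x \<partial>\<mu>'\<bar> \<le> \<kappa> * sphere_avg \<mu>' r + sphere_avg \<mu> r / \<kappa>"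
proof -
  define \<nu> where "\<nu> = distr sphere_measure borel (\<lambda>\<omega>::'a. r *\<^sub>R \<omega>)"
  have [measurable]: "(\<lambda>\<omega>::'a. r *\<^sub>R \<omega>) \<in> measurable sphere_measure borel"
    unfolding measurable_cong_sets[OF sets_sphere_measure refl] by (intro borel_measurable_continuous_onI continuous_intros)
  have nu: "borel_prob \<nu>" unfolding \<nu>_def by (auto intro!: sphere.prob_space_distr)
  interpret nu: prob_space \<nu> using nu by simp
  have fcos_nu: "fcos \<nu> u = fcos sphere_measure (r *\<^sub>R u)" for u
    unfolding fcos_def \<nu>_def by (subst integral_distr) auto
  let ?F = "\<lambda>\<xi>. fcos \<mu>' \<xi> * fcos \<mu> \<xi> + fsin \<mu>' \<xi> * fsin \<mu> \<xi>"
  have eq: "(\<integral>x. sphere_conv \<mu> r x \<partial>\<mu>') = (\<integral>\<xi>. ?F \<xi> \<partial>\<nu>)"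
    using fcos_bilinear[OF borel_probD(2,3)[OF mu'] borel_probD(2,3)[OF mu] borel_probD(2,3)[OF nu]]
    by (simp add: sphere_conv_def fcos_nu)
  have avg: "sphere_avg m r = (\<integral>\<xi>. (cmod (ft m \<xi>))\<^sup>2 \<partial>\<nu>)" if "borel_prob m" for m :: "'a measure"
    using borel_measurable_ft[OF that] unfolding \<nu>_def sphere_avg_ft[OF that] by (subst integral_distr) auto
  have int: "integrable \<nu> (\<lambda>\<xi>. (cmod (ft m \<xi>))\<^sup>2)" if "borel_prob m" for m :: "'a measure"
    using borel_measurable_ft[OF that] by (intro integrable_bounded_finite[where B=1] nu.finite_measure_axioms)
      (auto simp: measurable_cong_sets[OF borel_probD(3)[OF nu] refl] power_le_one cmod_ft_le_1[OF that])
  have pt: "2 * \<bar>?F \<xi>\<bar> \<le> \<kappa> * (cmod (ft \<mu>' \<xi>))\<^sup>2 + (cmod (ft \<mu> \<xi>))\<^sup>2 / \<kappa>" for \<xi>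
  proof -
    have "?F \<xi> = Re (ft \<mu>' \<xi> * cnj (ft \<mu> \<xi>))" by (simp add: ft_def)
    then have "\<bar>?F \<xi>\<bar> \<le> cmod (ft \<mu>' \<xi>) * cmod (ft \<mu> \<xi>)"
      using abs_Re_le_cmod[of "ft \<mu>' \<xi> * cnj (ft \<mu> \<xi>)"] by (simp add: norm_mult)
    moreover have "2 * (p * q) \<le> \<kappa> * p\<^sup>2 + q\<^sup>2 / \<kappa>" for p q :: real
    proof -
      have "0 \<le> (\<kappa> * p - q)\<^sup>2 / \<kappa>" using \<kappa> by simp
      also have "\<dots> = \<kappa> * p\<^sup>2 + q\<^sup>2 / \<kappa> - 2 * (p * q)" using \<kappa> by (simp add: power2_eq_square field_simps)
      finally show ?thesis by simp
    qed
    ultimately show ?thesis by (smt (verit))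
  qed
  have Fm: "?F \<in> borel_measurable borel"
    using borel_measurable_fcos[OF borel_probD(2,3)[OF mu]] borel_measurable_fcos[OF borel_probD(2,3)[OF mu']] by measurable
  have "2 * \<bar>\<integral>\<xi>. ?F \<xi> \<partial>\<nu>\<bar> \<le> 2 * (\<integral>\<xi>. \<bar>?F \<xi>\<bar> \<partial>\<nu>)" by (intro mult_left_mono integral_abs_bound) auto
  also have "\<dots> = (\<integral>\<xi>. 2 * \<bar>?F \<xi>\<bar> \<partial>\<nu>)" by simp
  also have "\<dots> \<le> (\<integral>\<xi>. \<kappa> * (cmod (ft \<mu>' \<xi>))\<^sup>2 + (cmod (ft \<mu> \<xi>))\<^sup>2 / \<kappa> \<partial>\<nu>)"
  proof (rule integral_mono[OF _ _ pt])
    show i: "integrable \<nu> (\<lambda>\<xi>. \<kappa> * (cmod (ft \<mu>' \<xi>))\<^sup>2 + (cmod (ft \<mu> \<xi>))\<^sup>2 / \<kappa>)" using int[OF mu] int[OF mu'] by simp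
    show "integrable \<nu> (\<lambda>\<xi>. 2 * \<bar>?F \<xi>\<bar>)"
      by (rule Bochner_Integration.integrable_bound[OF i])
        (use pt Fm in \<open>auto simp: measurable_cong_sets[OF borel_probD(3)[OF nu] refl] intro!: order_trans[OF pt]\<close>)
  qed
  also have "\<dots> = \<kappa> * sphere_avg \<mu>' r + sphere_avg \<mu> r / \<kappa>"
    using int[OF mu] int[OF mu'] by (simp add: avg[OF mu] avg[OF mu'])
  finally show ?thesis unfolding eq .
qed

text \<open>Normalizing the restriction to a level set of mass \<open>p\<close> gives Frostman
  constant \<open>c / p\<close>, and the pairing bound becomes
  \<open>l\<^sup>2 \<le> (D * c / p) * sphere_avg \<mu> r\<close>. The sign \<open>t\<close>
  separates positive from negative values, since the pairing is bounded below by \<open>l\<close>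
  only where the integrand has one sign.\<close>

lemma sphere_conv_level_signed:
  fixes \<mu> :: "'a::euclidean_space measure"
  assumes mu: "borel_prob \<mu>" and ball: "measure \<mu> (ball 0 R) = 1" and c: "c \<ge> 1" and D: "D > 0" and l: "l > 0"
    and frost: "\<And>x \<rho>. \<rho> > 0 \<Longrightarrow> measure \<mu> (ball x \<rho>) \<le> c * \<rho> powr s"
    and bound: "\<And>(\<nu> :: 'a measure) c'. borel_prob \<nu> \<Longrightarrow> measure \<nu> (ball 0 R) = 1 \<Longrightarrow> c' \<ge> 1 \<Longrightarrow>
      (\<And>x \<rho>. \<rho> > 0 \<Longrightarrow> measure \<nu> (ball x \<rho>) \<le> c' * \<rho> powr s) \<Longrightarrow> sphere_avg \<nu> r \<le> D * c'"
    and t: "\<bar>t\<bar> = (1::real)"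
  shows "l\<^sup>2 * measure \<mu> {x. l < t * sphere_conv \<mu> r x} \<le> D * c * sphere_avg \<mu> r"
proof -
  interpret prob_space \<mu> using mu by simp
  define A where "A = {x. l < t * sphere_conv \<mu> r x}"
  note [measurable] = sphere_conv_measurable1[OF mu]
  have "A \<in> sets borel" unfolding A_def by measurable
  then have A: "A \<in> sets \<mu>" using mu by simp
  show ?thesis
  proof (cases "measure \<mu> A = 0")
    case True
    then show ?thesis using c D sphere_avg_nonneg[of \<mu> r] by (simp add: A_def)
  next
    case False
    define p where "p = measure \<mu> A"
    have p: "0 < p" "p \<le> 1" using False by (auto simp: p_def zero_less_measure_iff)
    define \<nu> where "\<nu> = uniform_measure \<mu> A"
    have emA: "emeasure \<mu> A \<noteq> 0" "emeasure \<mu> A \<noteq> \<infinity>" using p by (auto simp: emeasure_eq_measure p_def)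
    have nu: "borel_prob \<nu>" unfolding \<nu>_def using prob_space_uniform_measure[OF emA] mu by simp
    interpret nu: prob_space \<nu> using nu by simp
    have meas: "measure \<nu> B = measure \<mu> (A \<inter> B) / p" if "B \<in> sets borel" for B
      unfolding \<nu>_def p_def using emA A that mu by (intro measure_uniform_measure) auto
    have ballA: "measure \<nu> (ball 0 R) = 1"
    proof -
      have "AE x in \<mu>. x \<in> ball 0 R" using ball mu by (subst (asm) prob_eq_1) auto
      then have "measure \<mu> (A \<inter> ball 0 R) = measure \<mu> A" using A mu by (intro measure_eq_AE) auto
      then show ?thesis using p by (simp add: meas p_def)
    qed
    have P: "sphere_avg \<nu> r \<le> D * (c / p)"
    proof (rule bound[OF nu ballA])
      show "c / p \<ge> 1" using p c by simp
      fix x :: 'a and \<rho> :: real assume "\<rho> > 0"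
      have "measure \<mu> (A \<inter> ball x \<rho>) \<le> measure \<mu> (ball x \<rho>)" using mu by (intro finite_measure_mono) auto
      also have "\<dots> \<le> c * \<rho> powr s" by (rule frost[OF \<open>\<rho> > 0\<close>])
      finally show "measure \<nu> (ball x \<rho>) \<le> c / p * \<rho> powr s" using p by (simp add: meas divide_right_mono)
    qed
    define P' where "P' = D * (c / p)"
    have P': "P' > 0" using D c p by (simp add: P'_def)
    have "l \<le> (\<integral>x. t * sphere_conv \<mu> r x \<partial>\<nu>)"
    proof -
      have "l = (\<integral>x. l \<partial>\<nu>)" by (simp add: nu.prob_space)
      also have "\<dots> \<le> (\<integral>x. t * sphere_conv \<mu> r x \<partial>\<nu>)"
      proof (rule integral_mono_AE)
        show "AE x in \<nu>. l \<le> t * sphere_conv \<mu> r x"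
          unfolding \<nu>_def using A by (intro AE_uniform_measureI) (auto simp: A_def)
        show "integrable \<nu> (\<lambda>x. t * sphere_conv \<mu> r x)"
          using abs_sphere_conv_le[OF mu] sphere_conv_measurable1[OF mu]
          by (intro integrable_mult_right integrable_bounded_finite[where B=1] nu.finite_measure_axioms)
            (auto simp: measurable_cong_sets[OF borel_probD(3)[OF nu] refl])
      qed simp
      finally show ?thesis .
    qed
    also have "\<dots> \<le> \<bar>\<integral>x. sphere_conv \<mu> r x \<partial>\<nu>\<bar>"
      using t by (cases "t = 1") (auto simp: abs_if split: if_splits)
    finally have "2 * l \<le> 2 * \<bar>\<integral>x. sphere_conv \<mu> r x \<partial>\<nu>\<bar>" by simp
    \<comment> \<open>With \<open>\<kappa> = l / P'\<close> the first term is at most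
      \<open>l\<close>, so it absorbs half of the \<open>2 * l\<close> on the left.\<close>
    also have "\<dots> \<le> (l / P') * sphere_avg \<nu> r + sphere_avg \<mu> r / (l / P')"
      using l P' by (intro sphere_conv_pairing mu nu) auto
    also have "\<dots> \<le> (l / P') * P' + sphere_avg \<mu> r / (l / P')"
      using l P' by (intro add_right_mono mult_left_mono P[folded P'_def]) auto
    also have "\<dots> = l + sphere_avg \<mu> r * P' / l" using P' by simp
    finally have "l \<le> sphere_avg \<mu> r * P' / l" by simp
    then have "l\<^sup>2 \<le> sphere_avg \<mu> r * P'" using l by (simp add: field_simps power2_eq_square)
    then have "l\<^sup>2 * p \<le> sphere_avg \<mu> r * P' * p" using p by (intro mult_right_mono) auto
    also have "\<dots> = D * c * sphere_avg \<mu> r" using p by (simp add: P'_def)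
    finally show ?thesis by (simp add: p_def A_def)
  qed
qed

text \<open>The weak-type bound is summed over the \<open>J\<close> largest dyadic levels, each
  contributing the same amount; the factor \<open>J\<close> is the price for passing from weak to
  strong type.\<close>

lemma sphere_conv_square:
  fixes \<mu> :: "'a::euclidean_space measure"
  assumes mu: "borel_prob \<mu>" and ball: "measure \<mu> (ball 0 R) = 1" and c: "c \<ge> 1" and D: "D > 0"
    and frost: "\<And>x \<rho>. \<rho> > 0 \<Longrightarrow> measure \<mu> (ball x \<rho>) \<le> c * \<rho> powr s"
    and bound: "\<And>(\<nu> :: 'a measure) c'. borel_prob \<nu> \<Longrightarrow> measure \<nu> (ball 0 R) = 1 \<Longrightarrow> c' \<ge> 1 \<Longrightarrow>
      (\<And>x \<rho>. \<rho> > 0 \<Longrightarrow> measure \<nu> (ball x \<rho>) \<le> c' * \<rho> powr s) \<Longrightarrow> sphere_avg \<nu> r \<le> D * c'"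
  shows "(\<integral>\<^sup>+x. ennreal ((sphere_conv \<mu> r x)\<^sup>2) \<partial>\<mu>)
    \<le> ennreal ((1/4) ^ J + 8 * real J * (D * c * sphere_avg \<mu> r))"
proof -
  interpret prob_space \<mu> using mu by simp
  note [measurable_cong] = borel_probD(3)[OF mu]
  note [measurable] = sphere_conv_measurable1[OF mu, of r]
  define G where "G = sphere_conv \<mu> r"
  have [measurable]: "G \<in> borel_measurable borel" by (simp add: G_def)
  have G1: "\<bar>G x\<bar> \<le> 1" for x unfolding G_def by (rule abs_sphere_conv_le[OF mu])
  define Q where "Q = D * c * sphere_avg \<mu> r"
  have level: "l\<^sup>2 * measure \<mu> {x. l < \<bar>G x\<bar>} \<le> 2 * Q" if l: "l > 0" for l
  proof -
    have s: "{x. l < t * G x} \<in> sets \<mu>" for t unfolding borel_probD(3)[OF mu] by measurable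
    have "{x. l < \<bar>G x\<bar>} = {x. l < 1 * G x} \<union> {x. l < (- 1) * G x}" by auto
    then have "measure \<mu> {x. l < \<bar>G x\<bar>} \<le> measure \<mu> {x. l < 1 * G x} + measure \<mu> {x. l < (- 1) * G x}"
      using measure_Un_le[OF s s, of 1 "- 1"] by simp
    then have "l\<^sup>2 * measure \<mu> {x. l < \<bar>G x\<bar>} \<le> l\<^sup>2 * measure \<mu> {x. l < 1 * G x} + l\<^sup>2 * measure \<mu> {x. l < (- 1) * G x}"
      unfolding distrib_left[symmetric] by (rule mult_left_mono) simp
    also have "\<dots> \<le> Q + Q"
      unfolding Q_def G_def by (intro add_mono sphere_conv_level_signed[OF mu ball c D l frost bound]) auto
    finally show ?thesis by simp
  qed
  define S where "S j = {x. (1/2) ^ Suc j < \<bar>G x\<bar>}" for j :: nat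
  have Sm: "S j \<in> sets \<mu>" for j unfolding S_def borel_probD(3)[OF mu] by measurable
  \<comment> \<open>The factor 8 is 2 for the two signs times 4 for comparing
    \<open>(1/4) ^ j\<close> with the square of the level \<open>(1/2) ^ Suc j\<close>.\<close>
  have dyadic: "(1/4) ^ j * measure \<mu> (S j) \<le> 8 * Q" for j
  proof -
    have "((1/2) ^ Suc j)\<^sup>2 * measure \<mu> (S j) \<le> 2 * Q" unfolding S_def by (rule level) simp
    moreover have "((1/2) ^ Suc j)\<^sup>2 = (1/4) ^ j / (4::real)"
      by (simp add: power2_eq_square power_mult_distrib[symmetric])
    ultimately have "(1/4) ^ j / 4 * measure \<mu> (S j) \<le> 2 * Q" by (simp only:)
    then show ?thesis by simp
  qed
  have pt: "(G x)\<^sup>2 \<le> (1/4) ^ J + (\<Sum>j<J. (1/4) ^ j * indicat_real (S j) x)" for x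
  proof -
    have "indicat_real {(1/2) ^ Suc j<..} \<bar>G x\<bar> = indicat_real (S j) x" for j by (simp add: S_def indicator_def)
    then show ?thesis using dyadic_square_bound[of "\<bar>G x\<bar>" J] G1[of x] by simp
  qed
  have i1: "integrable \<mu> (\<lambda>x. (G x)\<^sup>2)"
    using G1 by (intro integrable_bounded_finite[where B=1] finite_measure_axioms) (auto simp: abs_square_le_1 measurable_cong_sets[OF borel_probD(3)[OF mu] refl])
  have i2: "integrable \<mu> (\<lambda>x. (1/4) ^ J + (\<Sum>j<J. (1/4) ^ j * indicat_real (S j) x))"
    using Sm by (intro Bochner_Integration.integrable_add Bochner_Integration.integrable_sum integrable_mult_right) (auto simp: emeasure_eq_measure)
  have "(\<integral>x. (G x)\<^sup>2 \<partial>\<mu>) \<le> (\<integral>x. (1/4) ^ J + (\<Sum>j<J. (1/4) ^ j * indicat_real (S j) x) \<partial>\<mu>)"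
    by (rule integral_mono[OF i1 i2 pt])
  also have "\<dots> = (1/4) ^ J + (\<Sum>j<J. (1/4) ^ j * measure \<mu> (S j))"
  proof -
    have i3: "integrable \<mu> (\<lambda>x. (1/4) ^ j * indicat_real (S j) x)" for j
      using Sm by (intro integrable_mult_right) (simp add: emeasure_eq_measure)
    have "(\<integral>x. (\<Sum>j<J. (1/4) ^ j * indicat_real (S j) x) \<partial>\<mu>) = (\<Sum>j<J. \<integral>x. (1/4) ^ j * indicat_real (S j) x \<partial>\<mu>)"
      by (rule Bochner_Integration.integral_sum) (rule i3)
    moreover have "(\<integral>x. (1/4) ^ j * indicat_real (S j) x \<partial>\<mu>) = (1/4) ^ j * measure \<mu> (S j)" for j
      using Sm[of j] by (simp add: sets.Int_space_eq2)
    ultimately show ?thesis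
      by (subst Bochner_Integration.integral_add[OF _ Bochner_Integration.integrable_sum[OF i3]]) (simp_all only: integrable_const lebesgue_integral_const prob_space scaleR_one)
  qed
  also have "\<dots> \<le> (1/4) ^ J + (\<Sum>j<J. 8 * Q)" by (intro add_left_mono sum_mono dyadic)
  also have "\<dots> = (1/4) ^ J + 8 * real J * Q" by simp
  finally have "(\<integral>x. (G x)\<^sup>2 \<partial>\<mu>) \<le> (1/4) ^ J + 8 * real J * Q" .
  moreover have "(\<integral>\<^sup>+x. ennreal ((G x)\<^sup>2) \<partial>\<mu>) = ennreal (\<integral>x. (G x)\<^sup>2 \<partial>\<mu>)"
    by (rule nn_integral_eq_integral[OF i1]) simp
  ultimately show ?thesis by (simp add: G_def Q_def ennreal_leI)
qed

text \<open>A radial weight is constant on each sphere, so it can be drawn into the spherical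
  integral before polar coordinates are applied.\<close>

lemma sphere_avg_polar:
  fixes \<mu> :: "'a::euclidean_space measure"
  assumes mu: "borel_prob \<mu>" and [measurable]: "h \<in> borel_measurable borel"
  shows "(\<integral>\<^sup>+(\<xi>::'a). h (norm \<xi>) * ennreal (sphere_avg \<mu> (norm \<xi>)) \<partial>lborel)
    = (\<integral>\<^sup>+\<xi>. h (norm \<xi>) * ennreal ((cmod (fourier_measure \<mu> \<xi>))\<^sup>2) \<partial>lborel)"
proof -
  let ?F = "\<lambda>\<xi>. ennreal ((cmod (ft \<mu> \<xi>))\<^sup>2)"
  note [measurable] = borel_measurable_ft[OF mu]
  have "(\<integral>\<^sup>+\<omega>. h (norm (norm \<xi> *\<^sub>R \<omega>)) * ?F (norm \<xi> *\<^sub>R \<omega>) \<partial>sphere_measure) = h (norm \<xi>) * ennreal (sphere_avg \<mu> (norm \<xi>))" for \<xi> :: 'a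
  proof -
    have "(\<integral>\<^sup>+\<omega>. h (norm (norm \<xi> *\<^sub>R \<omega>)) * ?F (norm \<xi> *\<^sub>R \<omega>) \<partial>sphere_measure)
      = (\<integral>\<^sup>+\<omega>. h (norm \<xi>) * ?F (norm \<xi> *\<^sub>R \<omega>) \<partial>sphere_measure)"
      by (rule nn_integral_cong_AE, rule AE_mp[OF AE_sphere_measure]) (auto intro!: AE_I2)
    also have "\<dots> = h (norm \<xi>) * (\<integral>\<^sup>+\<omega>. ?F (norm \<xi> *\<^sub>R \<omega>) \<partial>sphere_measure)"
      by (rule nn_integral_cmult, unfold measurable_cong_sets[OF sets_sphere_measure refl]) measurable
    also have "(\<integral>\<^sup>+\<omega>. ?F (norm \<xi> *\<^sub>R \<omega>) \<partial>sphere_measure) = ennreal (sphere_avg \<mu> (norm \<xi>))"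
      unfolding sphere_avg_ft[OF mu] by (rule nn_integral_eq_integral[OF integrable_cmod_ft[OF mu]]) simp
    finally show ?thesis .
  qed
  then have "(\<integral>\<^sup>+(\<xi>::'a). h (norm \<xi>) * ennreal (sphere_avg \<mu> (norm \<xi>)) \<partial>lborel)
    = (\<integral>\<^sup>+(\<xi>::'a). \<integral>\<^sup>+\<omega>. h (norm (norm \<xi> *\<^sub>R \<omega>)) * ?F (norm \<xi> *\<^sub>R \<omega>) \<partial>sphere_measure \<partial>lborel)" by simp
  also have "\<dots> = (\<integral>\<^sup>+\<xi>. h (norm \<xi>) * ?F \<xi> \<partial>lborel)" by (rule sphere_polar) measurable
  finally show ?thesis by (simp add: cmod_ft[OF mu])
qed

text \<open>Integrating the square bound over \<open>\<mu>\<close> and over all frequencies leaves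
  \<open>norm \<xi> powr (- b)\<close>, up to a small power, against the squared transform of
  \<open>\<mu>\<close>. The latter grows like \<open>T powr (DIM('a) - s)\<close> on balls, so the
  integral converges for \<open>b > DIM('a) - s\<close>, and finiteness for almost every
  \<open>x\<close> follows from Fubini.\<close>

lemma AE_sphere_conv_square_finite:
  fixes \<mu> :: "'a::euclidean_space measure"
  assumes mu: "borel_prob \<mu>" and R: "measure \<mu> (ball 0 R) = 1" and c: "c \<ge> 1" and s: "s > 0"
    and frost: "\<And>x \<rho>. \<rho> > 0 \<Longrightarrow> measure \<mu> (ball x \<rho>) \<le> c * \<rho> powr s"
    and D: "D > 0" and b: "b > real DIM('a) - s" "s \<le> real DIM('a)"
    and bound: "\<And>(\<nu> :: 'a measure) c' r. borel_prob \<nu> \<Longrightarrow> measure \<nu> (ball 0 R) = 1 \<Longrightarrow> c' \<ge> 1 \<Longrightarrow> r \<ge> 1 \<Longrightarrow>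
      (\<And>x \<rho>. \<rho> > 0 \<Longrightarrow> measure \<nu> (ball x \<rho>) \<le> c' * \<rho> powr s) \<Longrightarrow> sphere_avg \<nu> r \<le> D * r powr (- b) * c'"
  shows "AE x in \<mu>. (\<integral>\<^sup>+(\<xi>::'a). ennreal ((sphere_conv \<mu> (norm \<xi>) x)\<^sup>2) \<partial>lborel) < \<infinity>"
proof -
  interpret prob_space \<mu> using mu by simp
  interpret pair: pair_sigma_finite \<mu> "lborel :: 'a measure" ..
  let ?d = "real DIM('a)"
  \<comment> \<open>Half of the surplus in \<open>b\<close> is spent on the logarithmic number of
    levels; the other half keeps the energy integral convergent.\<close>
  define \<eta> where "\<eta> = (b - (?d - s)) / 2"
  have \<eta>: "\<eta> > 0" "b - \<eta> > ?d - s" "b - \<eta> \<ge> 0" using b by (auto simp: \<eta>_def field_simps)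
  define L where "L = ?d / (\<eta> * ln 2) + 1"
  have L: "L > 0" using \<eta> by (auto simp: L_def intro!: add_nonneg_pos)
  define M where "M = 8 * L * (D * c)"
  have M: "M \<ge> 0" using L D c by (simp add: M_def)
  define G where "G \<xi> x = ennreal ((sphere_conv \<mu> (norm \<xi>) x)\<^sup>2)" for \<xi> x :: 'a
  have Gm: "(\<lambda>p. G (snd p) (fst p)) \<in> borel_measurable (borel \<Otimes>\<^sub>M borel)"
  proof -
    have "(\<lambda>p::'a\<times>'a. (norm (snd p), fst p)) \<in> borel \<Otimes>\<^sub>M borel \<rightarrow>\<^sub>M borel \<Otimes>\<^sub>M borel" by measurable
    from measurable_compose[OF this sphere_conv_measurable[OF mu]]
    show ?thesis unfolding G_def by (simp add: measurable_compose)
  qed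
  have Gm': "(\<lambda>p. G (snd p) (fst p)) \<in> borel_measurable (\<mu> \<Otimes>\<^sub>M lborel)"
    using Gm by (simp only: measurable_cong_sets[OF sets_pair_measure_cong[OF borel_probD(3)[OF mu] sets_lborel] refl])
  have F1: "(\<integral>\<^sup>+x. G \<xi> x \<partial>\<mu>) \<le> 1" for \<xi>
  proof -
    have "(\<integral>\<^sup>+x. G \<xi> x \<partial>\<mu>) \<le> (\<integral>\<^sup>+x. 1 \<partial>\<mu>)"
      using abs_sphere_conv_le[OF mu] by (intro nn_integral_mono) (simp add: G_def abs_square_le_1)
    then show ?thesis by (simp add: emeasure_space_1)
  qed
  have F2: "(\<integral>\<^sup>+x. G \<xi> x \<partial>\<mu>) \<le> ennreal (norm \<xi> powr (- (2 * ?d)))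
      + ennreal M * (ennreal (norm \<xi> powr (- (b - \<eta>))) * ennreal (sphere_avg \<mu> (norm \<xi>)))" if \<xi>: "norm \<xi> \<ge> 1" for \<xi>
  proof -
    define r where "r = norm \<xi>"
    have r: "r \<ge> 1" "r > 0" using \<xi> by (auto simp: r_def)
    \<comment> \<open>About \<open>?d * log 2 r\<close> levels make the truncation error
      \<open>(1/4) ^ J\<close> at most \<open>r powr (- 2 * ?d)\<close>, which is integrable at
      infinity, while \<open>J\<close> itself stays below \<open>L * r powr \<eta>\<close>.\<close>
    define J where "J = nat \<lceil>?d * log 2 r\<rceil>"
    have lr: "0 \<le> ?d * log 2 r" using r by simp
    have J: "?d * log 2 r \<le> real J" "real J \<le> ?d * log 2 r + 1" using lr unfolding J_def by linarith+
    have "2 powr (2 * real J) = (4::real) ^ J" using powr_realpow[of 2 "2 * J"] by (simp add: power_mult)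
    then have "(1/4) ^ J = 2 powr (- (2 * real J))" by (simp add: powr_minus power_one_over inverse_eq_divide)
    also have "\<dots> \<le> 2 powr (log 2 r * (- (2 * ?d)))" using J(1) by (intro powr_mono) (auto simp: mult_ac)
    also have "\<dots> = r powr (- (2 * ?d))" using r by (simp only: powr_powr[symmetric] powr_log_cancel)
    finally have J4: "(1/4) ^ J \<le> r powr (- (2 * ?d))" .
    have "real J \<le> ?d * ln r / ln 2 + 1" using J(2) by (simp add: log_def)
    also have "\<dots> \<le> ?d * (r powr \<eta> / \<eta>) / ln 2 + r powr \<eta>"
      using ln_powr_bound[OF r(1) \<eta>(1)] r \<eta> by (intro add_mono divide_right_mono mult_left_mono) (auto intro: ge_one_powr_ge_zero)
    also have "\<dots> = L * r powr \<eta>" by (simp add: L_def field_simps)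
    finally have JL: "real J \<le> L * r powr \<eta>" .
    have "(\<integral>\<^sup>+x. G \<xi> x \<partial>\<mu>) \<le> ennreal ((1/4) ^ J + 8 * real J * (D * r powr (- b) * c * sphere_avg \<mu> r))"
      unfolding G_def r_def[symmetric] using D r
      by (intro sphere_conv_square[OF mu R c _ frost] bound) auto
    also have "\<dots> \<le> ennreal (r powr (- (2 * ?d)) + 8 * (L * r powr \<eta>) * (D * r powr (- b) * c * sphere_avg \<mu> r))"
      using J4 JL D c sphere_avg_nonneg[of \<mu> r] by (intro ennreal_leI add_mono mult_right_mono mult_left_mono) auto
    also have "8 * (L * r powr \<eta>) * (D * r powr (- b) * c * sphere_avg \<mu> r) = M * (r powr (- (b - \<eta>)) * sphere_avg \<mu> r)"
      using powr_add[of r \<eta> "- b"] by (simp add: M_def add.commute)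
    also have "ennreal (r powr (- (2 * ?d)) + M * (r powr (- (b - \<eta>)) * sphere_avg \<mu> r))
      = ennreal (r powr (- (2 * ?d))) + ennreal M * (ennreal (r powr (- (b - \<eta>))) * ennreal (sphere_avg \<mu> r))"
      using M sphere_avg_nonneg[of \<mu> r] by (simp add: ennreal_mult)
    finally show ?thesis unfolding r_def .
  qed
  \<comment> \<open>The trailing factor 1 is the constant function to which
    \<open>weighted_integral_finite\<close> is applied, with the volume growth of balls.\<close>
  define A where "A \<xi> = ennreal (norm \<xi> powr (- (2 * ?d))) * indicator {\<xi>. 1 \<le> norm \<xi>} \<xi> * 1" for \<xi> :: 'a
  define h where "h r = ennreal (r powr (- (b - \<eta>))) * indicator {1..} r" for r :: real
  have hm: "h \<in> borel_measurable borel" unfolding h_def by measurable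
  have hm': "(\<lambda>\<xi>::'a. h (norm \<xi>)) \<in> borel_measurable borel" using hm by measurable
  have avm: "(\<lambda>\<xi>::'a. ennreal (sphere_avg \<mu> (norm \<xi>))) \<in> borel_measurable borel"
  proof -
    have "(\<lambda>(\<xi>::'a, \<omega>). (cmod (ft \<mu> (norm \<xi> *\<^sub>R \<omega>)))\<^sup>2) \<in> borel_measurable (borel \<Otimes>\<^sub>M borel)"
      using borel_measurable_ft[OF mu] by measurable
    then have "(\<lambda>(\<xi>::'a, \<omega>). (cmod (ft \<mu> (norm \<xi> *\<^sub>R \<omega>)))\<^sup>2) \<in> borel_measurable (borel \<Otimes>\<^sub>M sphere_measure)"
      by (simp only: measurable_cong_sets[OF sets_pair_measure_cong[OF refl sets_sphere_measure] refl])
    then have "(\<lambda>\<xi>::'a. sphere_avg \<mu> (norm \<xi>)) \<in> borel_measurable borel"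
      unfolding sphere_avg_ft[OF mu] by (rule sphere.borel_measurable_lebesgue_integral)
    then show ?thesis by measurable
  qed
  have Am: "A \<in> borel_measurable borel" unfolding A_def[abs_def] by measurable
  have finA: "(\<integral>\<^sup>+\<xi>. A \<xi> \<partial>lborel) < \<infinity>"
    unfolding A_def
  proof (rule weighted_integral_finite)
    fix T :: real assume T: "T \<ge> 1"
    show "(\<integral>\<^sup>+(\<xi>::'a). 1 * indicator (ball 0 T) \<xi> \<partial>lborel) \<le> ennreal (unit_ball_vol ?d * T powr ?d)"
      using T by (simp add: emeasure_ball powr_realpow)
  qed auto
  have finB: "(\<integral>\<^sup>+(\<xi>::'a). h (norm \<xi>) * ennreal (sphere_avg \<mu> (norm \<xi>)) \<partial>lborel) < \<infinity>"
  proof -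
    obtain C where C: "C \<ge> 0" "\<forall>T\<ge>1. (\<integral>\<^sup>+\<xi>. ennreal ((cmod (fourier_measure \<mu> \<xi>))\<^sup>2) * indicator (ball 0 T) \<xi> \<partial>lborel)
      \<le> ennreal (C * T powr (?d - s))"
    proof (rule frostman_energy[OF mu s frost])
      fix C assume "C \<ge> 0" "\<And>T. T \<ge> 1 \<Longrightarrow> (\<integral>\<^sup>+\<xi>. ennreal ((cmod (fourier_measure \<mu> \<xi>))\<^sup>2) * indicator (ball 0 T) \<xi> \<partial>lborel)
        \<le> ennreal (C * T powr (?d - s))"
      then show thesis by (intro that) auto
    qed
    have "(\<integral>\<^sup>+(\<xi>::'a). ennreal (norm \<xi> powr (- (b - \<eta>))) * indicator {\<xi>. 1 \<le> norm \<xi>} \<xi> * ennreal ((cmod (fourier_measure \<mu> \<xi>))\<^sup>2) \<partial>lborel) < \<infinity>"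
      using C \<eta> borel_measurable_cmod_fourier[OF borel_probD(2,3)[OF mu]]
      by (intro weighted_integral_finite[where C=C and a="?d - s"]) auto
    also have "(\<integral>\<^sup>+(\<xi>::'a). ennreal (norm \<xi> powr (- (b - \<eta>))) * indicator {\<xi>. 1 \<le> norm \<xi>} \<xi> * ennreal ((cmod (fourier_measure \<mu> \<xi>))\<^sup>2) \<partial>lborel)
      = (\<integral>\<^sup>+(\<xi>::'a). h (norm \<xi>) * ennreal ((cmod (fourier_measure \<mu> \<xi>))\<^sup>2) \<partial>lborel)"
      by (rule nn_integral_cong) (simp add: h_def indicator_def)
    finally show ?thesis unfolding sphere_avg_polar[OF mu hm] .
  qed
  have "(\<integral>\<^sup>+\<xi>. (\<integral>\<^sup>+x. G \<xi> x \<partial>\<mu>) \<partial>lborel)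
    \<le> (\<integral>\<^sup>+\<xi>. indicator (ball 0 1) \<xi> + (A \<xi> + ennreal M * (h (norm \<xi>) * ennreal (sphere_avg \<mu> (norm \<xi>)))) \<partial>lborel)"
  proof (rule nn_integral_mono)
    fix \<xi> :: 'a
    show "(\<integral>\<^sup>+x. G \<xi> x \<partial>\<mu>) \<le> indicator (ball 0 1) \<xi> + (A \<xi> + ennreal M * (h (norm \<xi>) * ennreal (sphere_avg \<mu> (norm \<xi>))))"
      using F1[of \<xi>] F2[of \<xi>] by (cases "norm \<xi> < 1") (auto simp: A_def h_def)
  qed
  also have "\<dots> = (\<integral>\<^sup>+\<xi>. indicator (ball (0::'a) 1) \<xi> \<partial>lborel) + ((\<integral>\<^sup>+\<xi>. A \<xi> \<partial>lborel)
      + ennreal M * (\<integral>\<^sup>+(\<xi>::'a). h (norm \<xi>) * ennreal (sphere_avg \<mu> (norm \<xi>)) \<partial>lborel))"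
    (is "?l = ?a + (?b + ?c)")
  proof -
    let ?B = "\<lambda>\<xi>::'a. h (norm \<xi>) * ennreal (sphere_avg \<mu> (norm \<xi>))"
    have Bm: "?B \<in> borel_measurable lborel" using hm' avm by (simp add: borel_measurable_times_ennreal)
    have MBm: "(\<lambda>\<xi>. ennreal M * ?B \<xi>) \<in> borel_measurable lborel" by (intro borel_measurable_times_ennreal borel_measurable_const Bm)
    have Am': "A \<in> borel_measurable lborel" using Am by simp
    have "?l = ?a + (\<integral>\<^sup>+\<xi>. A \<xi> + ennreal M * ?B \<xi> \<partial>lborel)"
      by (rule nn_integral_add) (simp_all only: measurable_lborel2 borel_measurable_indicator borel_open open_ball
        borel_measurable_add[OF Am' MBm, unfolded measurable_lborel2])
    also have "(\<integral>\<^sup>+\<xi>. A \<xi> + ennreal M * ?B \<xi> \<partial>lborel) = ?b + (\<integral>\<^sup>+\<xi>. ennreal M * ?B \<xi> \<partial>lborel)"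
      by (rule nn_integral_add[OF Am' MBm])
    also have "(\<integral>\<^sup>+\<xi>. ennreal M * ?B \<xi> \<partial>lborel) = ?c" by (rule nn_integral_cmult[OF Bm])
    finally show ?thesis .
  qed
  also have "\<dots> < \<infinity>"
    using finA finB emeasure_lborel_ball_finite[of "0::'a" 1] by (simp add: ennreal_mult_less_top)
  finally have "(\<integral>\<^sup>+\<xi>. (\<integral>\<^sup>+x. G \<xi> x \<partial>\<mu>) \<partial>lborel) < \<infinity>" .
  moreover have "(\<integral>\<^sup>+\<xi>. (\<integral>\<^sup>+x. G \<xi> x \<partial>\<mu>) \<partial>lborel) = (\<integral>\<^sup>+x. (\<integral>\<^sup>+\<xi>. G \<xi> x \<partial>lborel) \<partial>\<mu>)"
    using pair.Fubini'[of "\<lambda>x \<xi>. G \<xi> x"] Gm' by (simp add: case_prod_beta')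
  ultimately have "(\<integral>\<^sup>+x. (\<integral>\<^sup>+\<xi>. G \<xi> x \<partial>lborel) \<partial>\<mu>) \<noteq> \<infinity>" by simp
  moreover have "(\<lambda>x. \<integral>\<^sup>+\<xi>. G \<xi> x \<partial>lborel) \<in> borel_measurable \<mu>"
    using lborel.borel_measurable_nn_integral_fst[OF Gm'] by simp
  ultimately have "AE x in \<mu>. (\<integral>\<^sup>+\<xi>. G \<xi> x \<partial>lborel) \<noteq> \<infinity>" by (rule nn_integral_PInf_AE[rotated])
  then show ?thesis by (simp add: G_def less_top)
qed

section \<open>Pinned distances and assembly of chains\<close>

lemma fsin_sphere_measure: "fsin sphere_measure (v :: 'a::euclidean_space) = 0"
proof -
  have o: "orthogonal_transformation (uminus :: 'a \<Rightarrow> 'a)" by (simp add: orthogonal_transformation_neg orthogonal_transformation_id[unfolded id_def])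
  have "fsin sphere_measure v = (\<integral>x. sin (2 * pi * (x \<bullet> v)) \<partial>distr sphere_measure borel uminus)"
    by (simp add: fsin_def sphere_measure_orthogonal[OF o])
  also have "\<dots> = (\<integral>x. sin (2 * pi * (- x \<bullet> v)) \<partial>sphere_measure)"
    by (rule integral_distr) (simp_all add: measurable_cong_sets[OF sets_sphere_measure refl])
  also have "\<dots> = - fsin sphere_measure v" by (simp add: fsin_def)
  finally show ?thesis by simp
qed

text \<open>
  The law \<open>m\<close> of \<open>|x - y| \<omega>\<close>, with \<open>y\<close> distributed by \<open>\<mu>\<close> and \<open>\<omega>\<close> uniform on the sphere,
  is the rotation-invariant version of the pinned distance distribution; its Fourier transform is
  \<^const>\<open>sphere_conv\<close> because the Fourier transform of the sphere is radial.
\<close>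
lemma AE_pinned_distance:
  fixes \<mu> :: "(real ^ 'n) measure"
  assumes mu: "borel_prob \<mu>"
    and fin: "(\<integral>\<^sup>+(\<xi>::real ^ 'n). ennreal ((sphere_conv \<mu> (norm \<xi>) x)\<^sup>2) \<partial>lborel) < \<infinity>"
    and N: "N \<in> null_sets lborel"
  shows "AE y in \<mu>. dist x y \<notin> N"
proof -
  interpret prob_space \<mu> using mu by simp
  let ?S = "sphere_measure :: (real ^ 'n) measure"
  interpret pair: pair_sigma_finite \<mu> ?S ..
  interpret pr: prob_space "\<mu> \<Otimes>\<^sub>M ?S" by (rule prob_space_pair) unfold_locales
  have sets_pair: "sets (\<mu> \<Otimes>\<^sub>M ?S) = sets (borel \<Otimes>\<^sub>M borel)"
    by (rule sets_pair_measure_cong[OF borel_probD(3)[OF mu] sets_sphere_measure])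
  define g where "g p = dist x (fst p) *\<^sub>R snd p" for p :: "(real ^ 'n) \<times> (real ^ 'n)"
  have gb: "g \<in> borel_measurable (borel \<Otimes>\<^sub>M borel)" unfolding g_def[abs_def] by measurable
  have gm: "g \<in> borel_measurable (\<mu> \<Otimes>\<^sub>M ?S)" using gb by (simp only: measurable_cong_sets[OF sets_pair refl])
  define m where "m = distr (\<mu> \<Otimes>\<^sub>M ?S) borel g"
  have m: "borel_prob m" unfolding m_def using pr.prob_space_distr[OF gm] by simp
  have fubini: "(\<integral>z. f z \<partial>m) = (\<integral>y. \<integral>\<omega>. f (dist x y *\<^sub>R \<omega>) \<partial>?S \<partial>\<mu>)"
    if f: "f \<in> borel_measurable borel" "\<And>z. \<bar>f z\<bar> \<le> 1" for f :: "real ^ 'n \<Rightarrow> real"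
  proof -
    have "(\<integral>z. f z \<partial>m) = (\<integral>p. f (g p) \<partial>(\<mu> \<Otimes>\<^sub>M ?S))" unfolding m_def by (rule integral_distr[OF gm f(1)])
    also have "\<dots> = (\<integral>y. \<integral>\<omega>. f (g (y, \<omega>)) \<partial>?S \<partial>\<mu>)"
      by (rule pair.integral_fst'[symmetric], rule integrable_bounded_finite[where B=1])
        (use f measurable_compose[OF gm f(1)] pr.finite_measure_axioms in auto)
    finally show ?thesis by (simp add: g_def)
  qed
  \<comment> \<open>Fubini leaves the transform of the sphere at
    \<open>dist x y *\<^sub>R \<xi>\<close>. This has the same norm as
    \<open>norm \<xi> *\<^sub>R (x - y)\<close>, so radiality gives the integrand of
    \<open>sphere_conv\<close>.\<close>
  have cosine: "fcos m \<xi> = sphere_conv \<mu> (norm \<xi>) x" for \<xi>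
  proof -
    have "fcos m \<xi> = (\<integral>y. fcos ?S (dist x y *\<^sub>R \<xi>) \<partial>\<mu>)"
      unfolding fcos_def by (subst fubini) (auto simp: mult_ac)
    also have "\<dots> = sphere_conv \<mu> (norm \<xi>) x"
      unfolding sphere_conv_def by (intro Bochner_Integration.integral_cong refl fcos_sphere_radial) (simp add: dist_norm)
    finally show ?thesis .
  qed
  have sine: "fsin m \<xi> = 0" for \<xi>
  proof -
    have "fsin m \<xi> = (\<integral>y. fsin ?S (dist x y *\<^sub>R \<xi>) \<partial>\<mu>)"
      unfolding fsin_def by (subst fubini) (auto simp: mult_ac)
    then show ?thesis by (simp add: fsin_sphere_measure)
  qed
  have "(\<integral>\<^sup>+\<xi>. ennreal ((cmod (fourier_measure m \<xi>))\<^sup>2) \<partial>lborel) < \<infinity>"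
    using fin by (simp add: cmod_fourier_measure[OF borel_probD(2,3)[OF m]] cosine sine)
  then have "emeasure m {z. norm z \<in> N} = 0"
    by (rule L2_fourier_absolutely_continuous[OF borel_probD(2,3)[OF m] _ null_norm_vimage[OF N]])
  then have "{z. norm z \<in> N} \<in> null_sets m" 
    using null_setsD2[OF null_norm_vimage[OF N, where 'a="real ^ 'n"]] m by (simp add: null_sets_def)
  then have "AE z in m. norm z \<notin> N" using AE_not_in[of "{z. norm z \<in> N}" m] by simp
  then have "AE p in \<mu> \<Otimes>\<^sub>M ?S. norm (g p) \<notin> N"
    unfolding m_def by (rule AE_distrD[OF gm])
  then have "AE y in \<mu>. AE \<omega> in ?S. norm (g (y, \<omega>)) \<notin> N" by (rule pair.AE_pair)
  then show ?thesis
  proof eventually_elim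
    case (elim y)
    then have "AE \<omega> in ?S. dist x y \<notin> N"
      using AE_sphere_measure by eventually_elim (simp add: g_def)
    then show ?case by simp
  qed
qed

text \<open>\<open>X\<close> is both where the vertices live and a set of good pins, so the vertex
  added last can serve as the next pin. The null set is kept arbitrary in the induction because the
  step replaces it by another one.\<close>

lemma chain_avoiding_null_set:
  fixes \<mu> :: "'a::metric_space measure"
  assumes "prob_space \<mu>" and X: "AE x in \<mu>. x \<in> X"
    and pin: "\<And>x N. x \<in> X \<Longrightarrow> N \<in> null_sets lborel \<Longrightarrow> AE y in \<mu>. dist x y \<notin> N"
  shows "N \<in> null_sets (cube_meas k) \<Longrightarrow> \<exists>y. (\<forall>j\<le>k. y j \<in> X) \<and> chain_map k y \<notin> N"
proof (induction k arbitrary: N)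
  case 0
  interpret prob_space \<mu> by fact
  obtain x where "x \<in> X" using eventually_happens'[OF ae_filter_bot X] by blast
  \<comment> \<open>The product over no coordinates is a single point of mass 1, so its only null
    set is empty.\<close>
  moreover have "(\<lambda>_. undefined) \<notin> N"
  proof
    assume u: "(\<lambda>_. undefined) \<in> N"
    have "N \<subseteq> space (cube_meas 0)" using 0 by (auto dest: null_setsD2 sets.sets_into_space)
    then have "N = {\<lambda>_. undefined}" using u by (auto simp: space_PiM)
    then show False using 0 by (simp add: null_sets_def PiM_empty)
  qed
  ultimately show ?case by (intro exI[of _ "\<lambda>_. x"]) (simp add: chain_map_def restrict_def)
next
  case (Suc k)
  interpret prob_space \<mu> by fact
  interpret product_sigma_finite "\<lambda>_ :: nat. lborel :: real measure" ..
  let ?M = "cube_meas k"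
  have N: "N \<in> sets (Pi\<^sub>M (insert k {..<k}) (\<lambda>_. lborel))" "emeasure (Pi\<^sub>M (insert k {..<k}) (\<lambda>_. lborel)) N = 0"
    using Suc.prems by (auto simp: lessThan_Suc)
  have upd: "(\<lambda>p. (fst p)(k := snd p)) \<in> measurable (?M \<Otimes>\<^sub>M lborel) (Pi\<^sub>M (insert k {..<k}) (\<lambda>_. lborel :: real measure))"
    using measurable_add_dim[of k "{..<k}" "\<lambda>_. lborel :: real measure"] by (simp add: case_prod_beta')
  define h where "h f = (\<integral>\<^sup>+t. indicator N (f(k := t)) \<partial>lborel)" for f :: "nat \<Rightarrow> real"
  have im: "(\<lambda>p. indicator N ((fst p)(k := snd p)) :: ennreal) \<in> borel_measurable (?M \<Otimes>\<^sub>M lborel)"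
    by (rule measurable_compose[OF upd]) (rule borel_measurable_indicator[OF N(1)])
  have hm: "h \<in> borel_measurable ?M"
    using lborel.borel_measurable_nn_integral_fst[OF im] by (simp add: h_def[abs_def])
  have "0 = (\<integral>\<^sup>+f. indicator N f \<partial>Pi\<^sub>M (insert k {..<k}) (\<lambda>_. lborel))" using N by simp
  also have "\<dots> = (\<integral>\<^sup>+f. h f \<partial>?M)"
    unfolding h_def using N(1) by (intro product_nn_integral_insert) auto
  finally have "AE f in ?M. h f = 0" using nn_integral_0_iff_AE[OF hm] by simp
  \<comment> \<open>\<open>N'\<close> contains the prefixes over which the fibre of \<open>N\<close>
    has positive length. A shorter chain avoiding it leaves only a null set \<open>S\<close> of
    forbidden last distances.\<close>
  then obtain N' where N': "N' \<in> null_sets ?M" "{f \<in> space ?M. h f \<noteq> 0} \<subseteq> N'"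
    by (auto simp: eventually_ae_filter)
  obtain y where y: "\<forall>j\<le>k. y j \<in> X" "chain_map k y \<notin> N'" using Suc.IH[OF N'(1)] by blast
  define f where "f = chain_map k y"
  have fs: "f \<in> space ?M" by (simp add: f_def chain_map_space)
  have h0: "h f = 0" using y(2) N'(2) fs by (auto simp: f_def)
  define S where "S = {t. f(k := t) \<in> N}"
  have S: "S \<in> null_sets lborel"
  proof -
    have upd1: "(\<lambda>t. f(k := t)) \<in> measurable lborel (Pi\<^sub>M (insert k {..<k}) (\<lambda>_. lborel :: real measure))"
      using measurable_compose[OF measurable_Pair1'[OF fs] upd] by simp
    have Sm: "S \<in> sets lborel" using measurable_sets[OF upd1 N(1)] by (simp add: S_def vimage_def)
    have "emeasure lborel S = (\<integral>\<^sup>+t. indicator S t \<partial>lborel)" using Sm by simp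
    also have "\<dots> = h f" unfolding h_def S_def by (intro nn_integral_cong) (simp add: indicator_def)
    finally show ?thesis using Sm h0 by (intro null_setsI) auto
  qed
  have "AE z in \<mu>. z \<in> X \<and> dist (y k) z \<notin> S" using X pin[OF _ S, of "y k"] y(1) by auto
  then obtain z where z: "z \<in> X" "dist (y k) z \<notin> S" using eventually_happens'[OF ae_filter_bot] by blast
  show ?case
  proof (intro exI[of _ "y(Suc k := z)"] conjI allI impI)
    show "(y(Suc k := z)) j \<in> X" if "j \<le> Suc k" for j using that y(1) z by (auto simp: le_Suc_eq)
    have "chain_map (Suc k) (y(Suc k := z)) = f(k := dist (y k) z)"
      by (auto simp: chain_map_def f_def fun_eq_iff restrict_def less_Suc_eq)
    then show "chain_map (Suc k) (y(Suc k := z)) \<notin> N" using z by (simp add: S_def)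
  qed
qed

text \<open>The point mass at the origin satisfies the Frostman condition with exponent 0, and its
  transform has modulus 1 everywhere, so no decay is possible. This rules out dimension 0 in the
  main argument.\<close>

lemma spherical_average_exponent_0:
  assumes est: "spherical_average_estimate TYPE('a::euclidean_space) \<beta>"
  shows "\<beta> 0 \<le> 0"
proof (rule ccontr)
  assume "\<not> \<beta> 0 \<le> 0"
  then have b: "\<beta> 0 > 0" by simp
  define \<mu> where "\<mu> = return borel (0 :: 'a)"
  have mu: "prob_space \<mu>" "sets \<mu> = sets borel" by (simp_all add: \<mu>_def prob_space_return)
  interpret prob_space \<mu> by fact
  have "measure \<mu> (ball x r) \<le> 1 * r powr 0" if "r > 0" for x r using that by simp
  then have "\<exists>C>0. \<forall>x. \<forall>r>0. measure \<mu> (ball x r) \<le> C * r powr 0" by (intro exI[of _ 1]) simp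
  then obtain C where C: "C > 0" "\<And>r. r \<ge> 1 \<Longrightarrow> sphere_avg \<mu> r \<le> C * r powr (- \<beta> 0 + \<beta> 0 / 2)"
    using est[unfolded spherical_average_estimate_def, rule_format, OF conjI[OF mu(1) conjI[OF mu(2)]], of 0 "\<beta> 0 / 2"] b
    unfolding sphere_avg_def by auto
  have "fourier_measure \<mu> \<xi> = 1" for \<xi>
    unfolding fourier_measure_def \<mu>_def by (subst integral_return) auto
  then have avg: "sphere_avg \<mu> r = 1" for r by (simp add: sphere_avg_def sphere.prob_space)
  \<comment> \<open>Solves \<open>r powr (- \<beta> 0 / 2) = 1 / (C + 1)\<close>, which makes the
    claimed upper bound less than 1.\<close>
  define r where "r = (C + 1) powr (2 / \<beta> 0)"
  have "r \<ge> 1" using C(1) b by (auto simp: r_def intro: ge_one_powr_ge_zero)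
  moreover have "r powr (- \<beta> 0 + \<beta> 0 / 2) = 1 / (C + 1)"
  proof -
    have "2 / \<beta> 0 * (- \<beta> 0 + \<beta> 0 / 2) = - 1" using b by (simp add: field_simps)
    then show ?thesis using C(1) by (simp add: r_def powr_powr powr_minus_divide)
  qed
  ultimately have "1 \<le> C * (1 / (C + 1))" using C(2)[of r] by (simp add: avg)
  then show False using C(1) by (simp add: field_simps)
qed

theorem corollary1p8:
  fixes E :: "(real ^ 'n) set" and \<beta> :: "real \<Rightarrow> real" and k :: nat
  assumes "CARD('n) \<ge> 2"
    and "spherical_average_estimate TYPE(real ^ 'n) \<beta>"
    and "E \<in> sets borel"
    and "hausdorff_dim E + \<beta> (hausdorff_dim E) > real CARD('n)"
    and "k \<ge> 1"
  shows "emeasure (lebesgue_power k) (chain_set k E) > 0"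
proof -
  let ?d = "real CARD('n)"
  define s0 where "s0 = hausdorff_dim E"
  define T where "T = {s. s > 0 \<and> hausdorff_measure s E = 0}"
  have s0T: "s0 = Inf T" by (simp add: s0_def hausdorff_dim_def T_def)
  have large: "s \<in> T" if "s > ?d" for s
    using that hausdorff_measure_large[OF that, of E] by (auto simp: T_def intro: le_less_trans[of 0 ?d])
  have below: "bdd_below T" by (rule bdd_belowI[of _ 0]) (simp add: T_def)
  have s0d: "s0 \<le> ?d"
  proof (rule dense_ge)
    fix s assume "?d < s"
    then show "s0 \<le> s" unfolding s0T using large below by (intro cInf_lower) auto
  qed
  have s0_nonneg: "s0 \<ge> 0"
    unfolding s0T
  proof (rule cInf_greatest)
    show "T \<noteq> {}" using large[of "?d + 1"] by auto
  qed (simp add: T_def)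
  define \<tau> where "\<tau> = s0 + \<beta> s0 - ?d"
  have \<tau>: "\<tau> > 0" using assms(4) by (simp add: \<tau>_def s0_def)
  \<comment> \<open>Frostman's lemma is used with a positive exponent. For \<open>s0 = 0\<close> the
    hypothesis would make \<open>\<beta> 0\<close> larger than the dimension.\<close>
  have "s0 \<noteq> 0"
  proof
    assume "s0 = 0"
    then show False using \<tau> spherical_average_exponent_0[OF assms(2)] by (simp add: \<tau>_def)
  qed
  then have s0: "s0 > 0" using s0_nonneg by simp
  \<comment> \<open>Within \<open>\<tau> / 8\<close> of \<open>s0\<close>, to keep the losses below
    the surplus \<open>\<tau>\<close>; the maximum with \<open>s0 / 2\<close> keeps \<open>s\<close>
    positive.\<close>
  define s where "s = max (s0 / 2) (s0 - \<tau> / 8)"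
  have s: "0 < s" "s < s0" "s0 - s \<le> \<tau> / 8" using s0 \<tau> by (auto simp: s_def max_def)
  have "hausdorff_measure s E \<noteq> 0"
  proof
    assume "hausdorff_measure s E = 0"
    then have "s \<in> T" using s by (simp add: T_def)
    then have "s0 \<le> s" unfolding s0T using below by (rule cInf_lower)
    then show False using s by simp
  qed
  note hm = this
  obtain \<mu> K C where mu: "prob_space \<mu>" "sets \<mu> = sets borel" and K: "compact K" "K \<subseteq> E" "emeasure \<mu> K = 1"
    and C: "C > 0" "\<forall>x r. r > 0 \<longrightarrow> measure \<mu> (ball x r) \<le> C * r powr s"
  proof (rule frostman[OF assms(3) hm s(1)])
    fix \<mu> :: "(real ^ 'n) measure" and K C
    assume "prob_space \<mu>" "sets \<mu> = sets borel" "compact K" "K \<subseteq> E" "emeasure \<mu> K = 1" "C > 0"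
      "\<And>x r. r > 0 \<Longrightarrow> measure \<mu> (ball x r) \<le> C * r powr s"
    then show thesis by (intro that[of \<mu> K C]) auto
  qed
  have bp: "borel_prob \<mu>" using mu by simp
  interpret prob_space \<mu> by fact
  define c where "c = max C 1"
  have c: "c \<ge> 1" by (simp add: c_def)
  have frost: "measure \<mu> (ball x \<rho>) \<le> c * \<rho> powr s" if "\<rho> > 0" for x \<rho>
  proof -
    have "measure \<mu> (ball x \<rho>) \<le> C * \<rho> powr s" using C(2) that by blast
    also have "\<dots> \<le> c * \<rho> powr s" by (intro mult_right_mono) (auto simp: c_def)
    finally show ?thesis .
  qed
  obtain R where R: "R > 0" "K \<subseteq> ball 0 R" using bounded_subset_ballD[OF compact_imp_bounded[OF K(1)]] by blast
  have Kb: "K \<in> sets \<mu>" using mu borel_compact[OF K(1)] by simp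
  have K1: "measure \<mu> K = 1" using K(3) by (simp add: measure_def)
  have "measure \<mu> K \<le> measure \<mu> (ball 0 R)" using R(2) mu by (intro finite_measure_mono) auto
  then have ball: "measure \<mu> (ball 0 R) = 1" using K1 prob_le_1[of "ball 0 R"] by simp
  have aeK: "AE x in \<mu>. x \<in> K" using K1 Kb by (subst (asm) prob_eq_1) auto
  \<comment> \<open>The decay exponent after smoothing, with \<open>\<epsilon> = \<tau> / 8\<close>.
    Its excess over the dimension minus \<open>s\<close> is
    \<open>\<tau> - 2 * (s0 - s) - \<tau> / 8\<close>, hence at least \<open>5 * \<tau> / 8\<close>;
    the gap \<open>s0 - s\<close> enters twice, once through smoothing and once through the
    energy.\<close>
  define b where "b = - (s0 - s - \<beta> s0 + \<tau> / 8)"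
  have b: "b > real DIM(real ^ 'n) - s" 
  proof -
    have "\<beta> s0 = \<tau> - s0 + ?d" by (simp add: \<tau>_def)
    then show ?thesis using s(3) \<tau> by (simp add: b_def)
  qed
  have le: "0 \<le> s" "s \<le> s0" "s0 \<le> real DIM(real ^ 'n)" "\<tau> / 8 > 0" using s s0d \<tau> by auto
  have ae: "AE x in \<mu>. (\<integral>\<^sup>+(\<xi>::real ^ 'n). ennreal ((sphere_conv \<mu> (norm \<xi>) x)\<^sup>2) \<partial>lborel) < \<infinity>"
  proof (rule sphere_avg_frostman_bound[OF assms(2) le])
    fix D :: real
    assume D: "D > 0"
      "\<And>(\<mu> :: (real ^ 'n) measure) R c (r :: real). borel_prob \<mu> \<Longrightarrow> R > 0 \<Longrightarrow> measure \<mu> (ball 0 R) = 1 \<Longrightarrow> c \<ge> 1 \<Longrightarrow> r \<ge> 1 \<Longrightarrow>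
        (\<And>x \<rho>. \<rho> > 0 \<Longrightarrow> measure \<mu> (ball x \<rho>) \<le> c * \<rho> powr s) \<Longrightarrow>
        sphere_avg \<mu> r \<le> D * c * r powr (s0 - s - \<beta> s0 + \<tau> / 8)"
    show ?thesis
    proof (rule AE_sphere_conv_square_finite[OF bp ball c s(1) frost D(1) b])
      show "s \<le> real DIM(real ^ 'n)" using le by linarith
      fix \<nu> :: "(real ^ 'n) measure" and c' r :: real
      assume "borel_prob \<nu>" "measure \<nu> (ball 0 R) = 1" "c' \<ge> 1" "r \<ge> 1"
        "\<And>x \<rho>. \<rho> > 0 \<Longrightarrow> measure \<nu> (ball x \<rho>) \<le> c' * \<rho> powr s"
      from D(2)[OF this(1) R(1) this(2-5)] have "sphere_avg \<nu> r \<le> D * c' * r powr (s0 - s - \<beta> s0 + \<tau> / 8)" .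
      moreover have "- b = s0 - s - \<beta> s0 + \<tau> / 8" by (simp add: b_def)
      ultimately show "sphere_avg \<nu> r \<le> D * r powr (- b) * c'" by (simp only: mult_ac)
    qed
  qed
  \<comment> \<open>Membership in \<open>K\<close> keeps the vertices inside \<open>E\<close>; the
    finite integral makes each of them a good pin.\<close>
  define X where "X = {x \<in> K. (\<integral>\<^sup>+(\<xi>::real ^ 'n). ennreal ((sphere_conv \<mu> (norm \<xi>) x)\<^sup>2) \<partial>lborel) < \<infinity>}"
  have aeX: "AE x in \<mu>. x \<in> X" using ae aeK by eventually_elim (simp add: X_def)
  have pin: "AE y in \<mu>. dist x y \<notin> N" if "x \<in> X" "N \<in> null_sets lborel" for x N
    using that by (intro AE_pinned_distance[OF bp]) (auto simp: X_def)
  have meas: "chain_set k E \<in> sets (completion (cube_meas k))"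
    using chain_set_measurable[OF assms(3), of k] by (simp add: lebesgue_power_def)
  show ?thesis
  proof (rule ccontr)
    assume "\<not> ?thesis"
    \<comment> \<open>Measurability is essential here: it turns vanishing \<open>emeasure\<close>
      into a genuine null set of the completion, which lies in a null set of the product measure
      itself.\<close>
    then have "chain_set k E \<in> null_sets (completion (cube_meas k))"
      using meas by (intro null_setsI) (auto simp: lebesgue_power_def)
    then obtain N where N: "N \<in> null_sets (cube_meas k)" "chain_set k E \<subseteq> N"
      by (auto simp: null_sets_completion_iff2)
    obtain y where y: "\<forall>j\<le>k. y j \<in> X" "chain_map k y \<notin> N"
      using chain_avoiding_null_set[OF mu(1) aeX pin N(1)] by blast
    have "\<forall>j\<le>k. y j \<in> E" using y(1) K(2) by (auto simp: X_def)
    then have "chain_map k y \<in> chain_set k E" unfolding chain_set_def chain_map_def by blast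
    then show False using y(2) N(2) by blast
  qed
qed

end
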